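(* Let $U\subset\mathbb R^n$ be open, $I=[0,t_0]$, let $L\colon T\mathbb R^n\times I\to\mathbb R$ be a $C^2$ function whose second-order derivatives are locally Lipschitz, and let $\mu\in\mathscr H$ be a measure closed in $U$ whose support is contained in an open set on which $L_{vv}=\partial^2L/\partial v^2$ is invertible. Assume that there is a constant $c\in\mathbb R$ such that $L+c$ is a $\mu$-minimizable Lagrangian, so that there is a Lipschitz function $f\colon\mathbb R^n\times I\to\mathbb R$, differentiable on $\pi_{\mathbb R^n\times I}(\operatorname{supp}\mu)$ and with $\int df_{(x,t)}(v,\mathbf 1)\,d\mu=0$, such that $L(x,v,t)+c\ge df_{(x,t)}(v,\mathbf 1)$ for all $v$ at every point $(x,t)$ where $f$ is differentiable, with equality throughout $\operatorname{supp}\mu$; assume that $f$ has the additional property that this equality occurs on exactly one point on each fiber over the projected support, i.e. for every $(x,t)\in\pi_{\mathbb R^n\times I}(\operatorname{supp}\mu)$ there is exactly one $v\in T_x\mathbb R^n$ with $L(x,v,t)+c=df_{(x,t)}(v,\mathbf 1)$. Then the minimizer $\mu$ is invariant under the Euler-Lagrange flow of $L$.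
   Context: Coordinates on $T\mathbb R^n\times I\cong\mathbb R^n\times\mathbb R^n\times I$ are $(x,v,t)$; $\pi_{\mathbb R^n\times I}(x,v,t)=(x,t)$; $\mathbf 1=\partial/\partial t$, so $df_{(x,t)}(v,\mathbf 1)=f_x(x,t)\cdot v+f_t(x,t)$. $\mathscr H$ (the measures closed in $U$) is the set of positive, compactly-supported Radon measures $\mu$, supported in $TU\times I$, such that $\int[\phi_x(x,t)\cdot v+\phi_t(x,t)]\,d\mu(x,v,t)=0$ for all $\phi\in C^\infty(U\times I)$ vanishing on $U\times\{0,t_0\}$. Where $L_{vv}$ is invertible, the Euler-Lagrange vector field is $$\mathcal X(x,v,t)=\frac{\partial}{\partial t}+\sum_iv_i\frac{\partial}{\partial x_i}+\sum_{i,k}\Big(L_{x_i}-L_{v_it}-\sum_jv_jL_{x_jv_i}\Big)(L_{vv}^{-1})_{ik}\frac{\partial}{\partial v_k},$$ and the Euler-Lagrange flow is its (local) flow. The measure $\mu$ is invariant under the Euler-Lagrange flow if $\int\mathcal X\varphi\,d\mu=0$ for all $\varphi\in C^\infty_c(TU\times I)$ vanishing on $t=0$ and $t=t_0$. *)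

theory Defs
  imports "HOL-Analysis.Analysis"
begin

section \<open>Differentiability classes on sets that may contain boundary points\<close>

text \<open>
  Functions on \<open>\<real>\<^sup>n \<times> I\<close>, \<open>T\<real>\<^sup>n \<times> I\<close> and the like, with \<open>I = [0, t\<^sub>0]\<close>, are total
  functions of which only the values on the domain \<open>S\<close> matter.  All derivatives are taken
  within \<open>S\<close>, so they are one-sided in the time direction at \<open>t = 0\<close> and \<open>t = t\<^sub>0\<close>.  On the
  sets \<open>S\<close> used here (open times an interval of positive length) such derivatives are unique,
  so \<^const>\<open>frechet_derivative\<close> selects the derivative.
\<close>

definition dir_deriv :: "'a::euclidean_space set \<Rightarrow> 'a \<Rightarrow> ('a \<Rightarrow> real) \<Rightarrow> 'a \<Rightarrow> real" where
  "dir_deriv S e f p = frechet_derivative f (at p within S) e"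

primrec Ck_on :: "nat \<Rightarrow> 'a::euclidean_space set \<Rightarrow> ('a \<Rightarrow> real) \<Rightarrow> bool" where
  "Ck_on 0 S f \<longleftrightarrow> continuous_on S f"
| "Ck_on (Suc k) S f \<longleftrightarrow>
     f differentiable_on S \<and> (\<forall>e\<in>Basis. Ck_on k S (dir_deriv S e f))"

definition smooth_fun_on :: "'a::euclidean_space set \<Rightarrow> ('a \<Rightarrow> real) \<Rightarrow> bool" where
  "smooth_fun_on S f \<longleftrightarrow> (\<forall>k. Ck_on k S f)"

definition locally_lipschitz_on :: "'a::metric_space set \<Rightarrow> ('a \<Rightarrow> real) \<Rightarrow> bool" where
  "locally_lipschitz_on S g \<longleftrightarrow> (\<forall>p\<in>S. \<exists>r>0. \<exists>C. C-lipschitz_on (S \<inter> cball p r) g)"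

definition C2_Lip_on :: "'a::euclidean_space set \<Rightarrow> ('a \<Rightarrow> real) \<Rightarrow> bool" where
  "C2_Lip_on S f \<longleftrightarrow> Ck_on 2 S f \<and>
     (\<forall>e\<in>Basis. \<forall>e'\<in>Basis. locally_lipschitz_on S (dir_deriv S e (dir_deriv S e' f)))"


section \<open>Phase space\<close>

text \<open>Points of \<open>T\<real>\<^sup>n \<times> I\<close> are triples \<open>(x, v, t)\<close>.\<close>

type_synonym 'n phase = "(real ^ 'n) \<times> (real ^ 'n) \<times> real"

definition base :: "(real ^ 'n) set \<Rightarrow> real \<Rightarrow> ((real ^ 'n) \<times> real) set" where
  "base U t0 = U \<times> {0..t0}"

definition phase :: "(real ^ 'n) set \<Rightarrow> real \<Rightarrow> ('n::finite) phase set" where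
  "phase U t0 = U \<times> UNIV \<times> {0..t0}"

definition proj_base :: "('n::finite) phase \<Rightarrow> (real ^ 'n) \<times> real" where
  "proj_base = (\<lambda>(x, v, t). (x, t))"

text \<open>\<open>total_deriv U t\<^sub>0 f (x, v, t)\<close> is \<open>df\<^sub>(\<^sub>x\<^sub>,\<^sub>t\<^sub>)(v, \<one>) = f\<^sub>x(x,t) \<cdot> v + f\<^sub>t(x,t)\<close>.\<close>

definition total_deriv ::
  "(real ^ 'n) set \<Rightarrow> real \<Rightarrow> ((real ^ 'n) \<times> real \<Rightarrow> real) \<Rightarrow> ('n::finite) phase \<Rightarrow> real" where
  "total_deriv U t0 f = (\<lambda>(x, v, t). frechet_derivative f (at (x, t) within base U t0) (v, 1))"


section \<open>Closed measures\<close>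

definition radon_measure :: "'a::euclidean_space measure \<Rightarrow> bool" where
  "radon_measure \<mu> \<longleftrightarrow> sets \<mu> = sets borel \<and>
     (\<forall>K. compact K \<longrightarrow> emeasure \<mu> K < \<infinity>) \<and>
     (\<forall>B\<in>sets borel. emeasure \<mu> B = (SUP K\<in>{K. compact K \<and> K \<subseteq> B}. emeasure \<mu> K))"

definition msupport :: "'a::topological_space measure \<Rightarrow> 'a set" where
  "msupport \<mu> = {p. \<forall>V. open V \<and> p \<in> V \<longrightarrow> emeasure \<mu> V > 0}"

text \<open>
  Measures on \<open>TU \<times> I\<close> are Borel measures on the ambient Euclidean space whose support lies in
  \<open>TU \<times> I\<close>.  The support has full measure; integrals are restricted to it because the
  integrands are only meaningful there, and arbitrary values elsewhere could destroy
  measurability, which would make the Bochner integral 0 by convention.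
\<close>

definition closed_in :: "(real ^ 'n) set \<Rightarrow> real \<Rightarrow> ('n::finite) phase measure \<Rightarrow> bool" where
  "closed_in U t0 \<mu> \<longleftrightarrow>
     radon_measure \<mu> \<and> compact (msupport \<mu>) \<and> msupport \<mu> \<subseteq> phase U t0 \<and>
     (\<forall>\<phi>. smooth_fun_on (base U t0) \<phi> \<and> (\<forall>x\<in>U. \<phi> (x, 0) = 0 \<and> \<phi> (x, t0) = 0) \<longrightarrow>
        (LINT p:msupport \<mu>|\<mu>. total_deriv U t0 \<phi> p) = 0)"


section \<open>Minimizable Lagrangians\<close>

text \<open>\<open>minimizable_by t\<^sub>0 \<mu> L f\<close>: the function \<open>f\<close> witnesses that \<open>L\<close> is \<open>\<mu>\<close>-minimizable.\<close>

definition minimizable_by ::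
  "real \<Rightarrow> ('n::finite) phase measure \<Rightarrow> ('n phase \<Rightarrow> real) \<Rightarrow> ((real ^ 'n) \<times> real \<Rightarrow> real) \<Rightarrow> bool"
where
  "minimizable_by t0 \<mu> L f \<longleftrightarrow>
     (\<exists>C. C-lipschitz_on (base UNIV t0) f) \<and>
     (\<forall>q \<in> proj_base ` msupport \<mu>. f differentiable (at q within base UNIV t0)) \<and>
     (LINT p:msupport \<mu>|\<mu>. total_deriv UNIV t0 f p) = 0 \<and>
     (\<forall>x t v. (x, t) \<in> base UNIV t0 \<and> f differentiable (at (x, t) within base UNIV t0) \<longrightarrow>
        L (x, v, t) \<ge> total_deriv UNIV t0 f (x, v, t)) \<and>
     (\<forall>p \<in> msupport \<mu>. L p = total_deriv UNIV t0 f p)"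


section \<open>The Euler-Lagrange vector field\<close>

definition unit_x :: "'n \<Rightarrow> ('n::finite) phase" where
  "unit_x i = (axis i 1, 0, 0)"

definition unit_v :: "'n \<Rightarrow> ('n::finite) phase" where
  "unit_v i = (0, axis i 1, 0)"

definition unit_t :: "('n::finite) phase" where
  "unit_t = (0, 0, 1)"

abbreviation pd :: "real \<Rightarrow> ('n::finite) phase \<Rightarrow> ('n phase \<Rightarrow> real) \<Rightarrow> 'n phase \<Rightarrow> real" where
  "pd t0 \<equiv> dir_deriv (phase UNIV t0)"

definition Lvv :: "real \<Rightarrow> (('n::finite) phase \<Rightarrow> real) \<Rightarrow> 'n phase \<Rightarrow> real ^ 'n ^ 'n" where
  "Lvv t0 L p = (\<chi> i k. pd t0 (unit_v k) (pd t0 (unit_v i) L) p)"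

definition EL_field :: "real \<Rightarrow> (('n::finite) phase \<Rightarrow> real) \<Rightarrow> 'n phase \<Rightarrow> 'n phase" where
  "EL_field t0 L = (\<lambda>(x, v, t).
     let p = (x, v, t) in
     (v,
      \<chi> k. \<Sum>i\<in>UNIV.
        (pd t0 (unit_x i) L p - pd t0 unit_t (pd t0 (unit_v i) L) p
          - (\<Sum>j\<in>UNIV. v $ j * pd t0 (unit_x j) (pd t0 (unit_v i) L) p))
        * matrix_inv (Lvv t0 L p) $ i $ k,
      1))"

text \<open>
  Test functions are smooth on \<open>TU \<times> I\<close> with compact support in \<open>TU \<times> I\<close> (not
  necessarily vanishing near the ends of \<open>I\<close>).
\<close>

definition test_fun :: "(real ^ 'n) set \<Rightarrow> real \<Rightarrow> (('n::finite) phase \<Rightarrow> real) \<Rightarrow> bool" where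
  "test_fun U t0 \<phi> \<longleftrightarrow> smooth_fun_on (phase U t0) \<phi> \<and>
     (\<exists>K. compact K \<and> K \<subseteq> phase U t0 \<and> (\<forall>p \<in> phase U t0 - K. \<phi> p = 0))"

definition EL_invariant ::
  "(real ^ 'n) set \<Rightarrow> real \<Rightarrow> (('n::finite) phase \<Rightarrow> real) \<Rightarrow> 'n phase measure \<Rightarrow> bool" where
  "EL_invariant U t0 L \<mu> \<longleftrightarrow>
     (\<forall>\<phi>. test_fun U t0 \<phi> \<and> (\<forall>x\<in>U. \<forall>v. \<phi> (x, v, 0) = 0 \<and> \<phi> (x, v, t0) = 0) \<longrightarrow>
        (LINT p:msupport \<mu>|\<mu>. dir_deriv (phase U t0) (EL_field t0 L p) \<phi> p) = 0)"

end

theory Submission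
  imports Defs
begin

text \<open>
  Let \<open>p = L\<^sub>v\<close> be the momentum. On the support, \<open>L + c - df\<close> vanishes and is minimal along the fiber, so
  \<open>p = f\<^sub>x\<close> there and \<open>L\<^sub>v\<^sub>v\<close> is positive definite. By Rademacher's theorem the inequality
  \<open>df(v, 1) \<le> L + c\<close> passes, up to a small error, to \<open>C\<^sup>1\<close> mollifications of \<open>f\<close>, to whose spatial
  translates closedness applies. Translating by \<open>\<plusminus> h\<close> shows that the deficits in the translated
  inequalities have integral \<open>o(h)\<close>; hence the difference quotients of \<open>f\<close> in \<open>x\<close>, which converge to
  \<open>p\<close>, have derivatives along \<open>(v, 1)\<close> converging to \<open>L\<^sub>x\<close> in \<open>L\<^sup>1(\<mu>)\<close>. This strong convergence
  justifies the chain rule for \<open>C\<^sup>1\<close> functions of \<open>(x, t, p)\<close>, although the velocity field on the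
  support is only continuous. As the support is a graph over the base, \<open>v\<close> is recovered from
  \<open>(x, t, p)\<close> by a gradient descent that starts at a polynomial approximation of the velocity field and
  converges together with its derivative; the limit of the derivatives is the Euler-Lagrange
  acceleration.
\<close>

section \<open>Rademacher's theorem\<close>

text \<open>The obstacle is a mismatch of test functions: closedness concerns functions of (x, t),
  invariance functions of (x, v, t). A test function becomes admissible once v is replaced by a C^1
  function V of (x, t), and this helps only if the derivative of V along (v, 1) approximates the
  acceleration. The velocity field on the support has uniform approximations, but nothing is known
  about their derivatives. The momentum does better, because the deficit in df <= L + c is least,
  namely 0, on the support, which constrains the translates of f to first order. Velocity is then
  recovered by an iteration that contracts errors of the derivative at the same rate as errors of
  the value; the starting field may have any derivative, since its error is forgotten in the limit.

  Smoothness of a test function is checked only for polynomials; a Weierstrass theorem in C^1 then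
  reaches all C^1 functions that vanish near the ends of I. The ends themselves carry no mass, and
  the cutoffs in time disappear because the test function is of the order of the distance to the
  ends.\<close>

lemma Lipschitz_right_derivative_AE:
  fixes g :: "real \<Rightarrow> real"
  assumes "C-lipschitz_on UNIV g"
  obtains N where "negligible N"
    "\<And>x. x \<notin> N \<Longrightarrow> \<exists>D. ((\<lambda>h. (g (x + h) - g x) / h) \<longlongrightarrow> D) (at_right 0)"
proof -
  have C: "C \<ge> 0" and lip: "\<bar>g x - g y\<bar> \<le> C * \<bar>x - y\<bar>" for x y
    using assms by (auto simp: lipschitz_on_def dist_real_def)
  \<comment> \<open>Adding \<open>(C + 1) * x\<close> brings all slopes between 1 and
    \<open>2 * C + 1\<close>, so \<open>F\<close> is an increasing bi-Lipschitz bijection of the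
    line.\<close>
  define F where "F = (\<lambda>x. g x + (C + 1) * x)"
  have F_ge: "F y - F x \<ge> y - x" if "x \<le> y" for x y
  proof -
    have "g y - g x \<ge> - (C * (y - x))" using lip[of y x] that by (simp add: abs_le_iff)
    then show ?thesis by (simp add: F_def algebra_simps)
  qed
  have F_le: "\<bar>F y - F x\<bar> \<le> (2 * C + 1) * \<bar>y - x\<bar>" for x y
  proof -
    have "\<bar>F y - F x\<bar> \<le> \<bar>g y - g x\<bar> + \<bar>(C + 1) * (y - x)\<bar>"
      unfolding F_def by (simp add: algebra_simps)
    also have "\<dots> \<le> C * \<bar>y - x\<bar> + (C + 1) * \<bar>y - x\<bar>"
      using lip[of y x] C by (simp add: abs_mult)
    finally show ?thesis by (simp add: algebra_simps)
  qed
  have cont: "continuous_on UNIV F"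
    by (rule lipschitz_on_continuous_on[where L="2*C+1"])
       (use F_le C in \<open>auto simp: lipschitz_on_def dist_real_def\<close>)
  have inj: "inj F"
  proof (rule injI)
    fix x y assume "F x = F y"
    then show "x = y" using F_ge[of x y] F_ge[of y x] by linarith
  qed
  have surj: "surj F"
  proof (unfold surj_def, intro allI)
    fix y
    define b where "b = \<bar>y - F 0\<bar>"
    have "F (-b) \<le> y" "y \<le> F b" "-b \<le> b" using F_ge[of 0 b] F_ge[of "-b" 0] by (auto simp: b_def)
    from IVT'[OF this continuous_on_subset[OF cont]] show "\<exists>x. y = F x" by auto
  qed
  define G where "G = inv F"
  have FG [simp]: "F (G y) = y" and GF [simp]: "G (F x) = x" for x y
    using inj surj by (auto simp: G_def surj_f_inv_f)
  have Glip: "\<bar>G a - G b\<bar> \<le> \<bar>a - b\<bar>" for a b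
    using F_ge[of "G a" "G b"] F_ge[of "G b" "G a"] by (cases "G a \<le> G b") auto
  have Gcont: "continuous_on UNIV G"
    by (rule lipschitz_on_continuous_on[where L=1]) (use Glip in \<open>auto simp: lipschitz_on_def dist_real_def\<close>)
  then have Gm [measurable]: "G \<in> borel_measurable borel" by (rule borel_measurable_continuous_onI)
  have vim: "G -` A = F ` A" for A by (force simp: image_iff)
  \<comment> \<open>Since \<open>G\<close> inverts \<open>F\<close>, this push-forward is the
    Stieltjes measure of \<open>F\<close>: the mass of \<open>{a..b}\<close> is
    \<open>F b - F a\<close>. The Lipschitz bound on \<open>F\<close> makes it absolutely
    continuous, and its Radon-Nikodym density is the candidate for the derivative.\<close>
  define \<nu> where "\<nu> = distr lborel borel G"
  have ac: "absolutely_continuous lborel \<nu>"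
    unfolding absolutely_continuous_def
  proof
    fix A assume A: "A \<in> null_sets (lborel :: real measure)"
    then have [measurable]: "A \<in> sets borel" by auto
    have "negligible A" using A by (simp add: negligible_iff_null_sets null_sets_completionI)
    then have "negligible (F ` A)"
      by (rule negligible_locally_Lipschitz_image[rotated])
         (use F_le in \<open>auto intro!: exI[of _ UNIV] exI[of _ "2*C+1"]\<close>)
    then have "F ` A \<in> null_sets lborel"
      unfolding vim[symmetric]
      by (metis Gm \<open>A \<in> sets borel\<close> measurable_sets_borel negligible_iff_null_sets null_sets_completion_iff sets_lborel)
    then show "A \<in> null_sets \<nu>"
      by (auto simp: null_sets_def \<nu>_def emeasure_distr vim)
  qed
  obtain r where r [measurable]: "r \<in> borel_measurable lborel" and dens: "density lborel r = \<nu>"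
    using sigma_finite_measure.Radon_Nikodym[OF lborel.sigma_finite_measure_axioms ac]
    by (auto simp: \<nu>_def)
  define \<rho> where "\<rho> = (\<lambda>x. enn2real (r x))"
  have [measurable]: "\<rho> \<in> borel_measurable lborel" unfolding \<rho>_def by measurable
  have hi: "(\<rho> has_integral (F b - F a)) {a..b}" if "a \<le> b" for a b
  proof -
    have ivl: "F ` {a..b} = {F a..F b}"
    proof safe
      fix y assume y: "y \<in> {F a..F b}"
      have "a \<le> G y" using F_ge[of "G y" a] y by (cases "a \<le> G y") auto
      moreover have "G y \<le> b" using F_ge[of b "G y"] y by (cases "G y \<le> b") auto
      ultimately show "y \<in> F ` {a..b}" by (auto intro!: image_eqI[of _ _ "G y"])
    next
      fix x assume "x \<in> {a..b}"
      then show "F x \<in> {F a..F b}" using F_ge[of a x] F_ge[of x b] by auto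
    qed
    have "(\<integral>\<^sup>+x. r x * indicator {a..b} x \<partial>lborel) = emeasure \<nu> {a..b}"
      by (simp add: dens[symmetric] emeasure_density)
    also have "\<dots> = ennreal (F b - F a)"
      using F_ge[of a b] that by (simp add: \<nu>_def emeasure_distr vim ivl)
    finally have nn: "(\<integral>\<^sup>+x. r x * indicator {a..b} x \<partial>lborel) = ennreal (F b - F a)" .
    then have "AE x in lborel. r x * indicator {a..b} x \<noteq> \<infinity>"
      by (intro nn_integral_noteq_infinite) auto
    then have "AE x in lborel. ennreal (\<rho> x * indicator {a..b} x) = r x * indicator {a..b} x"
      by eventually_elim (auto simp: \<rho>_def indicator_def ennreal_enn2real_if)
    then have "(\<integral>\<^sup>+x. ennreal (\<rho> x * indicator {a..b} x) \<partial>lborel) = ennreal (F b - F a)"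
      using nn by (subst nn_integral_cong_AE) auto
    then have "has_bochner_integral lborel (\<lambda>x. \<rho> x * indicator {a..b} x) (F b - F a)"
      using F_ge[of a b] that
      by (intro has_bochner_integral_nn_integral) (auto simp: \<rho>_def)
    then have "((\<lambda>x. \<rho> x * indicator {a..b} x) has_integral (F b - F a)) UNIV"
      using has_integral_integral_lborel[of "\<lambda>x. \<rho> x * indicator {a..b} x"]
      by (simp add: has_bochner_integral_iff)
    moreover have "(\<lambda>x. \<rho> x * indicator {a..b} x) = (\<lambda>x. if x \<in> {a..b} then \<rho> x else 0)"
      by (auto simp: indicator_def)
    ultimately show ?thesis
      by (simp only: has_integral_restrict_UNIV)
  qed
  have "\<rho> integrable_on cbox a b" for a b
    using hi[of a b] by (cases "a \<le> b") (simp_all add: has_integral_integrable)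
  \<comment> \<open>The differentiation theorem averages over cubes with lower corner
    \<open>x\<close>, on the line over \<open>{x..x + h}\<close>; this is why right derivatives come
    out.\<close>
  from integrable_ccontinuous_explicit[OF this] obtain N where N: "negligible N"
    "\<And>x e. \<lbrakk>x \<notin> N; 0 < e\<rbrakk> \<Longrightarrow> \<exists>d>0. \<forall>h. 0 < h \<and> h < d \<longrightarrow>
        norm (integral (cbox x (x + h *\<^sub>R One)) \<rho> /\<^sub>R h ^ DIM(real) - \<rho> x) < e" by metis
  show thesis
  proof (rule that[OF N(1)])
    fix x assume x: "x \<notin> N"
    have "((\<lambda>h. (F (x + h) - F x) / h) \<longlongrightarrow> \<rho> x) (at_right 0)"
      unfolding tendsto_iff eventually_at_right_field
    proof (intro allI impI)
      fix e :: real assume "e > 0"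
      from N(2)[OF x this] obtain d where d: "d > 0" "\<And>h. 0 < h \<Longrightarrow> h < d \<Longrightarrow>
         norm (integral (cbox x (x + h *\<^sub>R One)) \<rho> /\<^sub>R h ^ DIM(real) - \<rho> x) < e" by blast
      have "dist ((F (x + h) - F x) / h) (\<rho> x) < e" if "0 < h" "h < d" for h
        using d(2)[OF that] integral_unique[OF hi[of x "x + h"]] that
        by (simp add: dist_real_def divide_inverse mult.commute)
      then show "\<exists>b>0. \<forall>y>0. y < b \<longrightarrow> dist ((F (x + y) - F x) / y) (\<rho> x) < e" using d(1) by auto
    qed
    then have "((\<lambda>h. (F (x + h) - F x) / h - (C + 1)) \<longlongrightarrow> \<rho> x - (C + 1)) (at_right 0)"
      by (intro tendsto_intros)
    moreover have "\<forall>\<^sub>F h in at_right 0. (F (x + h) - F x) / h - (C + 1) = (g (x + h) - g x) / h"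
      unfolding eventually_at_right_field
      by (rule exI[of _ 1]) (auto simp: F_def field_simps)
    ultimately have "((\<lambda>h. (g (x + h) - g x) / h) \<longlongrightarrow> \<rho> x - (C + 1)) (at_right 0)"
      by (rule Lim_transform_eventually)
    then show "\<exists>D. ((\<lambda>h. (g (x + h) - g x) / h) \<longlongrightarrow> D) (at_right 0)" by blast
  qed
qed

text \<open>Lebesgue measure is invariant under the shift by \<open>s *\<^sub>R e\<close>. Averaging
  over s in [0, 1] and exchanging the integrals leaves, for each x, the length of the part of a line
  that meets \<open>N\<close>. No coordinates adapted to \<open>e\<close> have to be
  introduced.\<close>

lemma null_set_of_null_on_lines:
  fixes N :: "'a::euclidean_space set" and e :: 'a
  assumes N [measurable]: "N \<in> sets borel"
    and lines: "\<And>x. AE s in lborel. x + s *\<^sub>R e \<notin> N"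
  shows "N \<in> null_sets lborel"
proof -
  have [measurable]: "(\<lambda>(s, x). x + s *\<^sub>R e) \<in> borel_measurable (lborel \<Otimes>\<^sub>M lborel)"
    by (subst measurable_lborel1[symmetric], simp add: lborel_prod)
       (intro borel_measurable_continuous_onI continuous_intros, simp add: split_beta continuous_intros)
  have m: "(\<lambda>(s, x). indicator {0..1} s * indicator N (x + s *\<^sub>R e) :: ennreal) \<in> borel_measurable (lborel \<Otimes>\<^sub>M lborel)"
    by measurable
  have "emeasure lborel N = (\<integral>\<^sup>+s. indicator {0..1::real} s * emeasure lborel N \<partial>lborel)"
    by (simp add: nn_integral_multc)
  also have "\<dots> = (\<integral>\<^sup>+s. indicator {0..1::real} s * (\<integral>\<^sup>+x. indicator N (x + s *\<^sub>R e) \<partial>lborel) \<partial>lborel)"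
  proof (rule nn_integral_cong)
    fix s :: real
    have "emeasure lborel N = (\<integral>\<^sup>+x. indicator N x \<partial>distr lborel borel ((+) (s *\<^sub>R e)))"
      by (simp add: lborel_distr_plus)
    also have "\<dots> = (\<integral>\<^sup>+x. indicator N (x + s *\<^sub>R e) \<partial>lborel)"
      by (subst nn_integral_distr) (auto simp: add.commute)
    finally show "indicator {0..1::real} s * emeasure lborel N =
      indicator {0..1} s * (\<integral>\<^sup>+x. indicator N (x + s *\<^sub>R e) \<partial>lborel)" by simp
  qed
  also have "\<dots> = (\<integral>\<^sup>+s. \<integral>\<^sup>+x. indicator {0..1::real} s * indicator N (x + s *\<^sub>R e) \<partial>lborel \<partial>lborel)"
    by (subst nn_integral_cmult) auto
  also have "\<dots> = (\<integral>\<^sup>+x. \<integral>\<^sup>+s. indicator {0..1::real} s * indicator N (x + s *\<^sub>R e) \<partial>lborel \<partial>lborel)"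
    using lborel_pair.Fubini'[OF m] by simp
  also have "\<dots> = (\<integral>\<^sup>+x. 0 \<partial>(lborel :: 'a measure))"
  proof (rule nn_integral_cong)
    fix x :: 'a
    have "(\<integral>\<^sup>+s. indicator {0..1::real} s * indicator N (x + s *\<^sub>R e) \<partial>lborel) = (\<integral>\<^sup>+s. 0 \<partial>(lborel :: real measure))"
      by (rule nn_integral_cong_AE, use lines[of x] in eventually_elim) auto
    then show "(\<integral>\<^sup>+s. indicator {0..1::real} s * indicator N (x + s *\<^sub>R e) \<partial>lborel) = 0" by simp
  qed
  finally show ?thesis using N by (auto simp: null_sets_def)
qed

text \<open>The steps are restricted to the reciprocals 1 / (n + 1), so that limits are taken over a
  sequence and stay measurable; \<open>Lip_right_quotient_limit\<close> recovers the limit over all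
  h > 0.\<close>

definition diff_quot :: "('a::euclidean_space \<Rightarrow> real) \<Rightarrow> 'a \<Rightarrow> nat \<Rightarrow> 'a \<Rightarrow> real" where
  "diff_quot f e n y = (f (y + (1 / real (Suc n)) *\<^sub>R e) - f y) * real (Suc n)"

text \<open>\<open>lim\<close> is total: where the quotients diverge the value is arbitrary, yet the
  function remains Borel measurable on the whole space.\<close>

definition lim_quot :: "('a::euclidean_space \<Rightarrow> real) \<Rightarrow> 'a \<Rightarrow> 'a \<Rightarrow> real" where
  "lim_quot f e y = lim (\<lambda>n. diff_quot f e n y)"

section \<open>Directional derivatives of a Lipschitz function almost everywhere\<close>

context
  fixes f :: "'a::euclidean_space \<Rightarrow> real" and C :: real
  assumes lip: "C-lipschitz_on UNIV f"
begin

lemma Lip_abs: "\<bar>f x - f y\<bar> \<le> C * norm (x - y)" and Lip_nonneg: "C \<ge> 0"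
  using lip by (auto simp: lipschitz_on_def dist_norm dist_real_def)

lemma diff_quot_bound: "\<bar>diff_quot f e n y\<bar> \<le> C * norm e"
proof -
  have "\<bar>f (y + (1 / real (Suc n)) *\<^sub>R e) - f y\<bar> \<le> C * (norm e / real (Suc n))"
    using Lip_abs[of "y + (1 / real (Suc n)) *\<^sub>R e" y] by simp
  then have "\<bar>f (y + (1 / real (Suc n)) *\<^sub>R e) - f y\<bar> * real (Suc n) \<le> C * norm e"
    by (simp add: pos_le_divide_eq del: of_nat_Suc)
  then show ?thesis
    by (simp add: diff_quot_def abs_mult del: of_nat_Suc)
qed

lemma Lip_measurable [measurable]: "f \<in> borel_measurable borel"
  by (intro borel_measurable_continuous_onI lipschitz_on_continuous_on[OF lip])

lemma diff_quot_measurable [measurable]: "diff_quot f e n \<in> borel_measurable borel"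
  unfolding diff_quot_def by measurable

lemma lim_quot_measurable [measurable]: "lim_quot f e \<in> borel_measurable borel"
  unfolding lim_quot_def by measurable

text \<open>The exceptional set is null on every line parallel to \<open>e\<close>, by the
  one-dimensional statement applied to the restriction of \<open>f\<close> to that line.\<close>

lemma convergent_diff_quot_AE: "AE y in lborel. convergent (\<lambda>n. diff_quot f e n y)"
proof -
  define N where "N = {y. \<not> convergent (\<lambda>n. diff_quot f e n y)}"
  have eq: "N = {y \<in> space borel. \<not> Cauchy (\<lambda>n. diff_quot f e n y)}"
    by (simp add: N_def Cauchy_convergent_iff)
  have [measurable]: "N \<in> sets borel" unfolding eq by measurable
  have "N \<in> null_sets lborel"
  proof (rule null_set_of_null_on_lines)
    fix x
    have "(C * norm e)-lipschitz_on UNIV (\<lambda>s::real. f (x + s *\<^sub>R e))"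
    proof (rule lipschitz_onI)
      fix s t :: real
      have "\<bar>f (x + s *\<^sub>R e) - f (x + t *\<^sub>R e)\<bar> \<le> C * norm ((s - t) *\<^sub>R e)"
        using Lip_abs[of "x + s *\<^sub>R e" "x + t *\<^sub>R e"] by (simp add: scaleR_diff_left)
      then show "dist (f (x + s *\<^sub>R e)) (f (x + t *\<^sub>R e)) \<le> C * norm e * dist s t"
        by (simp add: dist_real_def mult_ac)
    qed (simp add: Lip_nonneg)
    then obtain N' where N': "negligible N'" and *: "\<And>s. s \<notin> N' \<Longrightarrow>
        \<exists>D. ((\<lambda>h. (f (x + (s + h) *\<^sub>R e) - f (x + s *\<^sub>R e)) / h) \<longlongrightarrow> D) (at_right 0)"
      by (rule Lipschitz_right_derivative_AE) blast
    have "AE s in lebesgue. s \<notin> N'" using N' by (auto simp: negligible_iff_null_sets AE_not_in)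
    then have "AE s in lebesgue. x + s *\<^sub>R e \<notin> N"
    proof eventually_elim
      case (elim s)
      then obtain D where D: "((\<lambda>h. (f (x + (s + h) *\<^sub>R e) - f (x + s *\<^sub>R e)) / h) \<longlongrightarrow> D) (at_right 0)"
        using * by blast
      have "filterlim (\<lambda>n. 1 / real (Suc n)) (at_right 0) sequentially"
        by real_asymp
      from filterlim_compose[OF D this]
      have "(\<lambda>n. (f (x + (s + 1 / real (Suc n)) *\<^sub>R e) - f (x + s *\<^sub>R e)) / (1 / real (Suc n))) \<longlonglongrightarrow> D" .
      moreover have "(f (x + (s + 1 / real (Suc n)) *\<^sub>R e) - f (x + s *\<^sub>R e)) / (1 / real (Suc n))
         = diff_quot f e n (x + s *\<^sub>R e)" for n
        by (simp add: diff_quot_def scaleR_add_left add.assoc del: of_nat_Suc)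
      ultimately show ?case by (auto simp: N_def convergent_def)
    qed
    then show "AE s in lborel. x + s *\<^sub>R e \<notin> N" by (simp add: AE_completion_iff)
  qed auto
  then show ?thesis by (auto simp: N_def dest: AE_not_in)
qed

lemma diff_quot_LIMSEQ_AE: "AE y in lborel. (\<lambda>n. diff_quot f e n y) \<longlonglongrightarrow> lim_quot f e y"
  using convergent_diff_quot_AE unfolding lim_quot_def by (simp add: convergent_LIMSEQ_iff)

lemma lim_quot_bound_AE: "AE y in lborel. \<bar>lim_quot f e y\<bar> \<le> C * norm e"
  using diff_quot_LIMSEQ_AE[of e]
proof eventually_elim
  case (elim y)
  then have "(\<lambda>n. \<bar>diff_quot f e n y\<bar>) \<longlonglongrightarrow> \<bar>lim_quot f e y\<bar>" by (rule tendsto_rabs)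
  then show ?case by (rule LIMSEQ_le_const2) (use diff_quot_bound in auto)
qed

lemma lim_quot_set_integrable: "integrable lborel (\<lambda>y. indicator (cbox a b) y * lim_quot f e y)"
proof (rule Bochner_Integration.integrable_bound)
  show "integrable lborel (\<lambda>y. (C * norm e) * indicator (cbox a b) y :: real)"
    by (intro integrable_mult_right integrable_real_indicator) (use emeasure_bounded_finite[OF bounded_cbox, of a b] in auto)
  show "AE y in lborel. norm (indicator (cbox a b) y * lim_quot f e y) \<le> norm (C * norm e * indicator (cbox a b) y)"
    using lim_quot_bound_AE[of e] by eventually_elim (auto simp: indicator_def)
qed auto

text \<open>The step from y by (e + e') / (n + 1) splits into a step along \<open>e'\<close> from y
  and a step along \<open>e\<close> from the displaced point \<open>y + d n\<close>. Pointwise the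
  displacement could matter; under the integral it is moved by translation onto the indicator of the
  box.\<close>

lemma lim_quot_add_integral:
  "(LINT y|lborel. indicator (cbox a b) y * lim_quot f (e + e') y) =
   (LINT y|lborel. indicator (cbox a b) y * lim_quot f e y) + (LINT y|lborel. indicator (cbox a b) y * lim_quot f e' y)"
proof -
  define I where "I = (\<lambda>y. indicator (cbox a b) y :: real)"
  have [measurable]: "I \<in> borel_measurable borel" by (simp add: I_def)
  define d where "d n = (1 / real (Suc n)) *\<^sub>R e'" for n
  have dn: "norm (d n) \<le> norm e'" for n by (simp add: d_def divide_le_eq mult_left_le algebra_simps)
  obtain r where r: "\<And>y. y \<in> cbox a b \<Longrightarrow> norm y \<le> r" using bounded_cbox[of a b] by (auto simp: bounded_iff)
  define J where "J = (\<lambda>y. indicator (cball 0 (r + norm e')) (y::'a) :: real)"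
  have Jint: "integrable lborel (\<lambda>y. (C * norm v) * J y)" for v
    unfolding J_def
    by (intro integrable_mult_right integrable_real_indicator) (use emeasure_bounded_finite[OF bounded_cball, of 0 "r + norm e'"] in auto)
  have IJ: "I (y - d n) \<le> J y" "I y \<le> J y" "0 \<le> I y" "0 \<le> J y" for y n
    using r[of "y - d n"] dn[of n] r[of y] norm_triangle_ineq[of "y - d n" "d n"] norm_ge_zero[of e']
    by (auto simp: I_def J_def indicator_def; smt (verit) norm_ge_zero)+
  have lim1: "(\<lambda>n. LINT y|lborel. I y * diff_quot f v n y) \<longlonglongrightarrow> (LINT y|lborel. I y * lim_quot f v y)" for v
  proof (rule integral_dominated_convergence[where w="\<lambda>y. (C * norm v) * J y"])
    show "AE y in lborel. (\<lambda>n. I y * diff_quot f v n y) \<longlonglongrightarrow> I y * lim_quot f v y"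
      using diff_quot_LIMSEQ_AE[of v] by eventually_elim (intro tendsto_intros)
    show "AE y in lborel. norm (I y * diff_quot f v n y) \<le> C * norm v * J y" for n
      using diff_quot_bound[of v n] IJ
      by (auto simp: abs_mult mult.commute[of "C * norm v"] intro!: mult_mono)
  qed (use Jint in auto)
  \<comment> \<open>Off the frontier, a null set, \<open>I (y - d n)\<close> is eventually equal to
    \<open>I y\<close>, so the displaced box gives the same limit.\<close>
  have "AE y in lborel. y \<notin> frontier (cbox a b)"
    using negligible_frontier_interval[of a b]
    by (auto simp: frontier_cbox negligible_iff_null_sets null_sets_completion_iff dest!: AE_not_in)
  then have Icont: "AE y in lborel. (\<lambda>n. I (y - d n)) \<longlonglongrightarrow> I y"
  proof eventually_elim
    case (elim y)
    have "(\<lambda>n. y - d n) \<longlonglongrightarrow> y - 0 *\<^sub>R e'"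
      unfolding d_def by (intro tendsto_intros) real_asymp
    then have yn: "(\<lambda>n. y - d n) \<longlonglongrightarrow> y" by simp
    have "\<forall>\<^sub>F n in sequentially. I (y - d n) = I y"
    proof (cases "y \<in> cbox a b")
      case True
      with elim have "y \<in> box a b" by (simp add: frontier_cbox)
      from topological_tendstoD[OF yn open_box this]
      show ?thesis by eventually_elim (use True box_subset_cbox in \<open>auto simp: I_def indicator_def\<close>)
    next
      case False
      then have "y \<in> - cbox a b" by simp
      from topological_tendstoD[OF yn _ this] closed_cbox
      have "\<forall>\<^sub>F n in sequentially. y - d n \<in> - cbox a b" by (auto simp: closed_def)
      then show ?thesis by eventually_elim (use False in \<open>auto simp: I_def indicator_def\<close>)
    qed
    then show ?case by (simp add: tendsto_eventually)
  qed
  have lim2: "(\<lambda>n. LINT y|lborel. I (y - d n) * diff_quot f e n y) \<longlonglongrightarrow> (LINT y|lborel. I y * lim_quot f e y)"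
  proof (rule integral_dominated_convergence[where w="\<lambda>y. (C * norm e) * J y"])
    show "AE y in lborel. (\<lambda>n. I (y - d n) * diff_quot f e n y) \<longlonglongrightarrow> I y * lim_quot f e y"
      using diff_quot_LIMSEQ_AE[of e] Icont by eventually_elim (intro tendsto_intros)
    show "AE y in lborel. norm (I (y - d n) * diff_quot f e n y) \<le> C * norm e * J y" for n
      using diff_quot_bound[of e n] IJ
      by (auto simp: abs_mult mult.commute[of "C * norm e"] intro!: mult_mono)
  qed (use Jint in auto)
  have split: "(LINT y|lborel. I y * diff_quot f (e + e') n y) =
     (LINT y|lborel. I (y - d n) * diff_quot f e n y) + (LINT y|lborel. I y * diff_quot f e' n y)" for n
  proof -
    have "(LINT y|lborel. I (y - d n) * diff_quot f e n y) =
        (LINT y|distr lborel borel ((+) (d n)). I (y - d n) * diff_quot f e n y)"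
      by (simp add: lborel_distr_plus)
    also have "\<dots> = (LINT y|lborel. I y * diff_quot f e n (y + d n))"
      by (subst integral_distr) (auto simp: add.commute)
    finally have 1: "(LINT y|lborel. I (y - d n) * diff_quot f e n y) =
       (LINT y|lborel. I y * diff_quot f e n (y + d n))" .
    have int: "integrable lborel (\<lambda>y. I y * diff_quot f v n (y + w))" for v w
    proof (rule Bochner_Integration.integrable_bound[OF Jint[of v]])
      show "AE y in lborel. norm (I y * diff_quot f v n (y + w)) \<le> norm (C * norm v * J y)"
        using diff_quot_bound[of v n] IJ Lip_nonneg
        by (auto simp: abs_mult mult.commute[of "C * norm v"] intro!: mult_mono)
    qed measurable
    have "I y * diff_quot f (e + e') n y = I y * diff_quot f e n (y + d n) + I y * diff_quot f e' n y" for y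
      by (simp add: diff_quot_def d_def algebra_simps scaleR_add_right)
    then show ?thesis
      using int[of e "d n"] int[of e' 0] by (simp add: 1)
  qed
  have "(\<lambda>n. LINT y|lborel. I y * diff_quot f (e + e') n y) \<longlonglongrightarrow>
     (LINT y|lborel. I y * lim_quot f e y) + (LINT y|lborel. I y * lim_quot f e' y)"
    unfolding split by (intro tendsto_add lim1 lim2)
  then show ?thesis using lim1[of "e + e'"] LIMSEQ_unique unfolding I_def by blast
qed

text \<open>The discrepancy has integral 0 over every box, so it vanishes almost everywhere by
  Lebesgue differentiation.\<close>

lemma lim_quot_add_AE: "AE y in lborel. lim_quot f (e + e') y = lim_quot f e y + lim_quot f e' y"
proof -
  define F where "F y = lim_quot f (e + e') y - lim_quot f e y - lim_quot f e' y" for y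
  have F: "(F has_integral 0) (cbox a b)" for a b
  proof -
    have i: "integrable lborel (\<lambda>y. indicator (cbox a b) y * F y)"
      using lim_quot_set_integrable by (simp add: F_def right_diff_distrib)
    moreover have "(LINT y|lborel. indicator (cbox a b) y * F y) = 0"
      using lim_quot_add_integral[of a b e e'] lim_quot_set_integrable
      by (simp add: F_def right_diff_distrib)
    ultimately have "((\<lambda>y. indicator (cbox a b) y * F y) has_integral 0) UNIV"
      using has_integral_integral_lborel by metis
    moreover have "(\<lambda>y. indicator (cbox a b) y * F y) = (\<lambda>y. if y \<in> cbox a b then F y else 0)"
      by (auto simp: indicator_def)
    ultimately show ?thesis by (simp only: has_integral_restrict_UNIV)
  qed
  then have "F integrable_on cbox a b" for a b by (auto simp: integrable_on_def)
  from integrable_ccontinuous_explicit[OF this] obtain N where N: "negligible N"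
    "\<And>x e. \<lbrakk>x \<notin> N; 0 < e\<rbrakk> \<Longrightarrow> \<exists>d>0. \<forall>h. 0 < h \<and> h < d \<longrightarrow>
        norm (integral (cbox x (x + h *\<^sub>R One)) F /\<^sub>R h ^ DIM('a) - F x) < e" by metis
  have "F x = 0" if x: "x \<notin> N" for x
  proof (rule ccontr)
    assume "F x \<noteq> 0"
    then obtain d where "d > 0" "\<forall>h. 0 < h \<and> h < d \<longrightarrow>
        norm (integral (cbox x (x + h *\<^sub>R One)) F /\<^sub>R h ^ DIM('a) - F x) < \<bar>F x\<bar>"
      using N(2)[OF x, of "\<bar>F x\<bar>"] by (auto simp only: zero_less_abs_iff)
    from this(2)[rule_format, of "d/2"] this(1) show False
      by (simp add: integral_unique[OF F])
  qed
  moreover have "AE x in lebesgue. x \<notin> N" using N(1) by (auto simp: negligible_iff_null_sets AE_not_in)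
  ultimately have "AE x in lebesgue. F x = 0" by (auto elim: eventually_mono)
  then show ?thesis by (simp add: AE_completion_iff F_def algebra_simps)
qed

end

text \<open>The number n + 1 is the ceiling of 1 / h. The gap between h and 1 / (n + 1) has order
  h^2 and stays negligible after the division by h in a difference quotient.\<close>

lemma finer_than_reciprocals:
  fixes h :: real
  assumes "0 < h" "h < 1"
  obtains n :: nat where "1 / real (Suc n) \<le> h" "h \<le> 1 / real (Suc n) + 2 * h\<^sup>2" "\<bar>1 - 1 / (real (Suc n) * h)\<bar> \<le> 2 * h"
proof -
  define n where "n = nat \<lceil>1 / h\<rceil> - 1"
  have c: "\<lceil>1/h\<rceil> \<ge> 1" using assms by (simp add: one_le_ceiling)
  then have Sn: "real (Suc n) = of_int \<lceil>1/h\<rceil>"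
    by (simp add: n_def of_nat_diff nat_mono_iff) 
  have lo: "1 / h \<le> real (Suc n)" and hi: "real (Suc n) < 1 / h + 1" unfolding Sn by linarith+
  have 1: "1 / real (Suc n) \<le> h"
    using lo assms by (simp add: divide_le_eq mult.commute del: of_nat_Suc) 
  have "h / (1 + h) < 1 / real (Suc n)"
    using hi assms by (simp add: field_simps del: of_nat_Suc)
  moreover have "h / (1 + h) \<ge> h - h\<^sup>2"
    using assms by (simp add: field_simps power2_eq_square)
  ultimately have 2: "h - h\<^sup>2 < 1 / real (Suc n)" by linarith
  have "1 / (real (Suc n) * h) = (1 / real (Suc n)) / h" by simp
  moreover have "(1 / real (Suc n)) / h \<le> 1" using 1 assms by (simp add: pos_divide_le_eq[of h] del: of_nat_Suc divide_divide_eq_left)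
  moreover have "(1 / real (Suc n)) / h \<ge> 1 - h"
  proof -
    have "(1 - h) * h \<le> 1 / real (Suc n)" using 2 by (simp add: algebra_simps power2_eq_square del: of_nat_Suc)
    then show ?thesis using assms by (simp add: le_divide_eq mult_ac del: of_nat_Suc)
  qed
  ultimately have "\<bar>1 - 1 / (real (Suc n) * h)\<bar> \<le> 2 * h" using assms by (simp del: of_nat_Suc)
  moreover have "h \<le> 1 / real (Suc n) + 2 * h\<^sup>2" using 2 zero_le_power2[of h] by linarith
  ultimately show thesis using that 1 by blast
qed

lemma Lip_right_quotient_limit:
  fixes f :: "'a::euclidean_space \<Rightarrow> real"
  assumes lip: "C-lipschitz_on UNIV f"
    and lim: "(\<lambda>n. diff_quot f e n y) \<longlonglongrightarrow> l"
  shows "((\<lambda>h. (f (y + h *\<^sub>R e) - f y) / h) \<longlongrightarrow> l) (at_right 0)"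
proof -
  have Labs: "\<bar>f x - f z\<bar> \<le> C * norm (x - z)" for x z using Lip_abs[OF lip] .
  have C: "C \<ge> 0" using Lip_nonneg[OF lip] .
  show ?thesis
    unfolding tendsto_iff eventually_at_right_field
  proof (intro allI impI)
    fix \<epsilon> :: real assume "\<epsilon> > 0"
    then obtain n0 where n0: "\<And>n. n \<ge> n0 \<Longrightarrow> \<bar>diff_quot f e n y - l\<bar> < \<epsilon> / 2"
      using lim by (metis LIMSEQ_D half_gt_zero real_norm_def)
    \<comment> \<open>Two errors of size \<open>2 * (C * norm e) * h\<close> occur, one from moving
      the endpoint to the nearby reciprocal step, one from dividing by \<open>h\<close> instead of
      that step. The summand 1 keeps \<open>K\<close> positive. In \<open>d\<close>, the bound
      \<open>1 / real (n0 + 2)\<close> forces \<open>n \<ge> n0\<close>.\<close>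
    define K where "K = 4 * (C * norm e) + 1"
    have K: "K > 0" using C by (simp add: K_def add_nonneg_pos)
    define d where "d = min (min (1/2) (1 / real (n0 + 2))) (\<epsilon> / (2 * K))"
    have d2: "d \<le> 1/2" unfolding d_def by linarith
    have d: "d > 0" using \<open>\<epsilon> > 0\<close> K by (simp add: d_def)
    have "dist ((f (y + h *\<^sub>R e) - f y) / h) l < \<epsilon>" if h: "0 < h" "h < d" for h
    proof -
      obtain n where n: "1 / real (Suc n) \<le> h" "h \<le> 1 / real (Suc n) + 2 * h\<^sup>2"
          "\<bar>1 - 1 / (real (Suc n) * h)\<bar> \<le> 2 * h"
        by (rule finer_than_reciprocals[of h]) (use h d2 in auto)
      have "1 / real (Suc n) < 1 / real (n0 + 2)" using n(1) h by (auto simp: d_def)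
      then have "n0 \<le> n" by (simp add: field_simps)
      from n0[OF this] have q: "\<bar>diff_quot f e n y - l\<bar> < \<epsilon> / 2" .
      define s where "s = 1 / real (Suc n)"
      have s: "0 < s" "s \<le> h" "h - s \<le> 2 * h\<^sup>2" using n by (auto simp: s_def)
      have "(f (y + h *\<^sub>R e) - f y) / h - diff_quot f e n y
        = (f (y + h *\<^sub>R e) - f (y + s *\<^sub>R e)) / h - (1 - s / h) * diff_quot f e n y"
      proof -
        have "s * diff_quot f e n y = f (y + s *\<^sub>R e) - f y"
          by (simp add: diff_quot_def s_def del: of_nat_Suc)
        moreover have "(1 - s / h) * diff_quot f e n y = diff_quot f e n y - (s * diff_quot f e n y) / h"
          by (simp add: algebra_simps)
        ultimately show ?thesis by (simp add: diff_divide_distrib)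
      qed
      then have "\<bar>(f (y + h *\<^sub>R e) - f y) / h - diff_quot f e n y\<bar>
        \<le> \<bar>(f (y + h *\<^sub>R e) - f (y + s *\<^sub>R e)) / h\<bar> + \<bar>1 - s / h\<bar> * \<bar>diff_quot f e n y\<bar>"
        by (metis abs_mult abs_triangle_ineq4)
      also have "\<bar>(f (y + h *\<^sub>R e) - f (y + s *\<^sub>R e)) / h\<bar> \<le> (C * norm e) * (2 * h)"
      proof -
        have "\<bar>f (y + h *\<^sub>R e) - f (y + s *\<^sub>R e)\<bar> \<le> C * norm ((h - s) *\<^sub>R e)"
          using Labs[of "y + h *\<^sub>R e" "y + s *\<^sub>R e"] by (simp add: scaleR_diff_left)
        also have "\<dots> = (C * norm e) * (h - s)" using s by (simp add: mult_ac)
        also have "\<dots> \<le> (C * norm e) * (2 * h\<^sup>2)" using s C by (intro mult_left_mono) auto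
        finally have "\<bar>f (y + h *\<^sub>R e) - f (y + s *\<^sub>R e)\<bar> \<le> (C * norm e) * (2 * h) * h"
          by (simp add: power2_eq_square mult_ac)
        then show ?thesis using h by (simp add: divide_le_eq)
      qed
      also have "\<bar>1 - s / h\<bar> * \<bar>diff_quot f e n y\<bar> \<le> (2 * h) * (C * norm e)"
        using n(3) diff_quot_bound[OF lip, of e n y] h by (intro mult_mono) (auto simp: s_def)
      finally have "\<bar>(f (y + h *\<^sub>R e) - f y) / h - diff_quot f e n y\<bar> \<le> (4 * (C * norm e)) * h"
        by (simp add: mult_ac)
      also have "\<dots> \<le> K * h" using h by (simp add: K_def)
      also have "\<dots> < \<epsilon> / 2" using h K by (simp add: d_def field_simps)
      finally show ?thesis unfolding dist_real_def using q by linarith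
    qed
    then show "\<exists>b>0. \<forall>h>0. h < b \<longrightarrow> dist ((f (y + h *\<^sub>R e) - f y) / h) l < \<epsilon>" using d by blast
  qed
qed

text \<open>A countable dense set closed under addition: a single null set serves all these
  directions, and the additivity of the limits can be used inside the set.\<close>

definition rational_points :: "'a::euclidean_space set" where
  "rational_points = {v. \<forall>b\<in>Basis. v \<bullet> b \<in> \<rat>}"

lemma countable_rational_points: "countable (rational_points :: 'a::euclidean_space set)"
proof -
  have "(rational_points :: 'a set) \<subseteq> (\<lambda>g. \<Sum>b\<in>Basis. g b *\<^sub>R b) ` (Basis \<rightarrow>\<^sub>E \<rat>)"
  proof
    fix v :: 'a assume "v \<in> rational_points"
    then show "v \<in> (\<lambda>g. \<Sum>b\<in>Basis. g b *\<^sub>R b) ` (Basis \<rightarrow>\<^sub>E \<rat>)"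
      by (intro image_eqI[of _ _ "restrict (\<lambda>b. v \<bullet> b) Basis"])
         (auto simp: rational_points_def euclidean_representation)
  qed
  moreover have "countable ((Basis :: 'a set) \<rightarrow>\<^sub>E (\<rat> :: real set))"
    by (intro countable_PiE countable_rat finite_Basis)
  ultimately show ?thesis by (meson countable_image countable_subset)
qed

lemma rational_points_dense:
  fixes u :: "'a::euclidean_space"
  assumes "\<eta> > 0" obtains e where "e \<in> rational_points" "norm (u - e) < \<eta>"
proof -
  have "u \<in> closure (\<Union>f \<in> Basis \<rightarrow> \<rat>. { \<Sum>i :: 'a \<in> Basis. f i *\<^sub>R i })"
    by (simp add: closure_rational_coordinates)
  then obtain f where f: "f \<in> Basis \<rightarrow> \<rat>" "dist (\<Sum>i :: 'a \<in> Basis. f i *\<^sub>R i) u < \<eta>"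
    using assms by (auto simp: closure_approachable)
  show thesis
    by (rule that[of "\<Sum>i :: 'a \<in> Basis. f i *\<^sub>R i"])
       (use f in \<open>auto simp: rational_points_def inner_sum_left_Basis dist_norm norm_minus_commute\<close>)
qed

lemma rational_points_add: "a \<in> rational_points \<Longrightarrow> b \<in> rational_points \<Longrightarrow> a + b \<in> rational_points"
  by (auto simp: rational_points_def inner_add_left)

text \<open>At almost every point the limits exist in all rational directions and are additive
  there, hence given by a linear map \<open>l\<close>. Finitely many rational directions form a net
  of the unit sphere; together with the Lipschitz bound this makes the convergence uniform over all
  directions.\<close>

theorem Rademacher:
  fixes f :: "'a::euclidean_space \<Rightarrow> real"
  assumes lip: "C-lipschitz_on UNIV f"
  shows "AE y in lborel. f differentiable (at y)"
proof -
  have Labs: "\<bar>f x - f z\<bar> \<le> C * norm (x - z)" for x z using Lip_abs[OF lip] .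
  have C: "C \<ge> 0" using Lip_nonneg[OF lip] .
  let ?Q = "rational_points :: 'a set"
  have "AE y in lborel. \<forall>e\<in>?Q. (\<lambda>n. diff_quot f e n y) \<longlonglongrightarrow> lim_quot f e y"
    by (subst AE_ball_countable[OF countable_rational_points]) (simp add: diff_quot_LIMSEQ_AE[OF lip])
  moreover have "AE y in lborel. \<forall>e\<in>?Q. \<forall>e'\<in>?Q. lim_quot f (e + e') y = lim_quot f e y + lim_quot f e' y"
    by (intro AE_ball_countable[OF countable_rational_points, THEN iffD2] ballI) (simp add: lim_quot_add_AE[OF lip])
  ultimately show ?thesis
  proof eventually_elim
    case (elim y)
    define D where "D e = lim_quot f e y" for e
    have D: "((\<lambda>h. (f (y + h *\<^sub>R e) - f y) / h) \<longlongrightarrow> D e) (at_right 0)" if "e \<in> ?Q" for e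
      using Lip_right_quotient_limit[OF lip] elim(1) that by (auto simp: D_def)
    have Dadd: "D (e + e') = D e + D e'" if "e \<in> ?Q" "e' \<in> ?Q" for e e'
      using elim(2) that by (auto simp: D_def)
    have [simp]: "0 \<in> ?Q" by (simp add: rational_points_def)
    have D0: "D 0 = 0" using Dadd[of 0 0] by simp
    have Dpos: "D (c *\<^sub>R e) = c * D e" if "e \<in> ?Q" "c *\<^sub>R e \<in> ?Q" "c > 0" for c e
    proof -
      have "filterlim (\<lambda>h. h * c) (at_right 0) (at_right 0)"
        using that(3) by real_asymp
      from filterlim_compose[OF D[OF that(1)] this]
      have "((\<lambda>h. c * ((f (y + (h * c) *\<^sub>R e) - f y) / (h * c))) \<longlongrightarrow> c * D e) (at_right 0)"
        by (intro tendsto_intros)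
      also have "(\<lambda>h. c * ((f (y + (h * c) *\<^sub>R e) - f y) / (h * c))) = (\<lambda>h. (f (y + h *\<^sub>R (c *\<^sub>R e)) - f y) / h)"
        using that(3) by (auto simp: mult.commute[of _ c])
      finally have "((\<lambda>h. (f (y + h *\<^sub>R (c *\<^sub>R e)) - f y) / h) \<longlongrightarrow> c * D e) (at_right 0)" .
      from tendsto_unique[OF trivial_limit_at_right_real D[OF that(2)] this] show ?thesis .
    qed
    have Dscale: "D (q *\<^sub>R b) = q * D b" if q: "q \<in> \<rat>" and b: "b \<in> Basis" for q b
    proof -
      have bQ: "r *\<^sub>R b \<in> ?Q" if "r \<in> \<rat>" for r
        using b that by (auto simp: rational_points_def inner_Basis)
      have bQ1: "b \<in> ?Q" using bQ[of 1] by simp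
      \<comment> \<open>The limits are one-sided, so homogeneity for negative \<open>q\<close> does
        not come from rescaling \<open>h\<close>; it follows from additivity applied to
        \<open>q *\<^sub>R b\<close> and its opposite.\<close>
      consider "q > 0" | "q = 0" | "q < 0" by linarith
      then show ?thesis
      proof cases
        case 3
        have "D (q *\<^sub>R b) + D ((-q) *\<^sub>R b) = D 0"
          using Dadd[OF bQ[OF q], of "(-q) *\<^sub>R b"] bQ[of "-q"] q by simp
        moreover have "D ((-q) *\<^sub>R b) = (-q) * D b" using Dpos[OF bQ1, of "-q"] bQ[of "-q"] q 3 by auto
        ultimately show ?thesis using D0 by simp
      qed (use Dpos bQ bQ1 q D0 in auto)
    qed
    define l where "l v = (\<Sum>b\<in>Basis. (v \<bullet> b) * D b)" for v :: 'a
    have Dl: "D e = l e" if e: "e \<in> ?Q" for e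
    proof -
      have eb: "e \<bullet> b \<in> \<rat>" if "b \<in> Basis" for b using e that by (simp add: rational_points_def)
      have "D (\<Sum>b\<in>A. (e \<bullet> b) *\<^sub>R b) = (\<Sum>b\<in>A. (e \<bullet> b) * D b) \<and> (\<Sum>b\<in>A. (e \<bullet> b) *\<^sub>R b) \<in> ?Q"
        if "A \<subseteq> Basis" "finite A" for A
        using that(2,1)
      proof (induction A rule: finite_induct)
        case (insert b A)
        have "(e \<bullet> b) *\<^sub>R b \<in> ?Q" using insert.prems eb by (auto simp: rational_points_def inner_Basis)
        then show ?case using insert eb by (simp add: Dadd Dscale rational_points_add)
      qed (simp add: D0)
      from this[of Basis] show ?thesis by (simp add: l_def euclidean_representation)
    qed
    have "bounded_linear l"
      unfolding l_def by (intro bounded_linear_sum bounded_linear_mult_const bounded_linear_inner_left_comp bounded_linear_ident)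
    then obtain B where B: "B > 0" "\<And>v. \<bar>l v\<bar> \<le> norm v * B"
      using bounded_linear.pos_bounded[of l] by auto
    have lin: "l (a - b) = l a - l b" "l (c *\<^sub>R a) = c * l a" for a b c
      using \<open>bounded_linear l\<close> by (simp_all add: linear_diff linear_scale bounded_linear.linear)
    have "(f has_derivative l) (at y)"
      unfolding has_derivative_at_alt
    proof (intro conjI allI impI)
      show "bounded_linear l" by fact
      fix \<epsilon> :: real assume "\<epsilon> > 0"
      \<comment> \<open>Replacing a unit direction by one of \<open>T\<close> within
        \<open>\<eta>\<close> changes the quotient of \<open>f\<close> by at most
        \<open>C * \<eta>\<close> and the value of \<open>l\<close> by at most
        \<open>B * \<eta>\<close>; together this is \<open>\<epsilon> / 2\<close>.\<close>
      define \<eta> where "\<eta> = \<epsilon> / (2 * (C + B))"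
      have \<eta>: "\<eta> > 0" using \<open>\<epsilon> > 0\<close> C B by (simp add: \<eta>_def add_nonneg_pos)
      have cov: "sphere 0 1 \<subseteq> (\<Union>e\<in>?Q. ball e \<eta>)"
      proof
        fix u :: 'a
        obtain e where "e \<in> ?Q" "norm (u - e) < \<eta>" using rational_points_dense[OF \<eta>, of u] by blast
        then show "u \<in> (\<Union>e\<in>?Q. ball e \<eta>)" by (intro UN_I[of e]) (auto simp: dist_norm norm_minus_commute)
      qed
      obtain T where T: "T \<subseteq> ?Q" "finite T" "sphere 0 1 \<subseteq> (\<Union>e\<in>T. ball e \<eta>)"
        using compactE_image[OF compact_sphere _ cov] by auto
      have "\<forall>\<^sub>F h in at_right 0. \<forall>e\<in>T. \<bar>(f (y + h *\<^sub>R e) - f y) / h - l e\<bar> < \<epsilon> / 2"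
      proof (intro eventually_ball_finite ballI T)
        fix e assume "e \<in> T"
        then have "((\<lambda>h. (f (y + h *\<^sub>R e) - f y) / h) \<longlongrightarrow> l e) (at_right 0)" using D T Dl by fastforce
        then show "\<forall>\<^sub>F h in at_right 0. \<bar>(f (y + h *\<^sub>R e) - f y) / h - l e\<bar> < \<epsilon> / 2"
          using tendstoD[of _ "l e" _ "\<epsilon>/2"] \<open>\<epsilon> > 0\<close> by (simp add: dist_real_def)
      qed
      then obtain d where d: "d > 0" "\<And>h e. 0 < h \<Longrightarrow> h < d \<Longrightarrow> e \<in> T \<Longrightarrow> \<bar>(f (y + h *\<^sub>R e) - f y) / h - l e\<bar> < \<epsilon> / 2"
        by (auto simp: eventually_at_right_field)
      show "\<exists>d>0. \<forall>x. norm (x - y) < d \<longrightarrow> norm (f x - f y - l (x - y)) \<le> \<epsilon> * norm (x - y)"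
      proof (intro exI[of _ d] conjI allI impI d(1))
        fix x assume x: "norm (x - y) < d"
        show "norm (f x - f y - l (x - y)) \<le> \<epsilon> * norm (x - y)"
        proof (cases "x = y")
          case True
          then show ?thesis using lin(1)[of 0 0] by simp
        next
          case False
          define h where "h = norm (x - y)"
          have h: "0 < h" "h < d" using x False by (auto simp: h_def)
          define u where "u = (x - y) /\<^sub>R h"
          have xu: "x = y + h *\<^sub>R u" using h by (simp add: u_def)
          have "norm u = 1" using h by (simp add: u_def h_def)
          then obtain e where e: "e \<in> T" "norm (u - e) < \<eta>"
            using subsetD[OF T(3), of u] by (auto simp: dist_norm norm_minus_commute)
          have 1: "\<bar>f x - f (y + h *\<^sub>R e)\<bar> \<le> C * \<eta> * h"
          proof -
            have "\<bar>f x - f (y + h *\<^sub>R e)\<bar> \<le> C * norm (h *\<^sub>R (u - e))"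
              using Labs[of x "y + h *\<^sub>R e"] by (simp add: xu scaleR_diff_right)
            also have "\<dots> = C * norm (u - e) * h" using h by simp
            also have "\<dots> \<le> C * \<eta> * h" using e h C by (intro mult_right_mono mult_left_mono) auto
            finally show ?thesis .
          qed
          have 2: "\<bar>l (u - e)\<bar> \<le> B * \<eta>"
            using B(2)[of "u - e"] e(2) B(1) by (smt (verit) mult.commute mult_left_mono)
          have 3: "\<bar>f (y + h *\<^sub>R e) - f y - h * l e\<bar> \<le> \<epsilon> / 2 * h"
          proof -
            have "f (y + h *\<^sub>R e) - f y - h * l e = ((f (y + h *\<^sub>R e) - f y) / h - l e) * h"
              using h by (simp add: field_simps)
            then show ?thesis using d(2)[OF h e(1)] h by (simp add: abs_mult)
          qed
          have 4: "\<bar>h * l (u - e)\<bar> \<le> h * (B * \<eta>)"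
            using mult_left_mono[OF 2, of h] h by (simp add: abs_mult)
          have "f x - f y - l (x - y) = (f x - f (y + h *\<^sub>R e)) + (f (y + h *\<^sub>R e) - f y - h * l e) - h * l (u - e)"
            by (simp add: xu lin algebra_simps)
          then have "\<bar>f x - f y - l (x - y)\<bar> \<le> C * \<eta> * h + \<epsilon> / 2 * h + h * (B * \<eta>)"
            using 1 3 4 by linarith
          also have "\<dots> = ((C + B) * \<eta> + \<epsilon> / 2) * h" by (simp add: algebra_simps)
          also have "(C + B) * \<eta> = \<epsilon> / 2" using C B by (simp add: \<eta>_def field_simps add_nonneg_eq_0_iff)
          finally show ?thesis by (simp add: h_def)
        qed
      qed
    qed
    then show ?case by (auto simp: differentiable_def)
  qed
qed

section \<open>Continuously differentiable functions and mollification\<close>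

text \<open>The derivative is an explicit argument and is two-sided even at boundary points of
  \<open>S\<close>. Continuity is asked for each fixed increment; in finite dimension this yields
  uniformity in the increment, see \<open>C1_on_deriv_bound\<close> and
  \<open>C1_on_uniform\<close>.\<close>

definition C1_on :: "'a::euclidean_space set \<Rightarrow> ('a \<Rightarrow> 'b::euclidean_space) \<Rightarrow> ('a \<Rightarrow> 'a \<Rightarrow> 'b) \<Rightarrow> bool" where
  "C1_on S f f' \<longleftrightarrow> (\<forall>z\<in>S. (f has_derivative f' z) (at z)) \<and> (\<forall>e. continuous_on S (\<lambda>z. f' z e))"

lemma C1_onI:
  "(\<And>z. z \<in> S \<Longrightarrow> (f has_derivative f' z) (at z)) \<Longrightarrow> (\<And>e. continuous_on S (\<lambda>z. f' z e)) \<Longrightarrow> C1_on S f f'"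
  by (simp add: C1_on_def)

lemma C1_onD:
  assumes "C1_on S f f'"
  shows "z \<in> S \<Longrightarrow> (f has_derivative f' z) (at z)" "continuous_on S (\<lambda>z. f' z e)"
  using assms by (auto simp: C1_on_def)

lemma C1_on_subset: "C1_on S f f' \<Longrightarrow> T \<subseteq> S \<Longrightarrow> C1_on T f f'"
  by (auto simp: C1_on_def intro: continuous_on_subset)

lemma C1_on_continuous_on: "C1_on S f f' \<Longrightarrow> continuous_on S f"
  by (meson C1_onD(1) continuous_at_imp_continuous_on has_derivative_continuous)

lemma C1_on_linear: "C1_on S f f' \<Longrightarrow> z \<in> S \<Longrightarrow> bounded_linear (f' z)"
  by (meson C1_onD(1) has_derivative_bounded_linear)

lemma C1_on_deriv_basis:
  assumes "C1_on S f f'" "z \<in> S"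
  shows "f' z e = (\<Sum>b\<in>Basis. (e \<bullet> b) *\<^sub>R f' z b)"
proof -
  interpret bounded_linear "f' z" using C1_on_linear[OF assms] .
  have "f' z e = f' z (\<Sum>b\<in>Basis. (e \<bullet> b) *\<^sub>R b)" by (simp add: euclidean_representation)
  then show ?thesis by (simp add: sum scale)
qed

lemma C1_on_continuous_deriv:
  assumes f: "C1_on S f f'" and a: "continuous_on T a" "\<And>x. x \<in> T \<Longrightarrow> a x \<in> S" and b: "continuous_on T b"
  shows "continuous_on T (\<lambda>x. f' (a x) (b x))"
proof -
  have "continuous_on T (\<lambda>x. \<Sum>i\<in>Basis. (b x \<bullet> i) *\<^sub>R f' (a x) i)"
    using a by (intro continuous_intros b continuous_on_compose2[OF C1_onD(2)[OF f] a(1)]) auto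
  then show ?thesis
    by (rule continuous_on_eq) (simp add: C1_on_deriv_basis[OF f a(2), symmetric])
qed

lemma C1_on_compose:
  assumes g: "C1_on T g g'" and f: "C1_on S f f'" and st: "\<And>x. x \<in> S \<Longrightarrow> f x \<in> T"
  shows "C1_on S (\<lambda>x. g (f x)) (\<lambda>x e. g' (f x) (f' x e))"
proof (rule C1_onI)
  show "((\<lambda>x. g (f x)) has_derivative (\<lambda>e. g' (f z) (f' z e))) (at z)" if "z \<in> S" for z
    using has_derivative_compose[OF C1_onD(1)[OF f that] C1_onD(1)[OF g st[OF that]]] .
  show "continuous_on S (\<lambda>z. g' (f z) (f' z e))" for e
    using C1_on_continuous_deriv[OF g C1_on_continuous_on[OF f] st C1_onD(2)[OF f]] .
qed

lemma C1_on_bounded_linear: "bounded_linear h \<Longrightarrow> C1_on S h (\<lambda>z. h)"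
  by (intro C1_onI bounded_linear_imp_has_derivative continuous_intros)

lemma C1_on_const: "C1_on S (\<lambda>z. c) (\<lambda>z e. 0)"
  by (intro C1_onI derivative_intros continuous_intros)

lemma C1_on_add: "C1_on S f f' \<Longrightarrow> C1_on S g g' \<Longrightarrow> C1_on S (\<lambda>z. f z + g z) (\<lambda>z e. f' z e + g' z e)"
  unfolding C1_on_def by (auto intro!: has_derivative_add continuous_intros)

lemma C1_on_diff: "C1_on S f f' \<Longrightarrow> C1_on S g g' \<Longrightarrow> C1_on S (\<lambda>z. f z - g z) (\<lambda>z e. f' z e - g' z e)"
  unfolding C1_on_def by (auto intro!: has_derivative_diff continuous_intros)

lemma C1_on_scaleR:
  fixes c :: "'a::euclidean_space \<Rightarrow> real"
  assumes "C1_on S c c'" "C1_on S g g'"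
  shows "C1_on S (\<lambda>z. c z *\<^sub>R g z) (\<lambda>z e. c z *\<^sub>R g' z e + c' z e *\<^sub>R g z)"
  using assms C1_on_continuous_on[OF assms(1)] C1_on_continuous_on[OF assms(2)]
  unfolding C1_on_def by (auto intro!: has_derivative_scaleR continuous_intros)

lemma C1_on_mult:
  fixes c g :: "'a::euclidean_space \<Rightarrow> real"
  assumes "C1_on S c c'" "C1_on S g g'"
  shows "C1_on S (\<lambda>z. c z * g z) (\<lambda>z e. c z * g' z e + c' z e * g z)"
  using C1_on_scaleR[OF assms] by simp

lemma C1_on_Pair: "C1_on S f f' \<Longrightarrow> C1_on S g g' \<Longrightarrow> C1_on S (\<lambda>z. (f z, g z)) (\<lambda>z e. (f' z e, g' z e))"
  unfolding C1_on_def by (auto intro!: has_derivative_Pair continuous_intros)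

lemma C1_on_real:
  assumes "\<And>x. x \<in> T \<Longrightarrow> (s has_real_derivative s' x) (at x)" "continuous_on T s'"
  shows "C1_on T s (\<lambda>x e. s' x * e)"
  using assms unfolding C1_on_def has_field_derivative_def
  by (auto intro!: continuous_intros)

text \<open>Near a point of \<open>S - K\<close> the function vanishes identically, so
  \<open>f'\<close> is 0 there and the two descriptions agree where they overlap. \<open>K\<close>
  may leave \<open>S\<close>; the extension is then controlled off \<open>K - S\<close>, which is
  what a test function reaching the end times requires.\<close>

lemma C1_on_extend_zero_Un:
  assumes f: "C1_on S f f'" and S: "open S" and K: "closed K" and z: "\<And>z. z \<in> S - K \<Longrightarrow> f z = 0"
  shows "C1_on (S \<union> - K) (\<lambda>z. if z \<in> S then f z else 0) (\<lambda>z e. if z \<in> K then f' z e else 0)"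
proof -
  let ?F = "\<lambda>z. if z \<in> S then f z else 0" and ?F' = "\<lambda>z e. if z \<in> K then f' z e else 0"
  have zero: "?F z = 0" if "z \<in> - K" for z using that z by auto
  have f'0: "f' z = (\<lambda>e. 0)" if "z \<in> S - K" for z
  proof -
    have "(f has_derivative (\<lambda>e. 0)) (at z)"
      by (rule has_derivative_transform_within_open[OF has_derivative_const[of 0], where s="S - K"])
         (use that z S K in \<open>auto intro: open_Diff\<close>)
    then show ?thesis using C1_onD(1)[OF f] that has_derivative_unique by blast
  qed
  show ?thesis
  proof (rule C1_onI)
    fix z assume zS: "z \<in> S \<union> - K"
    show "(?F has_derivative ?F' z) (at z)"
    proof (cases "z \<in> K")
      case True
      then have "(f has_derivative f' z) (at z)" using C1_onD(1)[OF f] zS by auto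
      from has_derivative_transform_within_open[OF this S, of ?F] show ?thesis using True zS by auto
    next
      case False
      have "(?F has_derivative (\<lambda>e. 0)) (at z)"
        by (rule has_derivative_transform_within_open[OF has_derivative_const[of 0], where s="-K"])
           (use False zero K in \<open>auto\<close>)
      then show ?thesis using False by simp
    qed
  next
    fix e
    show "continuous_on (S \<union> - K) (\<lambda>z. ?F' z e)"
    proof (rule continuous_on_open_Un)
      show "continuous_on S (\<lambda>z. ?F' z e)"
        by (rule continuous_on_eq[OF C1_onD(2)[OF f, of e]]) (use f'0 in auto)
      show "continuous_on (-K) (\<lambda>z. ?F' z e)"
        by (rule continuous_on_eq[OF continuous_on_const[of _ 0]]) auto
    qed (use S K in auto)
  qed
qed

lemma C1_on_extend_zero:
  assumes "C1_on S f f'" "open S" "closed K" "K \<subseteq> S" "\<And>z. z \<in> S - K \<Longrightarrow> f z = 0"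
  shows "C1_on UNIV (\<lambda>z. if z \<in> S then f z else 0) (\<lambda>z e. if z \<in> K then f' z e else 0)"
proof -
  have "S \<union> - K = UNIV" using assms(4) by auto
  then show ?thesis using C1_on_extend_zero_Un[OF assms(1-3,5)] by simp
qed

lemma C1_on_MVT:
  fixes g :: "'a::euclidean_space \<Rightarrow> real"
  assumes g: "C1_on S g g'" and h: "h > 0" and seg: "\<And>s. 0 \<le> s \<Longrightarrow> s \<le> h \<Longrightarrow> z + s *\<^sub>R d \<in> S"
  obtains s where "0 < s" "s < h" "g (z + h *\<^sub>R d) - g z = h * g' (z + s *\<^sub>R d) d"
proof -
  have "\<exists>s. 0 < s \<and> s < h \<and> g (z + h *\<^sub>R d) - g (z + 0 *\<^sub>R d) = (h - 0) * g' (z + s *\<^sub>R d) d"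
  proof (rule MVT2[OF h])
    fix s :: real assume s: "0 \<le> s" "s \<le> h"
    have "((\<lambda>s. z + s *\<^sub>R d) has_derivative (\<lambda>s. s *\<^sub>R d)) (at s)" by (auto intro!: derivative_eq_intros)
    from has_derivative_compose[OF this C1_onD(1)[OF g seg[OF s]]]
    have "((\<lambda>s. g (z + s *\<^sub>R d)) has_derivative (\<lambda>h. g' (z + s *\<^sub>R d) (h *\<^sub>R d))) (at s)" .
    moreover have "g' (z + s *\<^sub>R d) (h *\<^sub>R d) = g' (z + s *\<^sub>R d) d * h" for h
      using C1_on_linear[OF g seg[OF s]] by (simp add: bounded_linear.linear linear_scale)
    ultimately show "((\<lambda>s. g (z + s *\<^sub>R d)) has_real_derivative g' (z + s *\<^sub>R d) d) (at s)"
      by (simp add: has_field_derivative_def)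
  qed
  then show thesis using that by auto
qed

lemma C1_on_deriv_bound:
  fixes f :: "'a::euclidean_space \<Rightarrow> 'b::euclidean_space"
  assumes f: "C1_on S f f'" and K: "compact K" "K \<subseteq> S"
  obtains B where "B \<ge> 0" "\<And>z e. z \<in> K \<Longrightarrow> norm (f' z e) \<le> B * norm e"
proof -
  have "\<exists>B. \<forall>z\<in>K. norm (f' z b) \<le> B" for b
  proof -
    have "compact ((\<lambda>z. f' z b) ` K)"
      by (intro compact_continuous_image K(1) continuous_on_subset[OF C1_onD(2)[OF f] K(2)])
    then show ?thesis by (auto simp: bounded_iff dest!: compact_imp_bounded)
  qed
  then obtain B where B: "\<And>b z. z \<in> K \<Longrightarrow> norm (f' z b) \<le> B b" by metis
  show thesis
  proof (rule that[of "\<Sum>b\<in>Basis. \<bar>B b\<bar>"])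
    fix z e assume z: "z \<in> K"
    have "f' z e = (\<Sum>b\<in>Basis. (e \<bullet> b) *\<^sub>R f' z b)" using C1_on_deriv_basis[OF f] z K by blast
    then have "norm (f' z e) \<le> (\<Sum>b\<in>Basis. norm ((e \<bullet> b) *\<^sub>R f' z b))" by (metis norm_sum)
    also have "\<dots> \<le> (\<Sum>b\<in>Basis. norm e * \<bar>B b\<bar>)"
    proof (rule sum_mono)
      fix b :: 'a assume b: "b \<in> Basis"
      have "norm (f' z b) \<le> \<bar>B b\<bar>" using B[OF z, of b] by linarith
      then show "norm ((e \<bullet> b) *\<^sub>R f' z b) \<le> norm e * \<bar>B b\<bar>"
        unfolding norm_scaleR by (intro mult_mono Basis_le_norm b) auto
    qed
    finally show "norm (f' z e) \<le> (\<Sum>b\<in>Basis. \<bar>B b\<bar>) * norm e" by (simp add: sum_distrib_left mult.commute)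
  qed (simp add: sum_nonneg)
qed

lemma C1_on_uniform:
  fixes f :: "'a::euclidean_space \<Rightarrow> 'b::euclidean_space"
  assumes f: "C1_on S f f'" and K: "compact K" "K \<subseteq> S" and \<epsilon>: "\<epsilon> > 0"
  obtains d where "d > 0" "\<And>p q e. p \<in> K \<Longrightarrow> q \<in> K \<Longrightarrow> dist p q < d \<Longrightarrow> norm (f' p e - f' q e) \<le> \<epsilon> * norm e"
proof -
  have "\<exists>d>0. \<forall>p\<in>K. \<forall>q\<in>K. dist p q < d \<longrightarrow> norm (f' p i - f' q i) < \<epsilon> / DIM('a)" for i
  proof -
    have "uniformly_continuous_on K (\<lambda>p. f' p i)"
      by (intro compact_uniformly_continuous K continuous_on_subset[OF C1_onD(2)[OF f]])
    then show ?thesis using \<epsilon> unfolding uniformly_continuous_on_def dist_norm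
      by (metis DIM_positive divide_pos_pos norm_minus_commute of_nat_0_less_iff)
  qed
  then obtain dd where dd: "\<And>i. dd i > 0"
    "\<And>i p q. p \<in> K \<Longrightarrow> q \<in> K \<Longrightarrow> dist p q < dd i \<Longrightarrow> norm (f' p i - f' q i) < \<epsilon> / DIM('a)" by metis
  define d where "d = Min (dd ` Basis)"
  have d: "d > 0" "\<And>i. i \<in> Basis \<Longrightarrow> d \<le> dd i" using dd(1) by (auto simp: d_def)
  have "norm (f' p e - f' q e) \<le> \<epsilon> * norm e" if pq: "p \<in> K" "q \<in> K" "dist p q < d" for p q e
  proof -
    have "p \<in> S" "q \<in> S" using K pq by auto
    then have "f' p e - f' q e = (\<Sum>i\<in>Basis. (e \<bullet> i) *\<^sub>R (f' p i - f' q i))"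
      using C1_on_deriv_basis[OF f, of p e] C1_on_deriv_basis[OF f, of q e]
      by (simp add: sum_subtractf scaleR_diff_right)
    then have "norm (f' p e - f' q e) \<le> (\<Sum>i\<in>Basis. norm ((e \<bullet> i) *\<^sub>R (f' p i - f' q i)))" by (metis norm_sum)
    also have "\<dots> \<le> (\<Sum>i\<in>(Basis :: 'a set). norm e * (\<epsilon> / DIM('a)))"
    proof (rule sum_mono)
      fix i :: 'a assume i: "i \<in> Basis"
      have "dist p q < dd i" using d(2)[OF i] pq(3) by linarith
      then have "norm (f' p i - f' q i) \<le> \<epsilon> / DIM('a)" using dd(2)[OF pq(1,2)] by (intro less_imp_le) blast
      then show "norm ((e \<bullet> i) *\<^sub>R (f' p i - f' q i)) \<le> norm e * (\<epsilon> / DIM('a))"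
        unfolding norm_scaleR by (intro mult_mono Basis_le_norm i) auto
    qed
    also have "\<dots> = \<epsilon> * norm e" by simp
    finally show ?thesis .
  qed
  then show thesis using d(1) that by blast
qed

section \<open>Mollification of Lipschitz functions\<close>

lemma AE_lborel_translate:
  fixes z :: "'a::euclidean_space"
  assumes "AE y in lborel. P y"
  shows "AE y in lborel. P (z + y)"
proof -
  have "AE y in distr lborel borel ((+) z). P y" unfolding lborel_distr_plus by (rule assms)
  then show ?thesis by (rule AE_distrD[rotated]) simp
qed

lemma lborel_integral_translate:
  fixes h :: "'a::euclidean_space \<Rightarrow> real"
  assumes [measurable]: "h \<in> borel_measurable borel"
  shows "(LINT y|lborel. h y) = (LINT y|lborel. h (z + y))"
proof -
  have "(LINT y|lborel. h y) = (LINT y|distr lborel borel ((+) z). h y)" by (simp add: lborel_distr_plus)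
  also have "\<dots> = (LINT y|lborel. h (z + y))" by (subst integral_distr) auto
  finally show ?thesis .
qed

lemma diff_quot_LIMSEQ_derivative:
  assumes D: "(f has_derivative D) (at y)"
  shows "(\<lambda>n. diff_quot f w n y) \<longlonglongrightarrow> D w"
proof -
  have 1: "((\<lambda>t::real. y + t *\<^sub>R w) has_derivative (\<lambda>t. t *\<^sub>R w)) (at 0)"
    by (auto intro!: derivative_eq_intros)
  have "(f has_derivative D) (at (y + (0::real) *\<^sub>R w))" using D by simp
  from has_derivative_compose[OF 1 this]
  have "((\<lambda>t. f (y + t *\<^sub>R w)) has_derivative (\<lambda>t. D (t *\<^sub>R w))) (at 0)" .
  moreover have "D (t *\<^sub>R w) = D w * t" for t
    using has_derivative_bounded_linear[OF D] by (simp add: bounded_linear.linear linear_scale)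
  ultimately have "((\<lambda>t. f (y + t *\<^sub>R w)) has_real_derivative D w) (at 0)" by (simp add: has_field_derivative_def)
  then have "((\<lambda>t. (f (y + t *\<^sub>R w) - f y) / t) \<longlongrightarrow> D w) (at 0)"
    by (simp add: has_field_derivative_iff)
  moreover have "filterlim (\<lambda>n. 1 / real (Suc n)) (at 0) sequentially" by real_asymp
  ultimately have "(\<lambda>n. (f (y + (1 / real (Suc n)) *\<^sub>R w) - f y) / (1 / real (Suc n))) \<longlonglongrightarrow> D w"
    by (rule filterlim_compose)
  then show ?thesis by (simp add: diff_quot_def del: of_nat_Suc)
qed

lemma lim_quot_eq_derivative: "(f has_derivative D) (at y) \<Longrightarrow> lim_quot f w y = D w"
  using diff_quot_LIMSEQ_derivative[of f D y w] by (simp add: lim_quot_def limI)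

text \<open>For a radial kernel \<open>a\<close>, averaging over z + y is ordinary
  convolution.\<close>

definition mollify :: "('a::euclidean_space \<Rightarrow> real) \<Rightarrow> ('a \<Rightarrow> real) \<Rightarrow> 'a \<Rightarrow> real" where
  "mollify a b z = (LINT y|lborel. a y * b (z + y))"

text \<open>The differentiation falls on the Lipschitz factor \<open>b\<close>, where it is defined
  almost everywhere. A continuous kernel suffices, and inequalities satisfied by the derivative of
  \<open>b\<close> at almost every point survive the averaging.\<close>

definition mollify_deriv :: "('a::euclidean_space \<Rightarrow> real) \<Rightarrow> ('a \<Rightarrow> real) \<Rightarrow> 'a \<Rightarrow> 'a \<Rightarrow> real" where
  "mollify_deriv a b z w = (LINT y|lborel. a y * lim_quot b w (z + y))"

locale lipschitz_mollify =
  fixes a :: "'a::euclidean_space \<Rightarrow> real" and b :: "'a \<Rightarrow> real" and R C :: real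
  assumes a_cont: "continuous_on UNIV a" and a_supp: "\<And>y. norm y > R \<Longrightarrow> a y = 0"
    and b_lip: "C-lipschitz_on UNIV b"
begin

lemma a_measurable [measurable]: "a \<in> borel_measurable borel"
  using a_cont by (rule borel_measurable_continuous_onI)

lemma b_measurable [measurable]: "b \<in> borel_measurable borel"
  by (rule Lip_measurable[OF b_lip])

lemma b_cont: "continuous_on UNIV b" by (rule lipschitz_on_continuous_on[OF b_lip])

lemma lq_measurable [measurable]: "lim_quot b w \<in> borel_measurable borel"
  by (rule lim_quot_measurable[OF b_lip])

lemma integrable_supp:
  assumes "continuous_on UNIV g"
  shows "integrable lborel (\<lambda>y. a y * g y)"
proof -
  have "integrable lborel (\<lambda>y. indicator (cball 0 R) y *\<^sub>R (a y * g y))"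
    by (rule borel_integrable_compact)
       (auto intro!: continuous_intros continuous_on_subset[OF a_cont] continuous_on_subset[OF assms])
  moreover have "(\<lambda>y. indicator (cball 0 R) y *\<^sub>R (a y * g y)) = (\<lambda>y. a y * g y)"
    using a_supp by (force simp: indicator_def)
  ultimately show ?thesis by simp
qed

lemma integrable_a: "integrable lborel a"
  using integrable_supp[of "\<lambda>_. 1"] by simp

lemma integrable_ab: "integrable lborel (\<lambda>y. a y * b (z + y))"
  by (intro integrable_supp continuous_on_compose2[OF b_cont] continuous_intros) auto

lemma differentiable_AE: "AE y in lborel. b differentiable (at (z + y))"
  by (rule AE_lborel_translate[OF Rademacher[OF b_lip]])

lemma lim_quot_bound:
  assumes "b differentiable (at y)"
  shows "\<bar>lim_quot b w y\<bar> \<le> C * norm w"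
proof -
  from assms obtain D where D: "(b has_derivative D) (at y)" by (auto simp: differentiable_def)
  then have "(\<lambda>n. \<bar>diff_quot b w n y\<bar>) \<longlonglongrightarrow> \<bar>D w\<bar>" by (intro tendsto_rabs diff_quot_LIMSEQ_derivative)
  then have "\<bar>D w\<bar> \<le> C * norm w"
    by (rule LIMSEQ_le_const2) (use diff_quot_bound[OF b_lip] in auto)
  then show ?thesis using lim_quot_eq_derivative[OF D] by simp
qed

lemma integrable_deriv: "integrable lborel (\<lambda>y. a y * lim_quot b w (z + y))"
proof (rule Bochner_Integration.integrable_bound)
  show "integrable lborel (\<lambda>y. a y * (C * norm w))" using integrable_a by simp
  show "AE y in lborel. norm (a y * lim_quot b w (z + y)) \<le> norm (a y * (C * norm w))"
    using differentiable_AE[of z]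
    by eventually_elim (use lim_quot_bound Lip_nonneg[OF b_lip] in \<open>auto simp: abs_mult intro!: mult_left_mono\<close>)
qed auto

text \<open>\<open>lim_quot b\<close> is linear in the direction only at points of
  differentiability; Rademacher's theorem makes this enough under the integral.\<close>

lemma mollify_bounded_linear: "bounded_linear (mollify_deriv a b z)"
proof (rule linear_conv_bounded_linear[THEN iffD1], rule linearI)
  fix u w :: 'a and c :: real
  have lin: "AE y in lborel. lim_quot b (u + w) (z + y) = lim_quot b u (z + y) + lim_quot b w (z + y)
        \<and> lim_quot b (c *\<^sub>R u) (z + y) = c * lim_quot b u (z + y)"
    using differentiable_AE[of z]
  proof eventually_elim
    case (elim y)
    then obtain D where D: "(b has_derivative D) (at (z + y))" by (auto simp: differentiable_def)
    then have "linear D" using has_derivative_bounded_linear bounded_linear.linear by blast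
    then show ?case by (simp add: lim_quot_eq_derivative[OF D] linear_add linear_scale)
  qed
  have "mollify_deriv a b z (u + w) = (LINT y|lborel. a y * lim_quot b u (z + y) + a y * lim_quot b w (z + y))"
    unfolding mollify_deriv_def
    by (rule integral_cong_AE) (use lin in \<open>auto simp: distrib_left\<close>)
  then show "mollify_deriv a b z (u + w) = mollify_deriv a b z u + mollify_deriv a b z w"
    by (simp add: integrable_deriv mollify_deriv_def)
  have "mollify_deriv a b z (c *\<^sub>R u) = (LINT y|lborel. c * (a y * lim_quot b u (z + y)))"
    unfolding mollify_deriv_def
    by (rule integral_cong_AE) (use lin in auto)
  then show "mollify_deriv a b z (c *\<^sub>R u) = c *\<^sub>R mollify_deriv a b z u"
    by (simp add: mollify_deriv_def)
qed

text \<open>Dominated convergence along an arbitrary sequence of increments: the normalized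
  remainder of \<open>b\<close> tends to 0 at almost every point and is bounded by
  \<open>2 * C\<close>.\<close>

lemma mollify_has_derivative: "(mollify a b has_derivative mollify_deriv a b z) (at z)"
  unfolding has_derivative_at
proof (intro conjI mollify_bounded_linear)
  show "(\<lambda>w. norm (mollify a b (z + w) - mollify a b z - mollify_deriv a b z w) / norm w) \<midarrow>0\<rightarrow> 0"
    unfolding tendsto_at_iff_sequentially
  proof (intro allI impI, unfold comp_def)
    fix X :: "nat \<Rightarrow> 'a" assume X: "\<forall>i. X i \<in> UNIV - {0}" "X \<longlonglongrightarrow> 0"
    define r where "r n y = (b (z + y + X n) - b (z + y) - lim_quot b (X n) (z + y)) / norm (X n)" for n y
    have [measurable]: "r n \<in> borel_measurable borel" for n unfolding r_def by measurable
    have rb: "AE y in lborel. \<bar>r n y\<bar> \<le> 2 * C" for n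
      using differentiable_AE[of z]
    proof eventually_elim
      case (elim y)
      have "\<bar>b (z + y + X n) - b (z + y) - lim_quot b (X n) (z + y)\<bar> \<le> 2 * C * norm (X n)"
        using lim_quot_bound[OF elim, of "X n"] Lip_abs[OF b_lip, of "z + y + X n" "z + y"] by simp
      then show ?case using X by (simp add: r_def divide_le_eq)
    qed
    have "(\<lambda>n. LINT y|lborel. a y * r n y) \<longlonglongrightarrow> (LINT y|(lborel::'a measure). (0::real))"
    proof (rule integral_dominated_convergence[where w="\<lambda>y. \<bar>a y\<bar> * (2 * C)"])
      show "AE y in lborel. (\<lambda>n. a y * r n y) \<longlonglongrightarrow> 0"
        using differentiable_AE[of z]
      proof eventually_elim
        case (elim y)
        then obtain D where D: "(b has_derivative D) (at (z + y))" by (auto simp: differentiable_def)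
        then have "(\<lambda>w. norm (b (z + y + w) - b (z + y) - D w) / norm w) \<midarrow>0\<rightarrow> 0"
          by (simp add: has_derivative_at)
        then have "(\<lambda>n. norm (b (z + y + X n) - b (z + y) - D (X n)) / norm (X n)) \<longlonglongrightarrow> 0"
          using X unfolding tendsto_at_iff_sequentially comp_def by blast
        then have "(\<lambda>n. \<bar>r n y\<bar>) \<longlonglongrightarrow> 0"
          by (simp add: r_def lim_quot_eq_derivative[OF D])
        then have "(\<lambda>n. r n y) \<longlonglongrightarrow> 0" by (simp add: tendsto_rabs_zero_iff)
        then show ?case by (rule tendsto_mult_right_zero)
      qed
      show "AE y in lborel. norm (a y * r n y) \<le> \<bar>a y\<bar> * (2 * C)" for n
        using rb[of n] by eventually_elim (auto simp: abs_mult intro!: mult_left_mono)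
      show "integrable lborel (\<lambda>y. \<bar>a y\<bar> * (2 * C))" using integrable_a by simp
    qed auto
    then have "(\<lambda>n. \<bar>LINT y|lborel. a y * r n y\<bar>) \<longlonglongrightarrow> 0" by (simp add: tendsto_rabs_zero_iff)
    moreover have "\<bar>LINT y|lborel. a y * r n y\<bar> = norm (mollify a b (z + X n) - mollify a b z - mollify_deriv a b z (X n)) / norm (X n)" for n
    proof -
      have e: "a y * r n y = (a y * b ((z + X n) + y) - a y * b (z + y) - a y * lim_quot b (X n) (z + y)) / norm (X n)" for y
        by (simp add: r_def algebra_simps)
      have "(LINT y|lborel. a y * r n y) = (mollify a b (z + X n) - mollify a b z - mollify_deriv a b z (X n)) / norm (X n)"
        unfolding e mollify_def mollify_deriv_def
        using integrable_ab integrable_deriv by simp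
      then show ?thesis by simp
    qed
    ultimately show "(\<lambda>n. norm (mollify a b (z + X n) - mollify a b z - mollify_deriv a b z (X n)) / norm (X n)) \<longlonglongrightarrow> 0"
      by simp
  qed
qed

lemma mollify_deriv_continuous: "continuous_on UNIV (\<lambda>z. mollify_deriv a b z w)"
  unfolding continuous_on_sequentially
proof (intro ballI allI impI, unfold comp_def)
  fix Z z assume "(\<forall>n. Z n \<in> UNIV) \<and> Z \<longlonglongrightarrow> (z::'a)"
  then have Z: "Z \<longlonglongrightarrow> z" by simp
  \<comment> \<open>After the translation \<open>z\<close> occurs only in the continuous kernel,
    while the derivative of \<open>b\<close>, merely measurable, stays in place.\<close>
  have eq: "mollify_deriv a b z w = (LINT y|lborel. a (y - z) * lim_quot b w y)" for z
    unfolding mollify_deriv_def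
    by (subst lborel_integral_translate[where z=z and h="\<lambda>y. a (y - z) * lim_quot b w y"]) auto
  have "bounded (range Z)" using Z by (rule convergent_imp_bounded)
  then obtain S where S: "\<And>n. norm (Z n) \<le> S" by (auto simp: bounded_iff)
  have "compact (a ` cball 0 R)" by (intro compact_continuous_image continuous_on_subset[OF a_cont]) auto
  then obtain A where A0: "\<And>y. y \<in> cball 0 R \<Longrightarrow> \<bar>a y\<bar> \<le> A" using compact_imp_bounded by (fastforce simp: bounded_iff)
  then have A: "\<bar>a y\<bar> \<le> max A 0" for y using a_supp[of y] A0[of y] by (cases "norm y > R") (auto intro: max.coboundedI1)
  show "(\<lambda>n. mollify_deriv a b (Z n) w) \<longlonglongrightarrow> mollify_deriv a b z w"
    unfolding eq
  proof (rule integral_dominated_convergence[where w="\<lambda>y. indicator (cball 0 (R + S)) y * (max A 0 * (C * norm w))"])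
    have "emeasure lborel (cball (0::'a) (R + S)) < \<infinity>" by (rule emeasure_bounded_finite) simp
    then show "integrable lborel (\<lambda>y::'a. indicator (cball 0 (R + S)) y * (max A 0 * (C * norm w)) :: real)"
      by (intro integrable_mult_left integrable_real_indicator) auto
    show "AE y in lborel. (\<lambda>n. a (y - Z n) * lim_quot b w y) \<longlonglongrightarrow> a (y - z) * lim_quot b w y"
    proof (intro AE_I2 tendsto_intros)
      fix y
      show "(\<lambda>n. a (y - Z n)) \<longlonglongrightarrow> a (y - z)"
        by (rule continuous_on_tendsto_compose[OF a_cont]) (auto intro!: tendsto_intros Z)
    qed
    fix n
    show "AE y in lborel. norm (a (y - Z n) * lim_quot b w y) \<le> indicator (cball 0 (R + S)) y * (max A 0 * (C * norm w))"
      using Rademacher[OF b_lip]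
    proof eventually_elim
      case (elim y)
      show ?case
      proof (cases "norm (y - Z n) > R")
        case True
        then show ?thesis using a_supp Lip_nonneg[OF b_lip] by simp
      next
        case False
        then have "norm y \<le> R + S" using S[of n] norm_triangle_ineq[of "y - Z n" "Z n"] by simp
        then show ?thesis using mult_mono[OF A[of "y - Z n"] lim_quot_bound[OF elim, of w]] by (simp add: abs_mult)
      qed
    qed
  qed measurable
qed

lemma mollify_C1: "C1_on UNIV (mollify a b) (mollify_deriv a b)"
  by (intro C1_onI mollify_has_derivative mollify_deriv_continuous)

end

section \<open>Weierstrass approximation in \<open>C\<^sup>1\<close>\<close>

text \<open>The Landau kernel, truncated outside the ball of radius \<open>r\<close>. It serves
  twice: for large \<open>N\<close>, being polynomial inside the ball, it yields Weierstrass
  approximation; for \<open>N = 1\<close> and small \<open>r\<close> it is the mollifier applied to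
  f.\<close>

definition bump :: "real \<Rightarrow> nat \<Rightarrow> 'a::euclidean_space \<Rightarrow> real" where
  "bump r N y = (max 0 (1 - (norm y / r)\<^sup>2)) ^ N"

definition bump_kernel :: "real \<Rightarrow> nat \<Rightarrow> 'a::euclidean_space \<Rightarrow> real" where
  "bump_kernel r N y = bump r N y / (LINT y|lborel. bump r N (y::'a))"

lemma bump_cont: "continuous_on S (bump r N)"
  unfolding bump_def by (auto simp: divide_inverse intro!: continuous_intros)

lemma bump_measurable [measurable]: "bump r N \<in> borel_measurable borel"
  by (intro borel_measurable_continuous_onI bump_cont)

lemma bump_nonneg: "bump r N y \<ge> 0"
  by (simp add: bump_def)

lemma bump_supp: "r > 0 \<Longrightarrow> N > 0 \<Longrightarrow> norm y \<ge> r \<Longrightarrow> bump r N y = 0"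
  by (auto simp: bump_def max_def power_0_left power2_eq_square)
     (smt (verit) divide_le_eq_1 mult_le_one le_divide_eq_1 mult_left_le norm_ge_zero mult_mono)

lemma bump_integrable:
  assumes "r > 0" "N > 0"
  shows "integrable lborel (bump r N :: 'a::euclidean_space \<Rightarrow> real)"
proof -
  have "integrable lborel (\<lambda>y::'a. indicator (cball 0 r) y *\<^sub>R bump r N y)"
    by (rule borel_integrable_compact) (auto intro: bump_cont)
  moreover have "(\<lambda>y::'a. indicator (cball 0 r) y *\<^sub>R bump r N y) = bump r N"
    using bump_supp[OF assms] by (force simp: indicator_def)
  ultimately show ?thesis by simp
qed

lemma cball_finite: "emeasure lborel (cball (0::'a::euclidean_space) s) < \<infinity>"
  by (rule emeasure_bounded_finite) simp

lemma integrable_cball: "integrable lborel (\<lambda>y::'a::euclidean_space. indicator (cball 0 s) y * c :: real)"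
  using cball_finite by (intro integrable_mult_left integrable_real_indicator) auto

lemma bump_integral_ge:
  assumes r: "r > 0" "N > 0" and s: "0 \<le> s" "s \<le> 1"
  shows "(1 - s\<^sup>2) ^ N * measure lborel (cball (0::'a::euclidean_space) (s * r)) \<le> (LINT y|lborel. bump r N (y::'a))"
proof -
  have "(LINT y|lborel. indicator (cball (0::'a) (s * r)) y * (1 - s\<^sup>2) ^ N) \<le> (LINT y|lborel. bump r N (y::'a))"
  proof (rule integral_mono[OF integrable_cball bump_integrable[OF r]])
    fix y :: 'a
    show "indicator (cball (0::'a) (s * r)) y * (1 - s\<^sup>2) ^ N \<le> bump r N y"
    proof (cases "norm y \<le> s * r")
      case True
      then have "(norm y / r)\<^sup>2 \<le> s\<^sup>2" using r by (intro power_mono) (auto simp: divide_le_eq)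
      moreover have "s\<^sup>2 \<le> 1" using s by (simp add: power_le_one)
      ultimately have "(1 - s\<^sup>2) ^ N \<le> bump r N y" unfolding bump_def by (intro power_mono) auto
      then show ?thesis by (simp add: True)
    qed (simp add: bump_nonneg)
  qed
  then show ?thesis by (simp add: mult.commute)
qed

lemma measure_cball_pos: "s > 0 \<Longrightarrow> measure lborel (cball (0::'a::euclidean_space) s) > 0"
  using content_cball_pos[of s 0] by (simp add: measure_completion)

lemma bump_integral_pos:
  assumes r: "r > 0" "N > 0"
  shows "(LINT y|lborel. bump r N (y::'a::euclidean_space)) > 0"
proof -
  have "0 < (1 - (1/2)\<^sup>2) ^ N * measure lborel (cball (0::'a) ((1/2) * r))"
    using r by (intro mult_pos_pos measure_cball_pos zero_less_power) (auto simp: power2_eq_square)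
  also have "\<dots> \<le> (LINT y|lborel. bump r N (y::'a))" by (rule bump_integral_ge[OF r]) auto
  finally show ?thesis .
qed

context
  fixes r :: real and N :: nat
  assumes r: "r > 0" and N: "N > 0"
begin

lemma bump_kernel_cont: "continuous_on S (bump_kernel r N)"
  unfolding bump_kernel_def by (simp add: divide_inverse bump_cont continuous_on_mult_right)

lemma bump_kernel_measurable [measurable]: "bump_kernel r N \<in> borel_measurable borel"
  by (intro borel_measurable_continuous_onI bump_kernel_cont)

lemma bump_kernel_nonneg: "bump_kernel r N (y::'a::euclidean_space) \<ge> 0"
  by (simp add: bump_kernel_def bump_nonneg less_imp_le[OF bump_integral_pos[OF r N]])

lemma bump_kernel_supp: "norm y \<ge> r \<Longrightarrow> bump_kernel r N y = 0"
  by (simp add: bump_kernel_def bump_supp[OF r N])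

lemma bump_kernel_integrable: "integrable lborel (bump_kernel r N :: 'a::euclidean_space \<Rightarrow> real)"
  unfolding bump_kernel_def by (intro integrable_divide bump_integrable r N)

lemma bump_kernel_integral: "(LINT y|lborel. bump_kernel r N (y::'a::euclidean_space)) = 1"
  using bump_integral_pos[OF r N, where 'a='a] unfolding bump_kernel_def by simp

lemma bump_kernel_times_integrable:
  fixes h :: "'a::euclidean_space \<Rightarrow> real"
  assumes "continuous_on UNIV h"
  shows "integrable lborel (\<lambda>y. bump_kernel r N y * h (z + y))"
proof -
  have "integrable lborel (\<lambda>y. indicator (cball 0 r) y *\<^sub>R (bump_kernel r N y * h (z + y)))"
    by (rule borel_integrable_compact)
       (auto intro!: continuous_intros bump_kernel_cont continuous_on_compose2[OF assms])
  moreover have "(\<lambda>y. indicator (cball 0 r) y *\<^sub>R (bump_kernel r N y * h (z + y))) = (\<lambda>y. bump_kernel r N y * h (z + y))"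
    using bump_kernel_supp by (force simp: indicator_def)
  ultimately show ?thesis by simp
qed

lemma bump_average_le:
  fixes h :: "'a::euclidean_space \<Rightarrow> real"
  assumes "integrable lborel (\<lambda>y. bump_kernel r N y * h y)"
    and "AE y in lborel. norm y < r \<longrightarrow> h y \<le> c"
  shows "(LINT y|lborel. bump_kernel r N y * h y) \<le> c"
proof -
  have "(LINT y|lborel. bump_kernel r N y * h y) \<le> (LINT y|lborel. bump_kernel r N (y::'a) * c)"
  proof (rule integral_mono_AE[OF assms(1)])
    show "AE y in lborel. bump_kernel r N y * h y \<le> bump_kernel r N y * c"
      using assms(2)
    proof eventually_elim
      case (elim y)
      then show ?case using bump_kernel_supp[of y] bump_kernel_nonneg[of y]
        by (cases "norm y < r") (auto intro: mult_left_mono)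
    qed
  qed (use bump_kernel_integrable in auto)
  then show ?thesis using bump_kernel_integral[where 'a='a] by simp
qed

text \<open>The value of \<open>bump\<close> at distance d is compared with the mass inside radius d
  / 2, where \<open>bump\<close> is larger by a factor exponential in \<open>N\<close>; so the tail
  decays geometrically as \<open>N\<close> grows with \<open>r\<close> fixed.\<close>

lemma bump_kernel_tail:
  assumes d: "0 < d" "d < r" and y: "norm y \<ge> d"
  shows "bump_kernel r N (y::'a::euclidean_space) \<le>
    ((1 - (d / r)\<^sup>2) / (1 - (d / r / 2)\<^sup>2)) ^ N / measure lborel (cball (0::'a) (d / 2))"
proof -
  have "(d / r)\<^sup>2 \<le> (norm y / r)\<^sup>2" using y r d by (intro power_mono divide_right_mono) auto
  moreover have "(d / r)\<^sup>2 \<le> 1" using d by (simp add: power_le_one)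
  ultimately have 1: "bump r N y \<le> (1 - (d / r)\<^sup>2) ^ N" unfolding bump_def by (intro power_mono) auto
  have s: "0 \<le> d / r / 2" "d / r / 2 \<le> 1" using d by (auto simp: divide_le_eq)
  have "(d / r / 2)\<^sup>2 < 1\<^sup>2" using d by (intro power_strict_mono) (auto simp: divide_less_eq)
  then have 2: "0 < (1 - (d / r / 2)\<^sup>2) ^ N" by simp
  have 3: "(1 - (d / r / 2)\<^sup>2) ^ N * measure lborel (cball (0::'a) (d / 2)) \<le> (LINT y|lborel. bump r N (y::'a))"
    using bump_integral_ge[OF r N s, where 'a='a] r by simp
  have "bump_kernel r N y \<le> (1 - (d / r)\<^sup>2) ^ N / ((1 - (d / r / 2)\<^sup>2) ^ N * measure lborel (cball (0::'a) (d / 2)))"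
    unfolding bump_kernel_def
    using 1 2 3 measure_cball_pos[of "d/2", where 'a='a] d bump_nonneg[of r N y]
    by (intro frac_le) auto
  then show ?thesis by (simp add: power_divide)
qed

end

text \<open>Within distance \<open>d\<close> uniform continuity bounds the oscillation of
  \<open>h\<close>; between \<open>d\<close> and \<open>r\<close> the geometric decay of the kernel
  beats the bound \<open>2 * B\<close>.\<close>

lemma bump_kernel_approx:
  fixes h :: "'a::euclidean_space \<Rightarrow> real"
  assumes h: "continuous_on UNIV h" and r: "r > 0" and \<eta>: "\<eta> > 0"
  shows "\<forall>\<^sub>F N in sequentially. \<forall>z\<in>cball 0 R. \<bar>mollify (bump_kernel r N) h z - h z\<bar> \<le> \<eta>"
proof -
  let ?K = "cball (0::'a) (R + r)"
  have "uniformly_continuous_on ?K h"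
    by (intro compact_uniformly_continuous continuous_on_subset[OF h]) auto
  then obtain d0 where d0: "d0 > 0" "\<And>x y. x \<in> ?K \<Longrightarrow> y \<in> ?K \<Longrightarrow> dist x y < d0 \<Longrightarrow> dist (h x) (h y) < \<eta> / 2"
    unfolding uniformly_continuous_on_def using \<eta> by (metis half_gt_zero)
  define d where "d = min d0 (r / 2)"
  have d: "0 < d" "d < r" "d \<le> d0" using d0 r by (auto simp: d_def)
  have "compact (h ` ?K)" by (intro compact_continuous_image continuous_on_subset[OF h]) auto
  then obtain B where B: "B > 0" "\<And>x. x \<in> ?K \<Longrightarrow> \<bar>h x\<bar> \<le> B"
    by (auto simp: bounded_pos dest!: compact_imp_bounded)
  define \<theta> where "\<theta> = (1 - (d / r)\<^sup>2) / (1 - (d / r / 2)\<^sup>2)"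
  have dr: "0 < (d / r)\<^sup>2" "(d / r)\<^sup>2 < 1"
    using d power_strict_mono[of "d/r" 1 2] by (auto simp: divide_less_eq)
  define \<rho> where "\<rho> = (d / r)\<^sup>2"
  have "\<theta> = (1 - \<rho>) / (1 - \<rho> / 4)" by (simp add: \<theta>_def \<rho>_def power_divide)
  then have \<theta>: "0 \<le> \<theta>" "\<theta> < 1" using dr by (simp_all add: \<rho>_def[symmetric])
  define V where "V = measure lborel (cball (0::'a) r) / measure lborel (cball (0::'a) (d / 2))"
  have "(\<lambda>N. \<theta> ^ N * V * (2 * B)) \<longlonglongrightarrow> 0 * V * (2 * B)"
    using \<theta> by (intro tendsto_intros LIMSEQ_realpow_zero) auto
  then have "\<forall>\<^sub>F N in sequentially. \<theta> ^ N * V * (2 * B) < \<eta> / 2"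
    using \<eta> by (intro order_tendstoD(2)[where y="0::real"]) auto
  then show ?thesis using eventually_gt_at_top[of 0]
  proof eventually_elim
    case (elim N)
    then have N: "N > 0" by simp
    note kern = bump_kernel_integrable[OF r N, where 'a='a] bump_kernel_integral[OF r N, where 'a='a]
    show ?case
    proof
      fix z :: 'a assume z: "z \<in> cball 0 R"
      have I: "integrable lborel (\<lambda>y. bump_kernel r N y * (h (z + y) - h z))"
        using bump_kernel_times_integrable[OF r N h, of z] kern by (simp add: right_diff_distrib)
      have "mollify (bump_kernel r N) h z - h z = (LINT y|lborel. bump_kernel r N y * (h (z + y) - h z))"
        using bump_kernel_times_integrable[OF r N h, of z] kern by (simp add: mollify_def right_diff_distrib)
      also have "\<bar>\<dots>\<bar> \<le> (LINT y|lborel. \<bar>bump_kernel r N y * (h (z + y) - h z)\<bar>)"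
        using integral_norm_bound[of lborel] by simp
      also have "\<dots> \<le> (LINT y|lborel. bump_kernel r N (y::'a) * (\<eta> / 2) +
          indicator (cball 0 r) y * (\<theta> ^ N / measure lborel (cball (0::'a) (d / 2)) * (2 * B)))"
      proof (rule integral_mono)
        show "integrable lborel (\<lambda>y. \<bar>bump_kernel r N y * (h (z + y) - h z)\<bar>)" using I by simp
        show "integrable lborel (\<lambda>y::'a. bump_kernel r N y * (\<eta> / 2) +
          indicator (cball 0 r) y * (\<theta> ^ N / measure lborel (cball (0::'a) (d / 2)) * (2 * B)))"
          using kern by (intro Bochner_Integration.integrable_add integrable_cball) simp
        fix y :: 'a
        have k0: "bump_kernel r N y \<ge> 0" by (rule bump_kernel_nonneg[OF r N])
        have t0: "0 \<le> \<theta> ^ N / measure lborel (cball (0::'a) (d / 2)) * (2 * B)" using \<theta> B by simp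
        consider "norm y < d" | "d \<le> norm y" "norm y \<le> r" | "norm y > r" by linarith
        then show "\<bar>bump_kernel r N y * (h (z + y) - h z)\<bar> \<le> bump_kernel r N y * (\<eta> / 2) +
          indicator (cball 0 r) y * (\<theta> ^ N / measure lborel (cball (0::'a) (d / 2)) * (2 * B))"
        proof cases
          case 1
          have "z + y \<in> ?K" "z \<in> ?K" using z 1 d r norm_triangle_ineq[of z y] by auto
          then have "\<bar>h (z + y) - h z\<bar> \<le> \<eta> / 2"
            using d0(2)[of "z + y" z] 1 d by (simp add: dist_norm dist_real_def)
          then have "\<bar>bump_kernel r N y * (h (z + y) - h z)\<bar> \<le> bump_kernel r N y * (\<eta> / 2)"
            unfolding abs_mult abs_of_nonneg[OF k0] by (rule mult_left_mono[OF _ k0])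
          then show ?thesis using t0 by (simp add: indicator_def)
        next
          case 2
          have "z + y \<in> ?K" "z \<in> ?K" using z 2 d r norm_triangle_ineq[of z y] by auto
          then have "\<bar>h (z + y) - h z\<bar> \<le> 2 * B" using B(2)[of "z + y"] B(2)[of z] by simp
          then have "\<bar>bump_kernel r N y * (h (z + y) - h z)\<bar> \<le>
              \<theta> ^ N / measure lborel (cball (0::'a) (d / 2)) * (2 * B)"
            using k0 bump_kernel_tail[OF r N d(1,2) 2(1)] B \<theta> unfolding abs_mult \<theta>_def[symmetric]
            by (intro mult_mono) auto
          then show ?thesis using 2 k0 \<eta> by (simp add: add_increasing)
        next
          case 3
          then show ?thesis using bump_kernel_supp[OF r N, of y] by simp
        qed
      qed
      also have "\<dots> = \<eta> / 2 + \<theta> ^ N * V * (2 * B)"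
        using kern integrable_cball[of r, where 'a='a] by (simp add: V_def)
      finally show "\<bar>mollify (bump_kernel r N) h z - h z\<bar> \<le> \<eta>" using elim by linarith
    qed
  qed
qed

text \<open>Finite sums of products of a polynomial in z and a continuous function of u. Integration
  over u against a compactly supported continuous function leaves a polynomial in z, which is how
  the Landau kernel produces polynomials.\<close>

inductive separable :: "('a::euclidean_space \<Rightarrow> 'a \<Rightarrow> real) \<Rightarrow> bool" where
  product: "real_polynomial_function p \<Longrightarrow> continuous_on UNIV m \<Longrightarrow> separable (\<lambda>z u. p z * m u)"
| add: "separable h \<Longrightarrow> separable k \<Longrightarrow> separable (\<lambda>z u. h z u + k z u)"

lemma separable_mult:
  assumes "separable h" "separable k"
  shows "separable (\<lambda>z u. h z u * k z u)"
  using assms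
proof (induction h)
  case (product p m)
  from \<open>separable k\<close> show ?case
  proof (induction k)
    case (product p' m')
    have "separable (\<lambda>z u. (p z * p' z) * (m u * m' u))"
      using product.hyps \<open>real_polynomial_function p\<close> \<open>continuous_on UNIV m\<close>
      by (intro separable.product continuous_intros real_polynomial_function.intros(4))
    then show ?case by (simp add: mult_ac)
  next
    case (add h k)
    then show ?case using separable.add by (fastforce simp: distrib_left)
  qed
next
  case (add h k)
  then show ?case using separable.add by (fastforce simp: distrib_right)
qed

lemma separable_power: "separable h \<Longrightarrow> separable (\<lambda>z u. h z u ^ N)"
proof (induction N)
  case 0
  show ?case using separable.product[of "\<lambda>_. 1" "\<lambda>_. 1"] by (simp add: real_polynomial_function.intros)
next
  case (Suc N)
  then show ?case using separable_mult by auto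
qed

lemma separable_sum: "finite I \<Longrightarrow> (\<And>i. i \<in> I \<Longrightarrow> separable (h i)) \<Longrightarrow> separable (\<lambda>z u. \<Sum>i\<in>I. h i z u)"
proof (induction I rule: finite_induct)
  case empty
  show ?case using separable.product[of "\<lambda>_. 0" "\<lambda>_. 0"] by (simp add: real_polynomial_function.intros)
qed (auto intro: separable.add)

lemma separable_bump: "separable (\<lambda>z u. (1 - (norm (u - z) / r)\<^sup>2) ^ N)"
proof (rule separable_power)
  have lin: "real_polynomial_function (\<lambda>z::'a. z \<bullet> b)" for b
    by (intro real_polynomial_function.intros(1) bounded_linear_inner_left)
  have poly: "real_polynomial_function (\<lambda>z::'a. z \<bullet> z)"
  proof -
    have "(\<lambda>z::'a. z \<bullet> z) = (\<lambda>z. \<Sum>b\<in>Basis. (z \<bullet> b) * (z \<bullet> b))"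
      by (rule ext, rule euclidean_inner)
    then show ?thesis
      by (simp only:) (intro real_polynomial_function_sum finite_Basis real_polynomial_function.intros(4) lin)
  qed
  have "separable (\<lambda>(z::'a) u. ((1 - (z \<bullet> z) / r\<^sup>2) * 1 + 1 * (- (u \<bullet> u) / r\<^sup>2)) + (\<Sum>b\<in>Basis. (z \<bullet> b) * (2 * (u \<bullet> b) / r\<^sup>2)))"
    by (intro separable.add separable_sum separable.product finite_Basis lin real_polynomial_function_diff
          real_polynomial_function.intros(2) real_polynomial_function_divide poly)
       (auto intro!: continuous_intros simp: divide_inverse)
  moreover have "((1 - (z \<bullet> z) / r\<^sup>2) * 1 + 1 * (- (u \<bullet> u) / r\<^sup>2)) + (\<Sum>b\<in>Basis. (z \<bullet> b) * (2 * (u \<bullet> b) / r\<^sup>2))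
     = 1 - (norm (u - z) / r)\<^sup>2" for z u :: 'a
  proof -
    have "(\<Sum>b\<in>Basis. (z \<bullet> b) * (2 * (u \<bullet> b) / r\<^sup>2)) = (z \<bullet> u) * (2 / r\<^sup>2)"
      by (subst euclidean_inner[of z u]) (simp add: sum_distrib_right sum_distrib_left sum_divide_distrib mult_ac)
    moreover have "(norm (u - z))\<^sup>2 = u \<bullet> u - 2 * (z \<bullet> u) + z \<bullet> z"
      by (simp add: power2_norm_eq_inner inner_diff_left inner_diff_right inner_commute)
    ultimately show ?thesis by (simp add: power_divide diff_divide_distrib add_divide_distrib)
  qed
  ultimately show "separable (\<lambda>z u. 1 - (norm (u - z :: 'a) / r)\<^sup>2)" by (simp only:)
qed

lemma separable_integral_polynomial:
  fixes g :: "'a::euclidean_space \<Rightarrow> real"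
  assumes "separable h" and g: "continuous_on UNIV g" "\<And>u. norm u > R \<Longrightarrow> g u = 0"
  shows "real_polynomial_function (\<lambda>z. LINT u|lborel. h z u * g u) \<and> (\<forall>z. integrable lborel (\<lambda>u. h z u * g u))"
  using assms(1)
proof induction
  case (product p m)
  have "integrable lborel (\<lambda>u. indicator (cball 0 R) u *\<^sub>R (m u * g u))"
    by (rule borel_integrable_compact)
       (auto intro!: continuous_intros continuous_on_subset[OF g(1)] continuous_on_subset[OF product(2)])
  moreover have "(\<lambda>u. indicator (cball 0 R) u *\<^sub>R (m u * g u)) = (\<lambda>u. m u * g u)"
    using g(2) by (force simp: indicator_def)
  ultimately have "integrable lborel (\<lambda>u. m u * g u)" by simp
  then show ?case using product(1)
    by (auto simp: mult.assoc intro!: real_polynomial_function.intros(2,4))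
next
  case (add h k)
  then show ?case by (auto simp: distrib_right intro!: real_polynomial_function.intros(3))
qed

lemma real_polynomial_function_deriv:
  assumes "real_polynomial_function q"
  shows "\<exists>q'. (\<forall>z. (q has_derivative q' z) (at z)) \<and> (\<forall>e. real_polynomial_function (\<lambda>z. q' z e))"
  using assms
proof induction
  case (linear h)
  then show ?case
    by (intro exI[of _ "\<lambda>z. h"]) (auto intro: bounded_linear_imp_has_derivative real_polynomial_function.intros)
next
  case (const c)
  show ?case by (intro exI[of _ "\<lambda>z e. 0"]) (auto intro: real_polynomial_function.intros)
next
  case (add f g)
  then obtain f' g' where
    "\<And>z. (f has_derivative f' z) (at z)" "\<And>e. real_polynomial_function (\<lambda>z. f' z e)"
    "\<And>z. (g has_derivative g' z) (at z)" "\<And>e. real_polynomial_function (\<lambda>z. g' z e)" by auto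
  then show ?case
    by (intro exI[of _ "\<lambda>z e. f' z e + g' z e"]) (auto intro!: derivative_intros real_polynomial_function.intros(3))
next
  case (mult f g)
  then obtain f' g' where
    "\<And>z. (f has_derivative f' z) (at z)" "\<And>e. real_polynomial_function (\<lambda>z. f' z e)"
    "\<And>z. (g has_derivative g' z) (at z)" "\<And>e. real_polynomial_function (\<lambda>z. g' z e)" by auto
  then show ?case using mult.hyps
    by (intro exI[of _ "\<lambda>z e. f z * g' z e + f' z e * g z"])
       (auto intro!: derivative_intros real_polynomial_function.intros(3) real_polynomial_function.intros(4))
qed

lemma C1_compact_support_lipschitz:
  fixes g :: "'a::euclidean_space \<Rightarrow> real"
  assumes g: "C1_on UNIV g g'" and supp: "\<And>z. norm z > R \<Longrightarrow> g z = 0"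
  obtains C where "C-lipschitz_on UNIV g"
proof -
  have zero: "g' z e = 0" if "norm z > R" for z e
  proof -
    have o: "open {z::'a. norm z > R}" by (intro open_Collect_less continuous_intros)
    have "(g has_derivative (\<lambda>e. 0)) (at z)"
      by (rule has_derivative_transform_within_open[OF has_derivative_const[of 0] o]) (use that supp in auto)
    with C1_onD(1)[OF g, of z] show ?thesis using has_derivative_unique by (metis UNIV_I)
  qed
  have "\<exists>B. \<forall>z. \<bar>g' z b\<bar> \<le> B" for b
  proof -
    have "compact ((\<lambda>z. g' z b) ` cball 0 R)"
      by (intro compact_continuous_image continuous_on_subset[OF C1_onD(2)[OF g]]) auto
    then obtain B where B: "B > 0" "\<And>z. z \<in> cball 0 R \<Longrightarrow> \<bar>g' z b\<bar> \<le> B"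
      by (auto simp: bounded_pos dest!: compact_imp_bounded)
    have "\<bar>g' z b\<bar> \<le> B" for z using B zero[of z b] by (cases "norm z > R") auto
    then show ?thesis by blast
  qed
  then obtain B where B: "\<And>b z. \<bar>g' z b\<bar> \<le> B b" by metis
  define C where "C = (\<Sum>b\<in>Basis. B b)"
  have B0: "B b \<ge> 0" for b using B[of 0 b] by linarith
  have C: "C \<ge> 0" unfolding C_def by (intro sum_nonneg B0)
  have bound: "\<bar>g' z e\<bar> \<le> C * norm e" for z e
  proof -
    have "\<bar>g' z e\<bar> \<le> (\<Sum>b\<in>Basis. \<bar>(e \<bullet> b) * g' z b\<bar>)"
      by (subst C1_on_deriv_basis[OF g]) (auto simp: sum_abs)
    also have "\<dots> \<le> (\<Sum>b\<in>Basis. norm e * B b)"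
      by (intro sum_mono) (auto simp: abs_mult Basis_le_norm intro!: mult_mono B)
    finally show ?thesis by (simp add: C_def sum_distrib_left mult.commute)
  qed
  have "C-lipschitz_on UNIV g"
  proof (rule bounded_derivative_imp_lipschitz)
    show "(g has_derivative g' x) (at x within UNIV)" for x using C1_onD(1)[OF g] by simp
    show "onorm (g' x) \<le> C" for x by (rule onorm_bound[OF C]) (use bound in auto)
  qed (use C in auto)
  then show thesis by (rule that)
qed

text \<open>Differentiation commutes with the Landau mollification, so one kernel approximates
  \<open>g\<close> and all its directional derivatives at once. On the ball in question the
  mollification coincides with a polynomial.\<close>

theorem C1_Weierstrass:
  fixes g :: "'a::euclidean_space \<Rightarrow> real"
  assumes g: "C1_on UNIV g g'" and supp: "\<And>z. norm z > R \<Longrightarrow> g z = 0" and R: "R > 0" and \<epsilon>: "\<epsilon> > 0"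
  obtains q q' where "real_polynomial_function q" "\<And>z. (q has_derivative q' z) (at z)"
    "\<And>z. z \<in> cball 0 R \<Longrightarrow> \<bar>q z - g z\<bar> \<le> \<epsilon>"
    "\<And>z e. z \<in> cball 0 R \<Longrightarrow> \<bar>q' z e - g' z e\<bar> \<le> \<epsilon> * norm e"
proof -
  \<comment> \<open>For \<open>norm z < R + 1/2\<close> and u in the support of \<open>g\<close>,
    the distance of u and z is below \<open>2 * R + 1\<close>, so the truncation in
    \<open>bump\<close> is inactive and the integrand is polynomial in z.\<close>
  define r where "r = 2 * R + 1"
  have r: "r > 0" using R by (simp add: r_def)
  obtain C where lip: "C-lipschitz_on UNIV g" using C1_compact_support_lipschitz[OF g supp] by blast
  define \<epsilon>' where "\<epsilon>' = \<epsilon> / real DIM('a)"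
  have \<epsilon>': "\<epsilon>' > 0" using \<epsilon> by (simp add: \<epsilon>'_def)
  have gc: "continuous_on UNIV g" by (rule C1_on_continuous_on[OF g])
  have "\<forall>\<^sub>F N in sequentially. \<forall>b\<in>Basis. \<forall>z\<in>cball 0 R. \<bar>mollify (bump_kernel r N) (\<lambda>z. g' z b) z - g' z b\<bar> \<le> \<epsilon>'"
    by (intro eventually_ball_finite finite_Basis ballI bump_kernel_approx[OF _ r \<epsilon>'] C1_onD(2)[OF g])
  moreover have "\<forall>\<^sub>F N in sequentially. \<forall>z\<in>cball 0 R. \<bar>mollify (bump_kernel r N) g z - g z\<bar> \<le> \<epsilon>"
    by (intro bump_kernel_approx gc r \<epsilon>)
  ultimately have "\<forall>\<^sub>F N in sequentially. N > 0 \<and> (\<forall>z\<in>cball 0 R. \<bar>mollify (bump_kernel r N) g z - g z\<bar> \<le> \<epsilon>)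
     \<and> (\<forall>b\<in>Basis. \<forall>z\<in>cball 0 R. \<bar>mollify (bump_kernel r N) (\<lambda>z. g' z b) z - g' z b\<bar> \<le> \<epsilon>')"
    using eventually_gt_at_top[of 0] by eventually_elim auto
  then obtain N where N: "N > 0" and a0: "\<And>z. z \<in> cball 0 R \<Longrightarrow> \<bar>mollify (bump_kernel r N) g z - g z\<bar> \<le> \<epsilon>"
    and a1: "\<And>b z. b \<in> Basis \<Longrightarrow> z \<in> cball 0 R \<Longrightarrow> \<bar>mollify (bump_kernel r N) (\<lambda>z. g' z b) z - g' z b\<bar> \<le> \<epsilon>'"
    using eventually_happens'[OF sequentially_bot] by (smt (verit) eventually_mono)
  let ?k = "bump_kernel r N :: 'a \<Rightarrow> real"
  interpret lipschitz_mollify ?k g r C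
    by unfold_locales (auto simp: bump_kernel_cont[OF r N] bump_kernel_supp[OF r N] lip)
  define I where "I = (LINT y|lborel. bump r N (y::'a))"
  define q where "q z = (LINT u|lborel. (1 - (norm (u - z) / r)\<^sup>2) ^ N * g u) / I" for z
  have poly: "real_polynomial_function q"
    unfolding q_def using separable_integral_polynomial[OF separable_bump gc supp]
    by (intro real_polynomial_function_divide) blast
  then obtain q' where q': "\<And>z. (q has_derivative q' z) (at z)"
    using real_polynomial_function_deriv by blast
  \<comment> \<open>The margin 1/2 makes the identity hold on an open neighbourhood of
    \<open>cball 0 R\<close>, so that the derivatives agree on the closed ball as well.\<close>
  have eq: "mollify ?k g z = q z" if z: "norm z < R + 1/2" for z
  proof -
    have "mollify ?k g z = (LINT u|lborel. ?k (u - z) * g u)"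
      unfolding mollify_def
      by (subst lborel_integral_translate[where z=z and h="\<lambda>u. ?k (u - z) * g u"]) (use bump_kernel_measurable[OF r N] in auto)
    also have "\<dots> = (LINT u|lborel. (1 - (norm (u - z) / r)\<^sup>2) ^ N * g u / I)"
    proof (rule Bochner_Integration.integral_cong[OF refl])
      fix u :: 'a
      show "?k (u - z) * g u = (1 - (norm (u - z) / r)\<^sup>2) ^ N * g u / I"
      proof (cases "norm u > R")
        case False
        then have "norm (u - z) \<le> r" using z norm_triangle_ineq4[of u z] by (simp add: r_def)
        then have "(norm (u - z) / r)\<^sup>2 \<le> 1" using r by (simp add: power_le_one)
        then show ?thesis by (simp add: bump_kernel_def bump_def I_def)
      qed (simp add: supp)
    qed
    finally show ?thesis by (simp add: q_def)
  qed
  have d_eq: "q' z = mollify_deriv ?k g z" if z: "z \<in> cball 0 R" for z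
  proof -
    have "(q has_derivative mollify_deriv ?k g z) (at z)"
      by (rule has_derivative_transform_within_open[OF mollify_has_derivative, of "ball 0 (R + 1/2)"])
         (use z eq in auto)
    then show ?thesis using q' has_derivative_unique by blast
  qed
  have m_eq: "mollify_deriv ?k g z e = mollify ?k (\<lambda>z. g' z e) z" for z e
    unfolding mollify_deriv_def mollify_def using lim_quot_eq_derivative[OF C1_onD(1)[OF g]] by simp
  show thesis
  proof (rule that[OF poly q'])
    show "\<bar>q z - g z\<bar> \<le> \<epsilon>" if "z \<in> cball 0 R" for z
      using a0[OF that] eq[of z] that by simp
    fix z e :: 'a assume z: "z \<in> cball 0 R"
    define l where "l e = q' z e - g' z e" for e
    have l: "linear l" unfolding l_def
      using has_derivative_bounded_linear[OF q', of z] C1_on_linear[OF g, of z]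
      by (intro linear_compose_sub bounded_linear.linear) auto
    have "l e = l (\<Sum>b\<in>Basis. (e \<bullet> b) *\<^sub>R b)" by (simp add: euclidean_representation)
    then have "l e = (\<Sum>b\<in>Basis. (e \<bullet> b) * (q' z b - g' z b))"
      by (simp add: linear_sum[OF l] linear_scale[OF l]) (simp add: l_def)
    then have "\<bar>q' z e - g' z e\<bar> \<le> (\<Sum>b\<in>Basis. \<bar>(e \<bullet> b) * (q' z b - g' z b)\<bar>)"
      by (simp add: l_def sum_abs)
    also have "\<dots> \<le> (\<Sum>b\<in>(Basis::'a set). norm e * \<epsilon>')"
      using a1[OF _ z]
      by (intro sum_mono) (auto simp: abs_mult Basis_le_norm d_eq[OF z] m_eq intro!: mult_mono)
    also have "\<dots> = \<epsilon> * norm e" by (simp add: \<epsilon>'_def)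
    finally show "\<bar>q' z e - g' z e\<bar> \<le> \<epsilon> * norm e" .
  qed
qed

section \<open>Closed measures\<close>

lemma Ck_on_cong:
  "(\<And>p. p \<in> S \<Longrightarrow> f p = g p) \<Longrightarrow> Ck_on k S f \<longleftrightarrow> Ck_on k S g"
proof (induction k arbitrary: f g)
  case 0
  then show ?case by (auto cong: continuous_on_cong)
next
  case (Suc k)
  have hd: "(f has_derivative D) (at p within S) \<longleftrightarrow> (g has_derivative D) (at p within S)" if "p \<in> S" for p D
    using Suc.prems that by (metis has_derivative_transform)
  then have "f differentiable_on S \<longleftrightarrow> g differentiable_on S"
    by (simp add: differentiable_on_def differentiable_def)
  moreover have "dir_deriv S e f p = dir_deriv S e g p" if "p \<in> S" for e p
    using hd[OF that] by (simp add: dir_deriv_def frechet_derivative_def)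
  then have "Ck_on k S (dir_deriv S e f) \<longleftrightarrow> Ck_on k S (dir_deriv S e g)" for e
    using Suc.IH by blast
  ultimately show ?case by simp
qed

text \<open>The accumulation hypothesis makes derivatives within \<open>S\<close> unique, so those
  selected by \<open>frechet_derivative\<close> are the derivatives on the whole space. These are
  polynomials again and the induction continues.\<close>

lemma polynomial_smooth_fun_on:
  fixes q :: "'a::euclidean_space \<Rightarrow> real"
  assumes S: "\<And>p i e. \<lbrakk>p \<in> S; i \<in> Basis; e > 0\<rbrakk> \<Longrightarrow> \<exists>d. 0 < \<bar>d\<bar> \<and> \<bar>d\<bar> < e \<and> (p + d *\<^sub>R i) \<in> S"
    and q: "real_polynomial_function q"
  shows "smooth_fun_on S q"
proof -
  have "Ck_on k S q" for k
    using q
  proof (induction k arbitrary: q)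
    case 0
    then show ?case
      by (simp add: continuous_at_imp_continuous_on continuous_real_polymonial_function)
  next
    case (Suc k)
    obtain q' where q': "\<And>z. (q has_derivative q' z) (at z)" "\<And>e. real_polynomial_function (\<lambda>z. q' z e)"
      using real_polynomial_function_deriv[OF Suc.prems] by blast
    have hd: "(q has_derivative q' p) (at p within S)" for p
      using q'(1) has_derivative_at_withinI by blast
    have "frechet_derivative q (at p within S) = q' p" if "p \<in> S" for p
      by (rule frechet_derivative_unique_within[OF _ hd[of p] S[OF that]])
         (use hd in \<open>auto simp: frechet_derivative_works[symmetric] differentiable_def\<close>)
    then have "Ck_on k S (dir_deriv S e q) \<longleftrightarrow> Ck_on k S (\<lambda>z. q' z e)" for e
      by (intro Ck_on_cong) (simp add: dir_deriv_def)
    then show ?case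
      using Suc.IH[OF q'(2)] hd by (auto simp: differentiable_on_def differentiable_def)
  qed
  then show ?thesis by (simp add: smooth_fun_on_def)
qed

lemma base_accumulates:
  fixes U :: "(real ^ 'n::finite) set"
  assumes "open U" "t0 > 0" "p \<in> base U t0" "i \<in> Basis" "e > 0"
  shows "\<exists>d. 0 < \<bar>d\<bar> \<and> \<bar>d\<bar> < e \<and> (p + d *\<^sub>R i) \<in> base U t0"
proof -
  obtain x t where p: "p = (x, t)" "x \<in> U" "0 \<le> t" "t \<le> t0" using assms(3) by (auto simp: base_def)
  consider b where "i = (b, 0)" "b \<in> Basis" | "i = (0, 1)"
    using assms(4) by (auto simp: Basis_prod_def)
  then show ?thesis
  proof cases
    case 1
    obtain r where r: "r > 0" "ball x r \<subseteq> U" using p(2) assms(1) by (meson openE)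
    define d where "d = min r e / 2"
    have "0 < d" "d < r" "d < e" using r assms(5) by (auto simp: d_def)
    then have "x + d *\<^sub>R b \<in> ball x r" using 1 by (simp add: dist_norm)
    then show ?thesis using r p 1 \<open>0 < d\<close> \<open>d < e\<close> by (intro exI[of _ d]) (auto simp: base_def)
  next
    case 2
    show ?thesis
    proof (cases "t < t0")
      case True
      then show ?thesis using p 2 assms(5)
        by (intro exI[of _ "min (e / 2) (t0 - t)"]) (auto simp: base_def)
    next
      case False
      then show ?thesis using p 2 assms(2,5)
        by (intro exI[of _ "- min (e / 2) t0"]) (auto simp: base_def)
    qed
  qed
qed

lemma frechet_derivative_base:
  assumes "open U" "t0 > 0" "p \<in> base U t0" "(f has_derivative D) (at p)"
  shows "frechet_derivative f (at p within base U t0) = D"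
proof -
  have hd: "(f has_derivative D) (at p within base U t0)" using assms(4) has_derivative_at_withinI by blast
  show ?thesis
    by (rule frechet_derivative_unique_within[OF _ hd base_accumulates[OF assms(1-3)]])
       (use hd in \<open>auto simp: frechet_derivative_works[symmetric] differentiable_def\<close>)
qed

text \<open>The squares make the positive parts C^1, and the two summands of the denominator never
  vanish together. C^1 regularity is all that is claimed of it.\<close>

definition smooth_step :: "real \<Rightarrow> real" where
  "smooth_step s = (max 0 s)\<^sup>2 / ((max 0 s)\<^sup>2 + (max 0 (1 - s))\<^sup>2)"

lemma smooth_step_0: "s \<le> 0 \<Longrightarrow> smooth_step s = 0" and smooth_step_1: "s \<ge> 1 \<Longrightarrow> smooth_step s = 1"
  by (auto simp: smooth_step_def max_def)

lemma smooth_step_denominator: "(max 0 s)\<^sup>2 + (max 0 (1 - s))\<^sup>2 > (0::real)"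
proof (cases "s > 0")
  case True
  then show ?thesis by (simp add: add_pos_nonneg)
next
  case False
  then show ?thesis by (simp add: max_def)
qed

lemma smooth_step_range: "0 \<le> smooth_step s" "smooth_step s \<le> 1"
  using smooth_step_denominator[of s] by (simp_all add: smooth_step_def)

lemma max_power2_deriv: "((\<lambda>s::real. (max 0 s)\<^sup>2) has_real_derivative 2 * max 0 s) (at s)"
proof -
  consider "s > 0" | "s < 0" | "s = 0" by linarith
  then show ?thesis
  proof cases
    case 1
    have "((\<lambda>s::real. s\<^sup>2) has_real_derivative 2 * max 0 s) (at s)" using 1 by (auto intro!: derivative_eq_intros)
    then show ?thesis
      by (rule has_field_derivative_transform_within_open[where S="{0<..}"]) (use 1 in auto)
  next
    case 2
    have "((\<lambda>s::real. 0) has_real_derivative 2 * max 0 s) (at s)" using 2 by (auto intro!: derivative_eq_intros)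
    then show ?thesis
      by (rule has_field_derivative_transform_within_open[where S="{..<0}"]) (use 2 in auto)
  next
    case 3
    have "((\<lambda>h::real. (max 0 h)\<^sup>2 / h) \<longlongrightarrow> 0) (at 0)"
    proof (rule Lim_null_comparison)
      show "\<forall>\<^sub>F h in at 0. norm ((max 0 h)\<^sup>2 / h) \<le> \<bar>h::real\<bar>"
        by (rule always_eventually) (auto simp: max_def power2_eq_square)
      show "((\<lambda>h::real. \<bar>h\<bar>) \<longlongrightarrow> 0) (at 0)" by (intro tendsto_rabs_zero tendsto_ident_at)
    qed
    then show ?thesis using 3 by (simp add: has_field_derivative_iff)
  qed
qed

definition smooth_step_deriv :: "real \<Rightarrow> real" where
  "smooth_step_deriv s = (let a = (max 0 s)\<^sup>2; b = (max 0 (1 - s))\<^sup>2; a' = 2 * max 0 s; b' = - (2 * max 0 (1 - s)) in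
     (a' * (a + b) - a * (a' + b')) / ((a + b) * (a + b)))"

lemma smooth_step_has_derivative: "(smooth_step has_real_derivative smooth_step_deriv s) (at s)"
proof -
  have 1: "((\<lambda>s::real. (max 0 (1 - s))\<^sup>2) has_real_derivative (2 * max 0 (1 - s)) * (- 1)) (at s)"
    by (rule DERIV_chain'[OF _ max_power2_deriv, of "\<lambda>s. 1 - s"]) (auto intro!: derivative_eq_intros)
  then show ?thesis
    unfolding smooth_step_def[abs_def] smooth_step_deriv_def Let_def
    using smooth_step_denominator[of s]
    by (intro DERIV_divide[OF max_power2_deriv DERIV_add[OF max_power2_deriv 1], THEN DERIV_cong]) auto
qed

lemma smooth_step_C1: "C1_on UNIV smooth_step (\<lambda>s e. smooth_step_deriv s * e)"
proof (rule C1_on_real)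
  show "continuous_on UNIV smooth_step_deriv"
    unfolding smooth_step_deriv_def Let_def
    by (intro continuous_intros ballI no_zero_divisors less_imp_neq[OF smooth_step_denominator, symmetric])
qed (rule smooth_step_has_derivative)

text \<open>The step is applied to a quadratic polynomial in z rather than to the norm, which avoids
  the singularity of the norm at 0.\<close>

lemma C1_cutoff:
  fixes R :: real
  assumes "R > 0"
  obtains h h' where "C1_on UNIV (h :: 'a::euclidean_space \<Rightarrow> real) h'" "\<And>z. norm z < R \<Longrightarrow> h z = 1"
    "\<And>z. norm z > 2 * R \<Longrightarrow> h z = 0"
proof -
  have inner: "C1_on UNIV (\<lambda>z::'a. 2 - (1 / R\<^sup>2) * (z \<bullet> z)) (\<lambda>z e. 0 - (1 / R\<^sup>2) * (z \<bullet> e + e \<bullet> z))"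
    by (intro C1_onI has_derivative_diff has_derivative_const has_derivative_mult_right has_derivative_inner
        has_derivative_ident continuous_intros)
  show thesis
  proof (rule that[OF C1_on_compose[OF smooth_step_C1 inner]])
    fix z :: 'a
    show "smooth_step (2 - (1 / R\<^sup>2) * (z \<bullet> z)) = 1" if "norm z < R"
    proof (rule smooth_step_1)
      have "z \<bullet> z \<le> R\<^sup>2" using that power_mono[of "norm z" R 2] by (simp add: power2_norm_eq_inner)
      then show "1 \<le> 2 - (1 / R\<^sup>2) * (z \<bullet> z)" using assms by (simp add: divide_le_eq)
    qed
    show "smooth_step (2 - (1 / R\<^sup>2) * (z \<bullet> z)) = 0" if "norm z > 2 * R"
    proof (rule smooth_step_0)
      have "(2 * R)\<^sup>2 \<le> z \<bullet> z" using that power_mono[of "2 * R" "norm z" 2] assms by (simp add: power2_norm_eq_inner)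
      then have "2 * R\<^sup>2 \<le> z \<bullet> z" using zero_le_power2[of R] unfolding power_mult_distrib by (simp del: zero_le_power2, linarith)
      then show "2 - (1 / R\<^sup>2) * (z \<bullet> z) \<le> 0" using assms by (simp add: le_divide_eq)
    qed
  qed auto
qed

abbreviation (input) lift :: "('n::finite) phase \<Rightarrow> (real ^ 'n) \<times> real" where
  "lift p \<equiv> (fst (snd p), 1)"

lemma proj_base_eq: "proj_base p = (fst p, snd (snd p))"
  by (simp add: proj_base_def split_beta)

lemma total_deriv_eq: "total_deriv U t0 f p = frechet_derivative f (at (proj_base p) within base U t0) (lift p)"
  by (simp add: total_deriv_def proj_base_def split_beta)

lemma continuous_on_proj_base [continuous_intros]: "continuous_on S proj_base"
  unfolding proj_base_def split_beta by (intro continuous_intros)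

section \<open>Closedness for C^1 functions, and null end times\<close>

locale closed_measure =
  fixes U :: "(real ^ 'n::finite) set" and t0 :: real and \<mu> :: "'n phase measure"
  assumes U: "open U" and t0: "t0 > 0" and closed_in: "closed_in U t0 \<mu>"
begin

abbreviation X :: "'n phase set" where "X \<equiv> msupport \<mu>"

text \<open>With the support as the whole space, an integrand has to be measurable on the support
  only. Compactness of the support makes this measure finite, so bounded convergence is
  available.\<close>

definition M :: "'n phase measure" where "M = restrict_space \<mu> X"

lemma compact_X: "compact X" and X_sub: "X \<subseteq> phase U t0"
  using closed_in by (auto simp: closed_in_def)

lemma sets_\<mu>: "sets \<mu> = sets borel"
  using closed_in by (simp add: closed_in_def radon_measure_def)

lemma space_\<mu>: "space \<mu> = UNIV" using sets_eq_imp_space_eq[OF sets_\<mu>] by simp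

lemma X_sets: "X \<in> sets \<mu>" using compact_X by (simp add: sets_\<mu> borel_compact)

lemma space_M [simp]: "space M = X" by (simp add: M_def space_restrict_space space_\<mu>)

lemma finite_M: "finite_measure M"
proof
  have "emeasure \<mu> X < \<infinity>" using closed_in compact_X by (simp add: closed_in_def radon_measure_def)
  then show "emeasure M (space M) \<noteq> \<infinity>"
    using X_sets by (simp add: M_def emeasure_restrict_space space_restrict_space space_\<mu>)
qed

lemma set_integral_M: "(LINT p:X|\<mu>. (h p :: real)) = (LINT p|M. h p)"
  unfolding M_def set_lebesgue_integral_def using X_sets by (subst integral_restrict_space) (auto simp: space_\<mu>)

lemma measurable_M:
  fixes h :: "'n phase \<Rightarrow> 'b::topological_space"
  assumes "continuous_on X h" shows "h \<in> borel_measurable M"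
  using borel_measurable_continuous_on_restrict[OF assms]
  by (simp add: M_def measurable_cong_sets[OF sets_restrict_space_cong[OF sets_\<mu>] refl])

lemma continuous_bounded_X:
  fixes h :: "'n phase \<Rightarrow> 'b::real_normed_vector"
  assumes "continuous_on X h" obtains B where "B > 0" "\<And>p. p \<in> X \<Longrightarrow> norm (h p) \<le> B"
  using compact_imp_bounded[OF compact_continuous_image[OF assms compact_X]] by (auto simp: bounded_pos)

lemma integrable_bounded_M:
  fixes h :: "'n phase \<Rightarrow> real"
  assumes "h \<in> borel_measurable M" "\<And>p. p \<in> X \<Longrightarrow> \<bar>h p\<bar> \<le> B"
  shows "integrable M h"
  by (rule finite_measure.integrable_const_bound[OF finite_M, where B=B])
     (use assms in \<open>auto intro!: AE_I2\<close>)

lemma integrable_M: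
  fixes h :: "'n phase \<Rightarrow> real"
  assumes "continuous_on X h" shows "integrable M h"
proof -
  obtain B where "\<And>p. p \<in> X \<Longrightarrow> norm (h p) \<le> B" using continuous_bounded_X[OF assms] by metis
  then show ?thesis by (intro integrable_bounded_M[where B=B] measurable_M assms) auto
qed

lemma dominated_M:
  fixes h :: "'n phase \<Rightarrow> real" and s :: "nat \<Rightarrow> 'n phase \<Rightarrow> real"
  assumes "\<And>n. s n \<in> borel_measurable M" "\<And>n p. p \<in> X \<Longrightarrow> \<bar>s n p\<bar> \<le> B"
    and "\<And>p. p \<in> X \<Longrightarrow> (\<lambda>n. s n p) \<longlonglongrightarrow> h p"
  shows "(\<lambda>n. LINT p|M. s n p) \<longlonglongrightarrow> (LINT p|M. h p)"
proof (rule integral_dominated_convergence[where w="\<lambda>_. B"])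
  show "h \<in> borel_measurable M"
    by (rule borel_measurable_LIMSEQ_metric[where f=s]) (use assms in auto)
  show "integrable M (\<lambda>_. B)" using finite_M by (simp add: finite_measure.integrable_const)
qed (use assms in \<open>auto intro!: AE_I2\<close>)

lemma proj_X: "p \<in> X \<Longrightarrow> proj_base p \<in> base U t0"
  using X_sub by (auto simp: proj_base_def phase_def base_def)

text \<open>This is the only access to the closedness hypothesis: polynomials are the functions
  whose smoothness up to the boundary of I has been established.\<close>

lemma closed_polynomial:
  assumes q: "real_polynomial_function q" and q': "\<And>z. (q has_derivative q' z) (at z)"
    and van: "\<And>x. q (x, 0) = 0" "\<And>x. q (x, t0) = 0"
  shows "(LINT p|M. q' (proj_base p) (lift p)) = 0"
proof -
  have "smooth_fun_on (base U t0) q"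
    by (rule polynomial_smooth_fun_on[OF base_accumulates[OF U t0] q])
  then have "(LINT p|M. total_deriv U t0 q p) = 0"
    using closed_in van unfolding closed_in_def set_integral_M by blast
  moreover have "(LINT p|M. total_deriv U t0 q p) = (LINT p|M. q' (proj_base p) (lift p))"
    by (rule Bochner_Integration.integral_cong[OF refl])
       (simp add: total_deriv_eq frechet_derivative_base[OF U t0 proj_X q'])
  ultimately show ?thesis by simp
qed

text \<open>A polynomial approximation of \<open>g\<close> need not vanish at the end times.
  Therefore \<open>g\<close> is first divided by \<open>w = t * (t0 - t)\<close>, possible because
  it vanishes near the ends, and cut off in space; the quotient is approximated in C^1, and
  multiplying back by \<open>w\<close> gives exactly admissible polynomials.\<close>

lemma closed_C1:
  fixes g :: "(real ^ 'n) \<times> real \<Rightarrow> real"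
  assumes g: "C1_on UNIV g g'" and \<delta>: "\<delta> > 0" and van: "\<And>x t. t < \<delta> \<or> t > t0 - \<delta> \<Longrightarrow> g (x, t) = 0"
  shows "(LINT p|M. g' (proj_base p) (lift p)) = 0"
proof -
  have lift_cont: "continuous_on X lift" by (intro continuous_intros)
  obtain R0 where R0: "R0 > 0" "\<And>p. p \<in> X \<Longrightarrow> norm (proj_base p) \<le> R0"
    using continuous_bounded_X[OF continuous_on_proj_base] by metis
  obtain B where B: "B > 0" "\<And>p. p \<in> X \<Longrightarrow> norm (lift p) \<le> B"
    using continuous_bounded_X[OF lift_cont] by metis
  define R where "R = R0 + 1"
  have R: "R > 0" "\<And>p. p \<in> X \<Longrightarrow> norm (proj_base p) < R" using R0 by (fastforce simp: R_def)+
  obtain c c' where c: "C1_on UNIV (c :: (real^'n) \<times> real \<Rightarrow> real) c'" "\<And>z. norm z < R \<Longrightarrow> c z = 1"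
      "\<And>z. norm z > 2 * R \<Longrightarrow> c z = 0"
    using C1_cutoff[OF R(1)] by blast
  define \<Omega> where "\<Omega> = (UNIV :: (real^'n) set) \<times> {0<..<t0}"
  define K where "K = (UNIV :: (real^'n) set) \<times> {\<delta>..t0 - \<delta>}"
  have \<Omega>: "open \<Omega>" and K: "closed K" "K \<subseteq> \<Omega>"
    using \<delta> by (auto simp: \<Omega>_def K_def intro!: open_Times closed_Times)
  define w where "w z = snd z * (t0 - snd z)" for z :: "(real^'n) \<times> real"
  define w' where "w' z e = snd e * (t0 - 2 * snd z)" for z e :: "(real^'n) \<times> real"
  have w: "C1_on S w w'" for S
    unfolding w_def w'_def
    by (rule C1_onI) (auto intro!: derivative_eq_intros continuous_intros simp: algebra_simps)
  have w0: "w z \<noteq> 0" if "z \<in> \<Omega>" for z using that by (auto simp: w_def \<Omega>_def)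
  have iw: "C1_on \<Omega> (\<lambda>z. inverse (w z)) (\<lambda>z e. - (inverse (w z) * w' z e * inverse (w z)))"
  proof (rule C1_onI)
    show "((\<lambda>z. inverse (w z)) has_derivative (\<lambda>e. - (inverse (w z) * w' z e * inverse (w z)))) (at z)" if "z \<in> \<Omega>" for z
      using C1_onD(1)[OF w[of UNIV]] w0[OF that] by (intro Deriv.has_derivative_inverse) auto
    show "continuous_on \<Omega> (\<lambda>z. - (inverse (w z) * w' z e * inverse (w z)))" for e
      using w0 by (intro continuous_intros C1_on_continuous_on[OF w] C1_onD(2)[OF w]) auto
  qed
  define G where "G z = (if z \<in> \<Omega> then inverse (w z) * (c z * g z) else 0)" for z
  note sub = C1_on_subset[OF _ subset_UNIV, of _ _ \<Omega>]
  have "\<exists>G'. C1_on UNIV G G'"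
    unfolding G_def
  proof (rule exI, rule C1_on_extend_zero[OF C1_on_mult[OF iw C1_on_mult[OF sub[OF c(1)] sub[OF g]]] \<Omega> K])
    fix z assume "z \<in> \<Omega> - K"
    then show "inverse (w z) * (c z * g z) = 0"
      using van[of "snd z" "fst z"] by (cases z) (auto simp: \<Omega>_def K_def)
  qed
  then obtain G' where G: "C1_on UNIV G G'" by blast
  have Gsupp: "G z = 0" if "norm z > 2 * R" for z using c(3)[OF that] by (simp add: G_def)
  have gw: "g z = w z * G z" if "norm z < R" for z
  proof (cases "z \<in> \<Omega>")
    case True
    then show ?thesis using w0 c(2)[OF that] by (simp add: G_def)
  next
    case False
    then show ?thesis using van[of "snd z" "fst z"] \<delta> by (cases z) (auto simp: G_def \<Omega>_def)
  qed
  have g'w: "g' z e = w z * G' z e + w' z e * G z" if z: "norm z < R" for z e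
  proof -
    have "(g has_derivative (\<lambda>e. w z * G' z e + w' z e * G z)) (at z)"
      by (rule has_derivative_transform_within_open[OF C1_onD(1)[OF C1_on_mult[OF w G]], where s="ball 0 R"])
         (use z gw in auto)
    from has_derivative_unique[OF this C1_onD(1)[OF g UNIV_I]] show ?thesis by metis
  qed
  have R2: "2 * R > 0" using R(1) by simp
  \<comment> \<open>On the support \<open>w\<close> is bounded by \<open>t0 * t0\<close>, its
    derivative along the lift by \<open>t0\<close>, and the lift by \<open>B\<close>; by the product
    rule \<open>\<epsilon> * D\<close> bounds the pointwise error.\<close>
  define D where "D = t0 * t0 * B + t0"
  have "\<bar>LINT p|M. g' (proj_base p) (lift p)\<bar> \<le> \<epsilon> * (D * measure M X)" if \<epsilon>: "\<epsilon> > 0" for \<epsilon>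
  proof -
    obtain q q' where q: "real_polynomial_function q" "\<And>z. (q has_derivative q' z) (at z)"
      and q0: "\<And>z. z \<in> cball 0 (2 * R) \<Longrightarrow> \<bar>q z - G z\<bar> \<le> \<epsilon>"
      and q1: "\<And>z e. z \<in> cball 0 (2 * R) \<Longrightarrow> \<bar>q' z e - G' z e\<bar> \<le> \<epsilon> * norm e"
      by (rule C1_Weierstrass[OF G Gsupp R2 \<epsilon>]) blast+
    define Q' where "Q' z e = w z * q' z e + w' z e * q z" for z e
    have Qd: "((\<lambda>z. w z * q z) has_derivative Q' z) (at z)" for z
      unfolding Q'_def using has_derivative_mult[OF C1_onD(1)[OF w, of z UNIV] q(2)] by simp
    have wp: "real_polynomial_function w"
      unfolding w_def
      by (intro real_polynomial_function.intros(4) real_polynomial_function_diff real_polynomial_function.intros(2)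
          real_polynomial_function.intros(1) bounded_linear_snd)
    have Qp: "real_polynomial_function (\<lambda>z. w z * q z)"
      by (intro real_polynomial_function.intros(4) wp q(1))
    have 0: "(LINT p|M. Q' (proj_base p) (lift p)) = 0"
      by (rule closed_polynomial[OF Qp Qd]) (auto simp: w_def)
    have gi: "integrable M (\<lambda>p. g' (proj_base p) (lift p))"
      by (intro integrable_M C1_on_continuous_deriv[OF g] continuous_on_proj_base lift_cont) auto
    obtain q'' where q'': "\<And>z. (q has_derivative q'' z) (at z)" "\<And>e. real_polynomial_function (\<lambda>z. q'' z e)"
      using real_polynomial_function_deriv[OF q(1)] by blast
    have "q' = q''" using q(2) q''(1) has_derivative_unique by blast
    then have qC: "C1_on UNIV q q'"
      by (intro C1_onI q(2) continuous_at_imp_continuous_on ballI)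
         (simp add: continuous_real_polymonial_function[OF q''(2)])
    have QC: "C1_on UNIV (\<lambda>z. w z * q z) Q'" using C1_on_mult[OF w qC] by (simp add: Q'_def[abs_def])
    have Qi: "integrable M (\<lambda>p. Q' (proj_base p) (lift p))"
      by (intro integrable_M C1_on_continuous_deriv[OF QC] continuous_on_proj_base lift_cont) auto
    have pt: "\<bar>g' (proj_base p) (lift p) - Q' (proj_base p) (lift p)\<bar> \<le> \<epsilon> * D" if p: "p \<in> X" for p
    proof -
      let ?z = "proj_base p" and ?e = "lift p"
      have t: "0 \<le> snd ?z" "snd ?z \<le> t0" using proj_X[OF p] by (auto simp: base_def)
      have zb: "?z \<in> cball 0 (2 * R)" using R(2)[OF p] R(1) by simp
      have "g' ?z ?e - Q' ?z ?e = w ?z * (G' ?z ?e - q' ?z ?e) + w' ?z ?e * (G ?z - q ?z)"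
        by (simp add: g'w[OF R(2)[OF p]] Q'_def algebra_simps)
      then have "\<bar>g' ?z ?e - Q' ?z ?e\<bar> \<le> \<bar>w ?z\<bar> * \<bar>G' ?z ?e - q' ?z ?e\<bar> + \<bar>w' ?z ?e\<bar> * \<bar>G ?z - q ?z\<bar>"
        by (simp only: abs_mult[symmetric] abs_triangle_ineq)
      also have "\<dots> \<le> (t0 * t0) * (\<epsilon> * B) + t0 * \<epsilon>"
      proof (intro add_mono mult_mono)
        have "snd ?z * (t0 - snd ?z) \<le> t0 * t0" using t by (intro mult_mono) auto
        then show "\<bar>w ?z\<bar> \<le> t0 * t0" using t by (simp add: w_def)
        show "\<bar>G' ?z ?e - q' ?z ?e\<bar> \<le> \<epsilon> * B"
          using q1[OF zb, of ?e] mult_left_mono[OF B(2)[OF p], of \<epsilon>] \<epsilon> by linarith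
        show "\<bar>w' ?z ?e\<bar> \<le> t0" using t by (simp add: w'_def)
        show "\<bar>G ?z - q ?z\<bar> \<le> \<epsilon>" using q0[OF zb] by linarith
      qed (use t0 in auto)
      finally show ?thesis by (simp add: D_def algebra_simps)
    qed
    have "\<bar>LINT p|M. g' (proj_base p) (lift p)\<bar> = \<bar>LINT p|M. g' (proj_base p) (lift p) - Q' (proj_base p) (lift p)\<bar>"
      using 0 gi Qi by simp
    also have "\<dots> \<le> (LINT p|M. \<bar>g' (proj_base p) (lift p) - Q' (proj_base p) (lift p)\<bar>)"
      using integral_norm_bound[of M] by simp
    also have "\<dots> \<le> (LINT p|M. \<epsilon> * D)"
      using gi Qi pt finite_M by (intro integral_mono) (auto simp: finite_measure.integrable_const)
    finally show ?thesis by (simp add: mult_ac)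
  qed
  then have "\<bar>LINT p|M. g' (proj_base p) (lift p)\<bar> \<le> 0"
  proof -
    assume *: "\<And>\<epsilon>. 0 < \<epsilon> \<Longrightarrow> \<bar>LINT p|M. g' (proj_base p) (lift p)\<bar> \<le> \<epsilon> * (D * measure M X)"
    have "((\<lambda>\<epsilon>. \<epsilon> * (D * measure M X)) \<longlongrightarrow> 0 * (D * measure M X)) (at_right 0)"
      by (intro tendsto_intros)
    then show ?thesis
      by (intro tendsto_lowerbound[where F="at_right (0::real)" and f="\<lambda>\<epsilon>. \<epsilon> * (D * measure M X)"])
         (use * in \<open>auto simp: eventually_at_right_field intro!: exI[of _ 1]\<close>)
  qed
  then show ?thesis by simp
qed

text \<open>Polynomials in time alone show that \<open>s = a + b * t\<close> has the moments of the
  uniform distribution on [0, 1], up to the total mass. The k-th moment tends to 0, while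
  \<open>s ^ k\<close> decreases to the indicator of \<open>s = 1\<close>.\<close>

lemma measure_time_end:
  assumes b: "b \<noteq> 0" and ends: "a \<in> {0, 1}" "a + b * t0 \<in> {0, 1}"
    and range: "\<And>t. 0 \<le> t \<Longrightarrow> t \<le> t0 \<Longrightarrow> a + b * t \<in> {0..1}"
  shows "AE p in M. a + b * snd (snd p) \<noteq> 1"
proof -
  define s where "s p = a + b * snd (snd p)" for p :: "'n phase"
  have s: "0 \<le> s p" "s p \<le> 1" if "p \<in> X" for p
    using range[of "snd (snd p)"] X_sub that by (auto simp: s_def phase_def)
  have sc: "continuous_on X s" unfolding s_def by (intro continuous_intros)
  have int: "(LINT p|M. s p ^ k) = measure M X / (real k + 1)" for k :: nat
  proof -
    \<comment> \<open>A primitive in time of \<open>s ^ k - 1 / (k + 1)\<close>. The constant is the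
      one for which the primitive vanishes at both \<open>s = 0\<close> and \<open>s = 1\<close>,
      that is, at both ends.\<close>
    define q where "q z = ((a + b * snd z) ^ Suc k - (a + b * snd z)) * (1 / (b * (real k + 1)))" for z :: "(real^'n) \<times> real"
    define q' where "q' z e = ((a + b * snd z) ^ k - 1 / (real k + 1)) * snd e" for z e :: "(real^'n) \<times> real"
    have p: "real_polynomial_function (\<lambda>z :: (real^'n) \<times> real. a + b * snd z)"
      by (intro real_polynomial_function.intros(2,3,4) real_polynomial_function.intros(1) bounded_linear_snd)
    have q: "real_polynomial_function q"
      unfolding q_def by (intro real_polynomial_function.intros(4) real_polynomial_function_diff
          real_polynomial_function_power p real_polynomial_function.intros(2))
    have 1: "((\<lambda>t. ((a + b * t) ^ Suc k - (a + b * t)) * (1 / (b * (real k + 1)))) has_real_derivative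
        (a + b * t) ^ k - 1 / (real k + 1)) (at t)" for t
    proof -
      have "((\<lambda>t. ((a + b * t) ^ Suc k - (a + b * t)) * (1 / (b * (real k + 1)))) has_real_derivative
        ((real k + 1) * (b * (a + b * t) ^ k) - b) * (1 / (b * (real k + 1)))) (at t)"
      proof -
        have "((\<lambda>t. a + b * t) has_real_derivative b) (at t)" by (auto intro!: derivative_eq_intros)
        from DERIV_cmult_right[OF DERIV_diff[OF DERIV_power_Suc[OF this, of k] this], of "1 / (b * (real k + 1))"]
        show ?thesis by (simp only: add.commute[of 1])
      qed
      moreover have "(c * (b * A) - b) * (1 / (b * c)) = A - 1 / c" if "c \<noteq> 0" for c A
        using b that by (simp add: field_simps)
      from this[of "real k + 1"] have "((real k + 1) * (b * (a + b * t) ^ k) - b) * (1 / (b * (real k + 1))) = (a + b * t) ^ k - 1 / (real k + 1)"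
        by simp
      ultimately show ?thesis by simp
    qed
    have 2: "(snd has_derivative snd) (at z)" for z :: "(real^'n) \<times> real"
      by (intro bounded_linear_imp_has_derivative bounded_linear_snd)
    have q': "(q has_derivative q' z) (at z)" for z
      using has_derivative_compose[OF 2[of z] 1[of "snd z", unfolded has_field_derivative_def]]
      unfolding q_def[abs_def] q'_def[abs_def] .
    have "(LINT p|M. q' (proj_base p) (lift p)) = 0"
      by (rule closed_polynomial[OF q q']) (use ends in \<open>auto simp: q_def\<close>)
    moreover have "q' (proj_base p) (lift p) = s p ^ k - 1 / (real k + 1)" for p
      by (simp add: q'_def s_def proj_base_eq)
    moreover have "integrable M (\<lambda>p. s p ^ k)" by (intro integrable_M continuous_intros sc)
    ultimately show ?thesis using finite_M by (simp add: finite_measure.integrable_const)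
  qed
  have "(\<lambda>k. LINT p|M. s p ^ k) \<longlonglongrightarrow> (LINT p|M. indicator {p. s p = 1} p)"
  proof (rule dominated_M[where B=1])
    show "(\<lambda>p. s p ^ k) \<in> borel_measurable M" for k by (intro measurable_M continuous_intros sc)
    fix p assume p: "p \<in> X"
    show "\<bar>s p ^ k\<bar> \<le> 1" for k using s[OF p] by (simp add: power_abs power_le_one)
    show "(\<lambda>k. s p ^ k) \<longlonglongrightarrow> indicator {p. s p = 1} p"
      using s[OF p] LIMSEQ_realpow_zero[of "s p"] by (cases "s p = 1") auto
  qed
  moreover have "(\<lambda>k. LINT p|M. s p ^ k) \<longlonglongrightarrow> 0"
    unfolding int by real_asymp
  ultimately have 0: "(LINT p|M. indicator {p. s p = 1} p) = (0::real)" by (rule LIMSEQ_unique)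
  have [measurable]: "s \<in> borel_measurable M" by (rule measurable_M[OF sc])
  have m: "(\<lambda>p. indicator {p. s p = 1} p :: real) \<in> borel_measurable M"
  proof (subst borel_measurable_indicator_iff)
    have "{p \<in> space M. s p = 1} \<in> sets M" by measurable
    then show "{p. s p = 1} \<inter> space M \<in> sets M" by (simp add: Int_def conj_commute)
  qed
  have "integrable M (\<lambda>p. indicator {p. s p = 1} p :: real)"
    by (rule integrable_bounded_M[OF m, where B=1]) (auto simp: indicator_def)
  from integral_nonneg_eq_0_iff_AE[OF this] 0 have "AE p in M. indicator {p. s p = 1} p = (0::real)" by simp
  then show ?thesis by eventually_elim (auto simp: s_def indicator_def split: if_splits)
qed

lemma measure_time_ends: "AE p in M. 0 < snd (snd p) \<and> snd (snd p) < t0"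
proof -
  \<comment> \<open>The initial time corresponds to s = 1 for \<open>s = 1 - t / t0\<close>, the
    final time to s = 1 for \<open>s = t / t0\<close>.\<close>
  have "AE p in M. 1 + (- 1 / t0) * snd (snd p) \<noteq> 1"
    by (rule measure_time_end) (use t0 in \<open>auto simp: field_simps\<close>)
  moreover have "AE p in M. 0 + (1 / t0) * snd (snd p) \<noteq> 1"
    by (rule measure_time_end) (use t0 in \<open>auto simp: field_simps\<close>)
  moreover have "AE p in M. p \<in> X" using AE_space[of M] by simp
  ultimately show ?thesis
  proof eventually_elim
    case (elim p)
    then have "0 \<le> snd (snd p)" "snd (snd p) \<le> t0" using X_sub by (auto simp: phase_def)
    then show ?case using elim t0 by (auto simp: less_le)
  qed
qed

end

section \<open>Mollified derivatives at a single point of differentiability\<close>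

lemma bump_translate_lipschitz:
  fixes y w :: "'a::euclidean_space"
  assumes r: "r > 0" and w: "norm w \<le> r"
  shows "\<bar>bump r 1 (y - w) - bump r 1 y\<bar> \<le> 5 * norm w / r * indicator (cball 0 (2 * r)) y"
proof (cases "norm y \<le> 2 * r")
  case True
  have yw: "norm (y - w) \<le> 3 * r" using True w norm_triangle_ineq4[of y w] by linarith
  have "\<bar>bump r 1 (y - w) - bump r 1 y\<bar> \<le> \<bar>(norm (y - w) / r)\<^sup>2 - (norm y / r)\<^sup>2\<bar>"
    unfolding bump_def by simp
  also have "(norm (y - w) / r)\<^sup>2 - (norm y / r)\<^sup>2 = (norm (y - w) - norm y) * (norm (y - w) + norm y) / r\<^sup>2"
    by (simp add: power_divide diff_divide_distrib[symmetric] power2_eq_square algebra_simps)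
  also have "\<bar>\<dots>\<bar> = \<bar>norm (y - w) - norm y\<bar> * (norm (y - w) + norm y) / r\<^sup>2"
    by (simp add: abs_mult)
  \<comment> \<open>\<open>norm (y - w)\<close> is at most \<open>3 * r\<close> and
    \<open>norm y\<close> at most \<open>2 * r\<close>, whence the factor 5.\<close>
  also have "\<dots> \<le> norm w * (5 * r) / r\<^sup>2"
  proof (intro divide_right_mono mult_mono)
    show "\<bar>norm (y - w) - norm y\<bar> \<le> norm w" using norm_triangle_ineq3[of "y - w" y] by simp
  qed (use True yw in auto)
  also have "\<dots> = 5 * norm w / r" using r by (simp add: power2_eq_square)
  finally show ?thesis using True by simp
next
  case False
  then have "norm (y - w) \<ge> r" "norm y \<ge> r" using w r norm_triangle_ineq2[of y w] by linarith+
  then show ?thesis using False by (simp add: bump_supp[OF r])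
qed

lemma measure_cball_scale:
  assumes "r \<ge> 0"
  shows "measure lborel (cball (0::'a::euclidean_space) (2 * r)) = 4 ^ DIM('a) * measure lborel (cball (0::'a) (r / 2))"
proof -
  have 1: "measure lborel (cball (0::'a) s) = unit_ball_vol (DIM('a)) * s ^ DIM('a)" if "s \<ge> 0" for s
    using content_cball[OF that, of "0::'a"] by simp
  have "2 * r = 4 * (r / 2)" by simp
  then have "(2 * r) ^ DIM('a) = 4 ^ DIM('a) * (r / 2) ^ DIM('a)" by (metis power_mult_distrib)
  then show ?thesis using assms by (simp only: 1 zero_le_mult_iff zero_le_divide_iff zero_le_numeral mult.left_commute simp_thms)
qed

text \<open>The remainder of the first-order expansion of \<open>b\<close> is \<open>o(r)\<close> on the ball of radius \<open>2 r\<close>, and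
  moving the increment onto the kernel costs a factor \<open>1 / r\<close>; so differentiability at the single
  point \<open>z\<close> suffices.\<close>

lemma mollify_deriv_tendsto:
  fixes b :: "'a::euclidean_space \<Rightarrow> real"
  assumes b: "C-lipschitz_on UNIV b" and D: "(b has_derivative D) (at z)"
  shows "((\<lambda>r. mollify_deriv (bump_kernel r 1) b z w) \<longlongrightarrow> D w) (at_right 0)"
  unfolding tendsto_iff eventually_at_right_field
proof (intro allI impI)
  fix \<epsilon> :: real assume \<epsilon>: "\<epsilon> > 0"
  \<comment> \<open>The factors are 5 from the Lipschitz bound of the kernel, 2 from the radius
    \<open>2 * r\<close>, 4/3 from the lower bound 3/4 for \<open>bump\<close> on the ball of radius
    r / 2, and \<open>4 ^ DIM('a)\<close> from the ratio of the volumes of the two balls.\<close>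
  define K :: real where "K = 40 / 3 * 4 ^ DIM('a)"
  have K: "K > 0" by (simp add: K_def)
  define \<eta> where "\<eta> = \<epsilon> / (2 * K * (norm w + 1))"
  have \<eta>: "\<eta> > 0" using \<epsilon> K by (simp add: \<eta>_def add_nonneg_pos)
  define \<rho> where "\<rho> y = b (z + y) - b z - D y" for y
  have linD: "bounded_linear D" by (rule has_derivative_bounded_linear[OF D])
  have \<rho>c: "continuous_on UNIV \<rho>"
    unfolding \<rho>_def
    by (intro continuous_intros continuous_on_compose2[OF lipschitz_on_continuous_on[OF b]]
        linear_continuous_on linD) auto
  obtain d where d: "d > 0" "\<And>y. norm y < d \<Longrightarrow> \<bar>\<rho> y\<bar> \<le> \<eta> * norm y"
  proof -
    obtain d where "d > 0" "\<forall>x. norm (x - z) < d \<longrightarrow> norm (b x - b z - D (x - z)) \<le> \<eta> * norm (x - z)"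
      using D \<eta> unfolding has_derivative_at_alt by blast
    from that[OF this(1)] this(2)[rule_format, of "z + y" for y] show thesis by (simp add: \<rho>_def)
  qed
  have "dist (mollify_deriv (bump_kernel r 1) b z w) (D w) < \<epsilon>" if r: "0 < r" "r < d / 2" for r
  proof -
    let ?k = "bump_kernel r 1 :: 'a \<Rightarrow> real" and ?I = "LINT y|lborel. bump r 1 (y::'a)"
    interpret lipschitz_mollify ?k b r C
      by unfold_locales (auto simp: bump_kernel_cont[OF r(1)] bump_kernel_supp[OF r(1)] b)
    have I: "?I \<ge> 3 / 4 * measure lborel (cball (0::'a) (r / 2))"
      using bump_integral_ge[of r 1 "1/2", where 'a='a] r by (simp add: power2_eq_square)
    have V: "measure lborel (cball (0::'a) (r / 2)) > 0" using r by (intro measure_cball_pos) auto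
    have Ipos: "?I > 0" using I V by linarith
    have est: "\<bar>mollify ?k b (z + u) - mollify ?k b z - D u\<bar> \<le> K * \<eta> * norm u" if u: "norm u \<le> r" for u
    proof -
      have ki: "integrable lborel (\<lambda>y. ?k y * \<rho> (x + y))" for x
        by (rule bump_kernel_times_integrable[OF r(1) _ \<rho>c]) simp
      have kb: "integrable lborel (\<lambda>y. ?k y * b (x + y))" for x by (rule integrable_ab)
      have k1: "integrable lborel ?k" "integral\<^sup>L lborel ?k = 1"
        using bump_kernel_integrable[OF r(1), of 1, where 'a='a] bump_kernel_integral[OF r(1), of 1, where 'a='a] by auto
      have "\<rho> (u + y) - \<rho> y = b (z + u + y) - b (z + y) - D u" for y
        using linear_add[OF bounded_linear.linear[OF linD]] by (simp add: \<rho>_def add.assoc)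
      then have "(LINT y|lborel. ?k y * \<rho> (u + y)) - (LINT y|lborel. ?k y * \<rho> (0 + y))
        = (LINT y|lborel. ?k y * (b (z + u + y) - b (z + y) - D u))"
        using ki[of u] ki[of 0] by (subst Bochner_Integration.integral_diff[symmetric]) (auto simp: right_diff_distrib[symmetric])
      also have "\<dots> = (LINT y|lborel. ?k y * b (z + u + y) - ?k y * b (z + y) - ?k y * D u)"
        by (simp add: right_diff_distrib)
      also have "\<dots> = mollify ?k b (z + u) - mollify ?k b z - D u"
        using kb k1 by (simp add: mollify_def)
      finally have 1: "mollify ?k b (z + u) - mollify ?k b z - D u
         = (LINT y|lborel. ?k y * \<rho> (u + y)) - (LINT y|lborel. ?k y * \<rho> y)" by simp
      have km: "?k \<in> borel_measurable borel" "\<rho> \<in> borel_measurable borel"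
        using bump_kernel_measurable[OF r(1)] borel_measurable_continuous_onI[OF \<rho>c] by auto
      have "(LINT y|lborel. ?k y * \<rho> (u + y)) = (LINT y|lborel. ?k (y - u) * \<rho> y)"
        by (subst (2) lborel_integral_translate[where z=u]) (use km in auto)
      moreover have "integrable lborel (\<lambda>y. ?k (y - u) * \<rho> y)"
      proof -
        have "integrable (distr lborel borel ((+) u)) (\<lambda>y. ?k (y - u) * \<rho> y)"
          by (subst integrable_distr_eq) (use km ki[of u] in auto)
        then show ?thesis by (simp add: lborel_distr_plus)
      qed
      \<comment> \<open>The affine part of \<open>b\<close> has produced exactly \<open>D u\<close>
        and dropped out. What is left pairs the remainder \<open>\<rho>\<close>, small compared with
        \<open>r\<close>, with a kernel increment of relative size
        \<open>norm u / r\<close>.\<close>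
      ultimately have 2: "mollify ?k b (z + u) - mollify ?k b z - D u = (LINT y|lborel. (?k (y - u) - ?k y) * \<rho> y)"
        unfolding 1 left_diff_distrib using ki[of 0] by (simp del: One_nat_def)
      have "\<bar>LINT y|lborel. (?k (y - u) - ?k y) * \<rho> y\<bar> \<le>
         (LINT y|lborel. indicator (cball 0 (2 * r)) (y::'a) * (5 * norm u / r / ?I * (\<eta> * (2 * r))))"
      proof (rule order_trans[OF integral_abs_bound integral_mono'[OF integrable_cball]])
        fix y :: 'a
        show "\<bar>(?k (y - u) - ?k y) * \<rho> y\<bar> \<le> indicator (cball 0 (2 * r)) y * (5 * norm u / r / ?I * (\<eta> * (2 * r)))"
        proof -
          have "\<bar>?k (y - u) - ?k y\<bar> = \<bar>bump r 1 (y - u) - bump r 1 y\<bar> / ?I"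
            using Ipos by (simp add: bump_kernel_def diff_divide_distrib[symmetric])
          also have "\<dots> \<le> 5 * norm u / r * indicator (cball 0 (2 * r)) y / ?I"
            using Ipos bump_translate_lipschitz[OF r(1) u, of y] by (intro divide_right_mono) auto
          finally have *: "\<bar>?k (y - u) - ?k y\<bar> \<le> 5 * norm u / r / ?I * indicator (cball 0 (2 * r)) y" by simp
          show ?thesis
          proof (cases "norm y \<le> 2 * r")
            case True
            then have "\<bar>\<rho> y\<bar> \<le> \<eta> * (2 * r)"
              using d(2)[of y] r \<eta> mult_left_mono[OF True, of \<eta>] by linarith
            then have "\<bar>?k (y - u) - ?k y\<bar> * \<bar>\<rho> y\<bar> \<le> (5 * norm u / r / ?I * indicator (cball 0 (2 * r)) y) * (\<eta> * (2 * r))"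
              using * by (intro mult_mono) auto
            then show ?thesis unfolding abs_mult by (simp only: mult_ac)
          next
            case False
            then show ?thesis using * by (simp add: abs_mult)
          qed
        qed
        show "0 \<le> indicator (cball 0 (2 * r)) y * (5 * norm u / r / ?I * (\<eta> * (2 * r)))"
          using Ipos r \<eta> by (intro mult_nonneg_nonneg divide_nonneg_nonneg) auto
      qed
      also have "\<dots> = measure lborel (cball (0::'a) (2 * r)) * (10 * norm u * \<eta>) / ?I"
        using r by (simp add: field_simps)
      also have "\<dots> \<le> measure lborel (cball (0::'a) (2 * r)) * (10 * norm u * \<eta>) / (3 / 4 * measure lborel (cball (0::'a) (r / 2)))"
        using I V \<eta> Ipos by (intro divide_left_mono mult_pos_pos) auto
      also have "\<dots> = K * \<eta> * norm u"
        using V measure_cball_scale[of r, where 'a='a] r by (simp add: K_def)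
      finally show ?thesis using 2 by simp
    qed
    have lim: "(\<lambda>n. diff_quot (mollify ?k b) w n z) \<longlonglongrightarrow> mollify_deriv ?k b z w"
      by (rule diff_quot_LIMSEQ_derivative[OF mollify_has_derivative])
    have ev: "\<forall>\<^sub>F n in sequentially. norm w / r < real (Suc n)"
      by real_asymp
    have "\<forall>\<^sub>F n in sequentially. \<bar>diff_quot (mollify ?k b) w n z - D w\<bar> \<le> K * \<eta> * norm w"
      using ev
    proof eventually_elim
      case (elim n)
      let ?s = "1 / real (Suc n)"
      have "norm (?s *\<^sub>R w) \<le> r" using elim r by (simp add: field_simps)
      from est[OF this] have "\<bar>mollify ?k b (z + ?s *\<^sub>R w) - mollify ?k b z - ?s * D w\<bar> * real (Suc n) \<le> K * \<eta> * norm w"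
        using linear_scale[OF bounded_linear.linear[OF linD]] by (simp add: field_simps del: of_nat_Suc)
      moreover have "\<bar>mollify ?k b (z + ?s *\<^sub>R w) - mollify ?k b z - ?s * D w\<bar> * real (Suc n)
        = \<bar>diff_quot (mollify ?k b) w n z - D w\<bar>"
      proof -
        have "diff_quot (mollify ?k b) w n z - D w = (mollify ?k b (z + ?s *\<^sub>R w) - mollify ?k b z - ?s * D w) * real (Suc n)"
          by (simp add: diff_quot_def algebra_simps add_divide_distrib del: of_nat_Suc)
        then show ?thesis by (simp add: abs_mult del: of_nat_Suc)
      qed
      ultimately show ?case by simp
    qed
    moreover have "(\<lambda>n. \<bar>diff_quot (mollify ?k b) w n z - D w\<bar>) \<longlonglongrightarrow> \<bar>mollify_deriv ?k b z w - D w\<bar>"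
      by (intro tendsto_intros lim)
    ultimately have "\<bar>mollify_deriv ?k b z w - D w\<bar> \<le> K * \<eta> * norm w"
      by (intro tendsto_upperbound) auto
    also have "\<dots> < \<epsilon>"
    proof -
      have "K * \<eta> * norm w \<le> K * \<eta> * (norm w + 1)" using K \<eta> by (intro mult_left_mono) auto
      also have "\<dots> = \<epsilon> / 2"
      proof -
        have "K * (\<epsilon> / (2 * K * m)) * m = \<epsilon> / 2" if "m > 0" for m using K that by (simp add: field_simps)
        from this[of "norm w + 1"] show ?thesis by (simp add: \<eta>_def add_nonneg_pos)
      qed
      also have "\<dots> < \<epsilon>" using \<epsilon> by simp
      finally show ?thesis .
    qed
    finally show ?thesis by (simp add: dist_real_def)
  qed
  then show "\<exists>b'>0. \<forall>r>0. r < b' \<longrightarrow> dist (mollify_deriv (bump_kernel r 1) b z w) (D w) < \<epsilon>"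
    using d(1) by (intro exI[of _ "d / 2"]) auto
qed

lemma mollify_bump_close:
  assumes b: "C-lipschitz_on UNIV b" and r: "r > 0"
  shows "\<bar>mollify (bump_kernel r 1) b z - b z\<bar> \<le> C * r"
proof -
  let ?k = "bump_kernel r 1"
  interpret lipschitz_mollify ?k b r C
    by unfold_locales (auto simp: bump_kernel_cont[OF r(1)] bump_kernel_supp[OF r(1)] b)
  have bd: "\<bar>b (z + y) - b z\<bar> \<le> C * r" if "norm y < r" for y
    using Lip_abs[OF b, of "z + y" z] mult_left_mono[of "norm y" r C] Lip_nonneg[OF b] that by simp
  have "mollify ?k b z \<le> b z + C * r"
    unfolding mollify_def
    by (rule bump_average_le[OF r]) (use integrable_ab bd in \<open>auto simp: abs_le_iff intro!: AE_I2\<close>, smt (verit) bd)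
  moreover have "(LINT y|lborel. ?k y * (- b (z + y))) \<le> - b z + C * r"
    by (rule bump_average_le[OF r]) (use integrable_ab[of z] bd in \<open>auto simp: abs_le_iff intro!: AE_I2\<close>, smt (verit) bd)
  ultimately show ?thesis by (simp add: mollify_def)
qed

lemma mollify_deriv_bump_bound:
  assumes b: "C-lipschitz_on UNIV b" and r: "r > 0"
  shows "\<bar>mollify_deriv (bump_kernel r 1) b z w\<bar> \<le> C * norm w"
proof -
  let ?k = "bump_kernel r 1"
  interpret lipschitz_mollify ?k b r C
    by unfold_locales (auto simp: bump_kernel_cont[OF r(1)] bump_kernel_supp[OF r(1)] b)
  have bd: "AE y in lborel. \<bar>lim_quot b w (z + y)\<bar> \<le> C * norm w"
    using differentiable_AE[of z] by eventually_elim (rule lim_quot_bound)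
  have "mollify_deriv ?k b z w \<le> C * norm w"
    unfolding mollify_deriv_def
    by (rule bump_average_le[OF r]) (use integrable_deriv bd in \<open>auto elim!: eventually_mono\<close>)
  moreover have "(LINT y|lborel. ?k y * (- lim_quot b w (z + y))) \<le> C * norm w"
    by (rule bump_average_le[OF r]) (use integrable_deriv[of w z] bd in \<open>auto elim!: eventually_mono\<close>)
  ultimately show ?thesis by (simp add: mollify_deriv_def)
qed

section \<open>The Hamilton-Jacobi inequality\<close>

lemma dir_deriv_basis:
  assumes "f differentiable (at p within S)"
  shows "dir_deriv S e f p = (\<Sum>b\<in>Basis. (e \<bullet> b) * dir_deriv S b f p)"
proof -
  have lin: "linear (frechet_derivative f (at p within S))"
    using assms by (rule linear_frechet_derivative)
  have "dir_deriv S e f p = frechet_derivative f (at p within S) (\<Sum>b\<in>Basis. (e \<bullet> b) *\<^sub>R b)"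
    by (simp add: dir_deriv_def euclidean_representation)
  also have "\<dots> = (\<Sum>b\<in>Basis. (e \<bullet> b) * dir_deriv S b f p)"
    by (simp add: linear_sum[OF lin] linear_scale[OF lin] dir_deriv_def)
  finally show ?thesis .
qed

lemma dir_deriv_continuous:
  assumes "f differentiable_on S" "\<forall>e\<in>Basis. continuous_on S (dir_deriv S e f)"
    and "continuous_on T a" "\<And>x. x \<in> T \<Longrightarrow> a x \<in> S" "continuous_on T e"
  shows "continuous_on T (\<lambda>x. dir_deriv S (e x) f (a x))"
proof -
  have "continuous_on T (\<lambda>x. \<Sum>b\<in>Basis. (e x \<bullet> b) * dir_deriv S b f (a x))"
    using assms by (intro continuous_intros continuous_on_compose2[OF _ assms(3)]) auto
  then show ?thesis
    by (rule continuous_on_eq)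
       (use assms(1,4) in \<open>simp add: dir_deriv_basis differentiable_on_def\<close>)
qed

lemma dir_deriv_C1:
  assumes "f differentiable_on S" "\<forall>e\<in>Basis. continuous_on S (dir_deriv S e f)"
  shows "C1_on (interior S) f (\<lambda>z e. dir_deriv S e f z)"
proof (rule C1_onI)
  fix z assume z: "z \<in> interior S"
  then have "z \<in> S" using interior_subset by blast
  then have "f differentiable (at z within S)" using assms(1) by (simp add: differentiable_on_def)
  then have "(f has_derivative frechet_derivative f (at z within S)) (at z within S)"
    by (simp only: frechet_derivative_works)
  moreover have "frechet_derivative f (at z within S) = (\<lambda>e. dir_deriv S e f z)"
    by (simp add: dir_deriv_def fun_eq_iff)
  ultimately show "(f has_derivative (\<lambda>e. dir_deriv S e f z)) (at z)"
    by (simp only: at_within_interior[OF z])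
next
  fix e show "continuous_on (interior S) (\<lambda>z. dir_deriv S e f z)"
    using interior_subset by (intro dir_deriv_continuous[OF assms] continuous_intros) auto
qed

lemma C1_difference_bound:
  fixes g :: "'a::euclidean_space \<Rightarrow> real"
  assumes g: "C1_on S g g'" and seg: "\<And>s. 0 \<le> s \<Longrightarrow> s \<le> 1 \<Longrightarrow> z + s *\<^sub>R d \<in> S"
    and bd: "\<And>s. 0 \<le> s \<Longrightarrow> s \<le> 1 \<Longrightarrow> \<bar>g' (z + s *\<^sub>R d) d - g' z d\<bar> \<le> B"
  shows "\<bar>g (z + d) - g z - g' z d\<bar> \<le> B"
proof -
  obtain s where "0 < s" "s < 1" "g (z + 1 *\<^sub>R d) - g z = 1 * g' (z + s *\<^sub>R d) d"
    by (rule C1_on_MVT[OF g zero_less_one seg])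
  then show ?thesis using bd[of s] by simp
qed

section \<open>The function f, extended in time and mollified\<close>

locale minimizer = closed_measure U t0 \<mu> for U :: "(real ^ 'n::finite) set" and t0 \<mu> +
  fixes L :: "'n phase \<Rightarrow> real" and c :: real and f :: "(real ^ 'n) \<times> real \<Rightarrow> real"
  assumes L2: "Ck_on 2 (phase UNIV t0) L" and min: "minimizable_by t0 \<mu> (\<lambda>p. L p + c) f"
begin

abbreviation S :: "'n phase set" where "S \<equiv> phase UNIV t0"
text \<open>At interior times the derivatives within \<open>S\<close> are two-sided, so the calculus
  of \<open>C1_on\<close> applies. The support itself may reach the end times.\<close>

definition \<Omega> :: "'n phase set" where "\<Omega> = UNIV \<times> UNIV \<times> {0<..<t0}"
abbreviation time :: "'n phase \<Rightarrow> real" where "time p \<equiv> snd (snd p)"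
abbreviation DL :: "'n phase \<Rightarrow> 'n phase \<Rightarrow> real" where "DL p e \<equiv> dir_deriv S e L p"

lemma X_S: "X \<subseteq> S" using X_sub by (auto simp: phase_def)

lemma open_\<Omega>: "open \<Omega>" by (auto simp: \<Omega>_def intro!: open_Times)

lemma \<Omega>_interior: "\<Omega> \<subseteq> interior S"
  by (rule interior_maximal[OF _ open_\<Omega>]) (auto simp: \<Omega>_def phase_def)

lemma L_diff: "L differentiable_on S" and L1: "\<forall>e\<in>Basis. dir_deriv S e L differentiable_on S"
  and L1c: "\<forall>e\<in>Basis. continuous_on S (dir_deriv S e L)"
  and L2c: "b \<in> Basis \<Longrightarrow> \<forall>e\<in>Basis. continuous_on S (dir_deriv S e (dir_deriv S b L))"
  using L2 by (auto simp: numeral_2_eq_2 intro: differentiable_imp_continuous_on)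

lemma L_cont: "continuous_on S L" by (rule differentiable_imp_continuous_on[OF L_diff])

lemma L_C1: "C1_on \<Omega> L DL"
  by (rule C1_on_subset[OF dir_deriv_C1[OF L_diff L1c] \<Omega>_interior])

lemma DL_C1: "b \<in> Basis \<Longrightarrow> C1_on \<Omega> (\<lambda>p. DL p b) (\<lambda>p e. dir_deriv S e (dir_deriv S b L) p)"
  using C1_on_subset[OF dir_deriv_C1 \<Omega>_interior] L1 L2c by blast

definition Cf :: real where "Cf = (SOME C. C-lipschitz_on (base UNIV t0) f)"

lemma f_lip: "Cf-lipschitz_on (base UNIV t0) f"
  unfolding Cf_def using min by (intro someI_ex[of "\<lambda>C. C-lipschitz_on (base UNIV t0) f"]) (simp add: minimizable_by_def)

text \<open>Clamping the time extends f to the whole space with the same Lipschitz constant, as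
  Rademacher's theorem and the mollification require; nothing changes near interior times.\<close>

definition fe :: "(real ^ 'n) \<times> real \<Rightarrow> real" where
  "fe z = f (fst z, max 0 (min t0 (snd z)))"

lemma fe_lip: "Cf-lipschitz_on UNIV fe"
proof (rule lipschitz_onI)
  show "Cf \<ge> 0" using f_lip by (simp add: lipschitz_on_def)
  fix z w :: "(real ^ 'n) \<times> real"
  have 1: "dist (max 0 (min t0 (snd z))) (max 0 (min t0 (snd w))) \<le> dist (snd z) (snd w)"
    by (simp add: dist_real_def)
  have "dist (fe z) (fe w) \<le> Cf * dist (fst z, max 0 (min t0 (snd z))) (fst w, max 0 (min t0 (snd w)))"
    unfolding fe_def using f_lip t0 by (auto simp: lipschitz_on_def base_def)
  also have "\<dots> \<le> Cf * dist z w"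
    unfolding dist_prod_def fst_conv snd_conv using f_lip 1
    by (intro mult_left_mono real_sqrt_le_mono add_mono power_mono) (auto simp: lipschitz_on_def)
  finally show "dist (fe z) (fe w) \<le> Cf * dist z w" .
qed

lemma fe_f_derivative:
  assumes "0 < snd z" "snd z < t0"
  shows "(fe has_derivative D) (at z) \<longleftrightarrow> (f has_derivative D) (at z)" "at z within base UNIV t0 = at z"
proof -
  let ?V = "(UNIV :: (real^'n) set) \<times> {0<..<t0}"
  have V: "open ?V" "z \<in> ?V" using assms by (auto intro!: open_Times simp: mem_Times_iff)
  have eq: "fe w = f w" if "w \<in> ?V" for w using that by (auto simp: fe_def)
  show "(fe has_derivative D) (at z) \<longleftrightarrow> (f has_derivative D) (at z)"
  proof
    assume "(fe has_derivative D) (at z)"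
    then show "(f has_derivative D) (at z)" by (rule has_derivative_transform_within_open[OF _ V]) (rule eq)
  next
    assume "(f has_derivative D) (at z)"
    then show "(fe has_derivative D) (at z)" by (rule has_derivative_transform_within_open[OF _ V]) (rule eq[symmetric])
  qed
  have "z \<in> interior (base UNIV t0)"
    by (rule interiorI[OF V]) (auto simp: base_def)
  then show "at z within base UNIV t0 = at z" by (rule at_within_interior)
qed

lemma fe_derivative_le:
  assumes "0 < t" "t < t0" "(fe has_derivative D) (at (x, t))"
  shows "D (v, 1) \<le> L (x, v, t) + c"
proof -
  have D: "(f has_derivative D) (at (x, t))" and w: "at (x, t) within base UNIV t0 = at (x, t)"
    using fe_f_derivative(1)[of "(x, t)" D] fe_f_derivative(2)[of "(x, t)"] assms by auto
  have "(x, t) \<in> base UNIV t0" using assms by (simp add: base_def)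
  moreover have "f differentiable (at (x, t) within base UNIV t0)" using D w by (auto simp: differentiable_def)
  ultimately have "total_deriv UNIV t0 f (x, v, t) \<le> L (x, v, t) + c"
    using min unfolding minimizable_by_def by blast
  then show ?thesis
    using frechet_derivative_at[OF D] by (simp add: total_deriv_def w)
qed

definition fD :: "(real ^ 'n) \<times> real \<Rightarrow> (real ^ 'n) \<times> real \<Rightarrow> real" where
  "fD z = frechet_derivative fe (at z)"

lemma fD:
  assumes "p \<in> X" "0 < time p" "time p < t0"
  shows "(fe has_derivative fD (proj_base p)) (at (proj_base p))" "fD (proj_base p) (lift p) = L p + c"
proof -
  have t: "0 < snd (proj_base p)" "snd (proj_base p) < t0" using assms by (auto simp: proj_base_eq)
  note w = fe_f_derivative(2)[OF t]
  have "f differentiable (at (proj_base p))" using min assms(1) w by (auto simp: minimizable_by_def)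
  then have d: "(f has_derivative frechet_derivative f (at (proj_base p))) (at (proj_base p))"
    by (simp add: frechet_derivative_works)
  then have e: "(fe has_derivative frechet_derivative f (at (proj_base p))) (at (proj_base p))"
    using fe_f_derivative(1)[OF t] by blast
  then have *: "fD (proj_base p) = frechet_derivative f (at (proj_base p))"
    unfolding fD_def by (rule frechet_derivative_at[symmetric])
  show "(fe has_derivative fD (proj_base p)) (at (proj_base p))" using e * by simp
  have "L p + c = total_deriv UNIV t0 f p" using min assms(1) by (auto simp: minimizable_by_def)
  then show "fD (proj_base p) (lift p) = L p + c" by (simp add: * total_deriv_eq w)
qed

definition F :: "real \<Rightarrow> (real ^ 'n) \<times> real \<Rightarrow> real" where "F r = mollify (bump_kernel r 1) fe"
definition F' :: "real \<Rightarrow> (real ^ 'n) \<times> real \<Rightarrow> (real ^ 'n) \<times> real \<Rightarrow> real" where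
  "F' r = mollify_deriv (bump_kernel r 1) fe"

lemma F_mollify: "r > 0 \<Longrightarrow> lipschitz_mollify (bump_kernel r 1) fe r Cf"
  by unfold_locales (auto simp: bump_kernel_cont bump_kernel_supp fe_lip)

lemma F_C1: "r > 0 \<Longrightarrow> C1_on UNIV (F r) (F' r)"
  unfolding F_def F'_def by (rule lipschitz_mollify.mollify_C1[OF F_mollify])

lemma F'_bound: "r > 0 \<Longrightarrow> \<bar>F' r z w\<bar> \<le> Cf * norm w"
  unfolding F'_def by (rule mollify_deriv_bump_bound[OF fe_lip])

lemma Cf: "Cf \<ge> 0" using f_lip by (simp add: lipschitz_on_def)

lemma F_lip: "r > 0 \<Longrightarrow> Cf-lipschitz_on UNIV (F r)"
proof (rule bounded_derivative_imp_lipschitz)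
  assume r: "r > 0"
  show "(F r has_derivative F' r x) (at x within UNIV)" for x using C1_onD(1)[OF F_C1[OF r]] by simp
  show "onorm (F' r x) \<le> Cf" for x by (rule onorm_bound[OF Cf]) (use F'_bound[OF r] in auto)
qed (use Cf in auto)

lemma F_close: "r > 0 \<Longrightarrow> \<bar>F r z - fe z\<bar> \<le> Cf * r"
  unfolding F_def by (rule mollify_bump_close[OF fe_lip])

text \<open>The derivative of the mollification averages derivatives of f at almost every nearby
  point, each satisfying the inequality with \<open>L\<close> at the displaced base point and the
  same \<open>v\<close>. Uniform continuity of \<open>L\<close> on a compact set absorbs the
  displacement.\<close>

lemma F'_le:
  assumes \<delta>: "\<delta> > 0" and \<eta>: "\<eta> > 0"
  shows "\<exists>r0>0. \<forall>r x v t. 0 < r \<and> r < r0 \<and> norm x \<le> R \<and> norm v \<le> R \<and> \<delta> \<le> t \<and> t \<le> t0 - \<delta> \<longrightarrow>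
     F' r (x, t) (v, 1) \<le> L (x, v, t) + c + \<eta>"
proof -
  define K where "K = (cball 0 (R + 1) :: (real^'n) set) \<times> (cball 0 R :: (real^'n) set) \<times> {0..t0}"
  have "uniformly_continuous_on K L"
    by (intro compact_uniformly_continuous continuous_on_subset[OF L_cont]) (auto simp: K_def phase_def intro!: compact_Times)
  then obtain d where d: "d > 0" "\<And>p q. p \<in> K \<Longrightarrow> q \<in> K \<Longrightarrow> dist p q < d \<Longrightarrow> dist (L p) (L q) < \<eta>"
    unfolding uniformly_continuous_on_def using \<eta> by metis
  \<comment> \<open>The bound by \<open>\<delta>\<close> keeps displaced times inside I, the bound
    by 1 keeps displaced positions in \<open>K\<close>, and the bound by \<open>d\<close> is for
    uniform continuity.\<close>
  define r0 where "r0 = Min {d, 1, \<delta>}"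
  have r0: "r0 > 0" "r0 \<le> d" "r0 \<le> 1" "r0 \<le> \<delta>" using d \<delta> by (auto simp: r0_def)
  have "F' r (x, t) (v, 1) \<le> L (x, v, t) + c + \<eta>"
    if r: "0 < r" "r < r0" and x: "norm x \<le> R" and v: "norm v \<le> R" and t: "\<delta> \<le> t" "t \<le> t0 - \<delta>" for r x v t
  proof -
    interpret lipschitz_mollify "bump_kernel r 1" fe r Cf using F_mollify[OF r(1)] .
    have "AE y in lborel. norm y < r \<longrightarrow> lim_quot fe (v, 1) ((x, t) + y) \<le> L (x, v, t) + c + \<eta>"
      using differentiable_AE[of "(x, t)"]
    proof eventually_elim
      case (elim y)
      show ?case
      proof
        assume y: "norm y < r"
        obtain y1 y2 where y12: "y = (y1, y2)" by (cases y)
        have n: "norm y1 < r" "\<bar>y2\<bar> < r" using y norm_fst_le[of y1 y2] norm_snd_le[of y2 y1] by (auto simp: y12)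
        obtain D where D: "(fe has_derivative D) (at (x + y1, t + y2))" using elim by (auto simp: differentiable_def y12)
        have tt: "0 < t + y2" "t + y2 < t0" using n t r r0 by auto
        have "D (v, 1) \<le> L (x + y1, v, t + y2) + c" by (rule fe_derivative_le[OF tt D])
        moreover have "dist (L (x + y1, v, t + y2)) (L (x, v, t)) < \<eta>"
        proof (rule d(2))
          show "(x + y1, v, t + y2) \<in> K" using x v tt n r r0 norm_triangle_ineq[of x y1] by (auto simp: K_def)
          show "(x, v, t) \<in> K" using x v t \<delta> by (auto simp: K_def intro: order_trans[OF x])
          have "dist (x + y1, v, t + y2) (x, v, t) = norm y"
            by (simp add: y12 dist_Pair_Pair norm_Pair dist_norm)
          then show "dist (x + y1, v, t + y2) (x, v, t) < d" using y r r0 by simp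
        qed
        ultimately show "lim_quot fe (v, 1) ((x, t) + y) \<le> L (x, v, t) + c + \<eta>"
          using lim_quot_eq_derivative[OF D, of "(v, 1)"] by (simp add: y12 dist_real_def)
      qed
    qed
    then show ?thesis
      unfolding F'_def mollify_deriv_def by (intro bump_average_le[OF r(1)] integrable_deriv) auto
  qed
  then show ?thesis using r0(1) by blast
qed

text \<open>f is differentiable at the base point itself but possibly not at all points around it,
  so the convergence rests on the pointwise statement \<open>mollify_deriv_tendsto\<close>.\<close>

lemma F'_tendsto:
  assumes "p \<in> X" "0 < time p" "time p < t0"
  shows "((\<lambda>r. F' r (proj_base p) e) \<longlongrightarrow> fD (proj_base p) e) (at_right 0)"
  unfolding F'_def by (rule mollify_deriv_tendsto[OF fe_lip fD(1)[OF assms]])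

definition XT :: "real \<Rightarrow> 'n phase set" where "XT \<delta> = {p \<in> X. \<delta> \<le> time p \<and> time p \<le> t0 - \<delta>}"

lemma XT_eq: "XT \<delta> = X \<inter> (UNIV \<times> UNIV \<times> {\<delta>..t0 - \<delta>})"
  by (auto simp: XT_def)

lemma compact_XT: "compact (XT \<delta>)"
  unfolding XT_eq by (intro compact_Int_closed compact_X closed_Times closed_atLeastAtMost) auto

lemma XT_sets [measurable]: "XT \<delta> \<in> sets M"
proof -
  have "closed ((UNIV :: (real^'n) set) \<times> (UNIV :: (real^'n) set) \<times> {\<delta>..t0 - \<delta>})"
    by (intro closed_Times closed_atLeastAtMost) auto
  then have "(UNIV :: (real^'n) set) \<times> (UNIV :: (real^'n) set) \<times> {\<delta>..t0 - \<delta>} \<in> sets \<mu>"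
    unfolding sets_\<mu> by (rule borel_closed)
  then show ?thesis
    unfolding XT_eq M_def using X_sets by (auto simp: sets_restrict_space_iff space_\<mu>)
qed

lemma integrable_XT:
  fixes h :: "'n phase \<Rightarrow> real"
  assumes "integrable M h" shows "integrable M (\<lambda>p. indicator (XT \<delta>) p * h p)"
  using integrable_mult_indicator[OF XT_sets assms] by simp

lemma XT_\<Omega>: "\<delta> > 0 \<Longrightarrow> XT \<delta> \<subseteq> \<Omega>"
  by (auto simp: XT_def \<Omega>_def mem_Times_iff)

end

section \<open>The momentum along the measure\<close>

lemma smooth_step_deriv_0: "s \<le> 0 \<or> 1 \<le> s \<Longrightarrow> smooth_step_deriv s = 0"
  by (auto simp: smooth_step_deriv_def Let_def max_def)

text \<open>The transition layers have width \<open>\<delta>\<close> and start at distance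
  \<open>\<delta>\<close> from the ends, so the function vanishes near the ends as
  \<open>closed_C1\<close> demands. Its derivative has order 1 / \<delta>.\<close>

definition plateau :: "real \<Rightarrow> real \<Rightarrow> real \<Rightarrow> real" where
  "plateau T \<delta> t = smooth_step ((t - \<delta>) / \<delta>) * smooth_step ((T - \<delta> - t) / \<delta>)"

definition plateau_deriv :: "real \<Rightarrow> real \<Rightarrow> real \<Rightarrow> real" where
  "plateau_deriv T \<delta> t = smooth_step ((t - \<delta>) / \<delta>) * (smooth_step_deriv ((T - \<delta> - t) / \<delta>) * (- 1 / \<delta>))
     + smooth_step_deriv ((t - \<delta>) / \<delta>) * (1 / \<delta>) * smooth_step ((T - \<delta> - t) / \<delta>)"

lemma plateau_has_derivative: "(plateau T \<delta> has_real_derivative plateau_deriv T \<delta> t) (at t)"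
proof -
  have 1: "((\<lambda>t. (t - \<delta>) / \<delta>) has_real_derivative 1 / \<delta>) (at t)"
    unfolding divide_inverse by (intro DERIV_cmult_right) (auto intro!: derivative_eq_intros)
  have 2: "((\<lambda>t. (T - \<delta> - t) / \<delta>) has_real_derivative - 1 / \<delta>) (at t)"
    unfolding divide_inverse by (intro DERIV_cmult_right) (auto intro!: derivative_eq_intros)
  have "((\<lambda>t. smooth_step ((t - \<delta>) / \<delta>)) has_real_derivative smooth_step_deriv ((t - \<delta>) / \<delta>) * (1 / \<delta>)) (at t)"
    by (rule DERIV_chain2[OF smooth_step_has_derivative 1])
  moreover have "((\<lambda>t. smooth_step ((T - \<delta> - t) / \<delta>)) has_real_derivative smooth_step_deriv ((T - \<delta> - t) / \<delta>) * (- 1 / \<delta>)) (at t)"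
    by (rule DERIV_chain2[OF smooth_step_has_derivative 2])
  ultimately show ?thesis
    unfolding plateau_def[abs_def] plateau_deriv_def by (rule DERIV_mult')
qed

lemma plateau_C1: "C1_on A (plateau T \<delta>) (\<lambda>t e. plateau_deriv T \<delta> t * e)"
proof (rule C1_on_real)
  have s: "continuous_on UNIV smooth_step" "continuous_on UNIV smooth_step_deriv"
    using C1_on_continuous_on[OF smooth_step_C1] C1_onD(2)[OF smooth_step_C1, of 1] by auto
  have l: "continuous_on A (\<lambda>t. (t - \<delta>) / \<delta>)" "continuous_on A (\<lambda>t. (T - \<delta> - t) / \<delta>)"
    unfolding divide_inverse by (intro continuous_intros)+
  note [continuous_intros] = s[THEN continuous_on_compose2, OF l(1)] s[THEN continuous_on_compose2, OF l(2)]
  show "continuous_on A (plateau_deriv T \<delta>)"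
    unfolding plateau_deriv_def by (intro continuous_intros subset_UNIV)
qed (rule plateau_has_derivative)

lemma plateau_outside:
  assumes "\<delta> > 0" "t \<le> \<delta> \<or> t \<ge> T - \<delta>"
  shows "plateau T \<delta> t = 0" "plateau_deriv T \<delta> t = 0"
proof -
  have "(t - \<delta>) / \<delta> \<le> 0 \<or> (T - \<delta> - t) / \<delta> \<le> 0" using assms by (auto simp: divide_le_0_iff)
  then show "plateau T \<delta> t = 0" "plateau_deriv T \<delta> t = 0"
    by (auto simp: plateau_def plateau_deriv_def smooth_step_0 smooth_step_deriv_0)
qed

lemma plateau_inside:
  assumes "\<delta> > 0" "2 * \<delta> \<le> t" "t \<le> T - 2 * \<delta>"
  shows "plateau T \<delta> t = 1" "plateau_deriv T \<delta> t = 0"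
proof -
  have "(t - \<delta>) / \<delta> \<ge> 1" "(T - \<delta> - t) / \<delta> \<ge> 1" using assms by (auto simp: le_divide_eq)
  then show "plateau T \<delta> t = 1" "plateau_deriv T \<delta> t = 0"
    by (auto simp: plateau_def plateau_deriv_def smooth_step_1 smooth_step_deriv_0)
qed

lemma plateau_range: "0 \<le> plateau T \<delta> t" "plateau T \<delta> t \<le> 1"
  by (auto simp: plateau_def smooth_step_range intro!: mult_le_one mult_nonneg_nonneg)

lemma integral_add3:
  fixes f g h :: "'a \<Rightarrow> real"
  assumes "integrable M f" "integrable M g" "integrable M h"
  shows "(LINT x|M. f x + g x + h x) = (LINT x|M. f x) + (LINT x|M. g x) + (LINT x|M. h x)"
  using assms by simp

context minimizer
begin

text \<open>Shifting \<open>F r\<close> by \<open>\<plusminus> h * plateau\<close> along \<open>b\<close> gives two test functions. Adding the two closedness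
  identities cancels the first-order terms, so the two nonnegative deficits \<open>a h\<close>, \<open>a (- h)\<close> in the
  Hamilton-Jacobi inequality have total mass \<open>o(h)\<close>.\<close>

lemma deficit_estimate:
  fixes b :: "real ^ 'n"
  assumes \<delta>: "\<delta> > 0" and nb: "norm b \<le> 1" and \<eta>: "\<eta> > 0"
  shows "\<exists>h r. 0 < h \<and> h < \<eta> \<and> 0 < r \<and> 2 * Cf * r \<le> \<eta> * h \<and>
    (LINT p|M. indicator (XT (2 * \<delta>)) p *
       \<bar>(F' r (proj_base p + h *\<^sub>R (b, 0)) (lift p) - F' r (proj_base p) (lift p)) / h - DL p (b, 0, 0)\<bar>) \<le> \<eta>"
proof -
  define \<theta> where "\<theta> = plateau t0 \<delta>"
  define \<theta>' where "\<theta>' = plateau_deriv t0 \<delta>"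
  define m where "m = measure M X"
  have m: "m \<ge> 0" by (simp add: m_def)
  have \<theta>C: "continuous_on A \<theta>" "continuous_on A \<theta>'" for A
    using C1_on_continuous_on[OF plateau_C1] C1_onD(2)[OF plateau_C1, of A t0 \<delta> 1] by (auto simp: \<theta>_def \<theta>'_def)
  have \<theta>r: "\<bar>\<theta> t\<bar> \<le> 1" for t using plateau_range[of t0 \<delta> t] by (simp add: \<theta>_def)
  have tc: "continuous_on X time" by (intro continuous_intros)
  obtain \<Theta> where \<Theta>: "\<Theta> > 0" "\<And>p. p \<in> X \<Longrightarrow> \<bar>\<theta>' (time p)\<bar> \<le> \<Theta>"
    using continuous_bounded_X[OF continuous_on_compose2[OF \<theta>C(2)[of UNIV] tc]] by auto
  obtain B where B: "B > 0" "\<And>p. p \<in> X \<Longrightarrow> norm p \<le> B"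
    using continuous_bounded_X[OF continuous_on_id] by auto
  \<comment> \<open>Shifting the base point by \<open>(s * \<theta> t) *\<^sub>R b\<close> changes
    the velocity of a lifted curve by \<open>(s * \<theta>' t) *\<^sub>R b\<close>;
    \<open>D s p\<close> is the resulting displacement in phase space.\<close>
  define D where "D s p = ((s * \<theta> (time p)) *\<^sub>R b, (s * \<theta>' (time p)) *\<^sub>R b, 0::real)" for s and p :: "'n phase"
  have D1: "norm (D 1 p) \<le> 1 + \<Theta>" if "p \<in> X" for p
  proof -
    have "norm (D 1 p) \<le> norm (\<theta> (time p) *\<^sub>R b) + norm (\<theta>' (time p) *\<^sub>R b)"
      unfolding D_def using norm_Pair_le[of "\<theta> (time p) *\<^sub>R b" "(\<theta>' (time p) *\<^sub>R b, 0::real)"] norm_Pair_le[of "\<theta>' (time p) *\<^sub>R b" "0::real"]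
      by simp
    also have "\<dots> \<le> 1 * 1 + \<Theta> * 1"
      using \<theta>r \<Theta>(2)[OF that] nb \<Theta>(1) by (simp only: norm_scaleR) (intro add_mono mult_mono, auto)
    finally show ?thesis by simp
  qed
  define R where "R = B + 1 + \<Theta>"
  define Kc where "Kc = (cball 0 R :: (real^'n) set) \<times> (cball 0 R :: (real^'n) set) \<times> {\<delta>..t0 - \<delta>}"
  have Kc: "compact Kc" "Kc \<subseteq> \<Omega>" using \<delta> by (auto simp: Kc_def \<Omega>_def intro!: compact_Times)
  \<comment> \<open>With \<open>\<eta>2 = \<eta>1 * h\<close>, the deficits will have total mass at
    most \<open>\<eta>1 * h * C1\<close>, and \<open>h\<close> times the integral in question will
    be at most \<open>h * (\<eta>1 * C2)\<close>. The choice \<open>\<eta>1 = \<eta> / C2\<close>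
    then gives \<open>\<eta>\<close>.\<close>
  define C1 where "C1 = m * (2 * (1 + \<Theta>) + 2) + 2"
  define C2 where "C2 = m * (2 + \<Theta>) + C1 + 1"
  have "0 \<le> m * (2 * (1 + \<Theta>) + 2)" "0 \<le> m * (2 + \<Theta>)" using m \<Theta>(1) by auto
  then have C: "C1 > 0" "C2 > 0" by (auto simp: C1_def C2_def)
  define \<eta>1 where "\<eta>1 = \<eta> / C2"
  have \<eta>1: "\<eta>1 > 0" using C \<eta> by (simp add: \<eta>1_def)
  obtain d where d: "d > 0" "\<And>p q e. p \<in> Kc \<Longrightarrow> q \<in> Kc \<Longrightarrow> dist p q < d \<Longrightarrow> norm (DL p e - DL q e) \<le> \<eta>1 * norm e"
    by (rule C1_on_uniform[OF L_C1 Kc \<eta>1]) blast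
  have Kin: "p + s *\<^sub>R D 1 p \<in> Kc" if p: "p \<in> XT \<delta>" and s: "\<bar>s\<bar> \<le> 1" for p s
  proof -
    obtain x v t where pe: "p = (x, v, t)" by (cases p)
    have pX: "p \<in> X" "\<delta> \<le> t" "t \<le> t0 - \<delta>" using p by (auto simp: XT_def pe)
    have "norm x \<le> B" "norm v \<le> B"
      using B(2)[OF pX(1)] norm_fst_le[of x "(v, t)"] norm_snd_le[of "(v,t)" x] norm_fst_le[of v t] by (auto simp: pe)
    moreover have "norm (s *\<^sub>R D 1 p) \<le> 1 + \<Theta>"
      using mult_mono[OF s D1[OF pX(1)]] by simp
    then have "norm ((s * \<theta> t) *\<^sub>R b) \<le> 1 + \<Theta>" "norm ((s * \<theta>' t) *\<^sub>R b) \<le> 1 + \<Theta>"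
      using norm_fst_le[of "(s * \<theta> t) *\<^sub>R b" "((s * \<theta>' t) *\<^sub>R b, 0::real)"]
        norm_snd_le[of "((s * \<theta>' t) *\<^sub>R b, 0::real)" "(s * \<theta> t) *\<^sub>R b"]
        norm_fst_le[of "(s * \<theta>' t) *\<^sub>R b" "0::real"] by (auto simp: D_def pe simp del: norm_scaleR)
    ultimately have "norm (x + (s * \<theta> t) *\<^sub>R b) \<le> R" "norm (v + (s * \<theta>' t) *\<^sub>R b) \<le> R"
      using norm_triangle_ineq[of x "(s * \<theta> t) *\<^sub>R b"] norm_triangle_ineq[of v "(s * \<theta>' t) *\<^sub>R b"]
      by (auto simp: R_def simp del: norm_scaleR)
    then show ?thesis using pX by (simp add: Kc_def D_def pe)
  qed
  \<comment> \<open>As \<open>D 1 p\<close> has norm at most \<open>1 + \<Theta>\<close>, the last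
    entry keeps shifts by up to \<open>h\<close> within the distance \<open>d\<close> at which the
    derivative of \<open>L\<close> varies by at most \<open>\<eta>1\<close>.\<close>
  define h where "h = Min {1/2, \<eta>/2, d / (2 * (1 + \<Theta>))}"
  have h: "0 < h" "h < 1" "h < \<eta>" "h * (1 + \<Theta>) < d"
  proof -
    show h0: "0 < h" "h < 1" "h < \<eta>" using \<eta> d \<Theta> by (auto simp: h_def)
    have "h \<le> d / (2 * (1 + \<Theta>))" by (simp add: h_def)
    then have "h * (1 + \<Theta>) \<le> d / 2" using \<Theta> by (simp add: field_simps)
    then show "h * (1 + \<Theta>) < d" using d by simp
  qed
  have taylor: "\<bar>L (p + s *\<^sub>R D 1 p) - L p - s * DL p (D 1 p)\<bar> \<le> \<eta>1 * (h * (1 + \<Theta>))"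
    if p: "p \<in> XT \<delta>" and s: "\<bar>s\<bar> \<le> h" for p s
  proof -
    have pX: "p \<in> X" and pK: "p \<in> Kc" using p Kin[OF p, of 0] by (auto simp: XT_def)
    have pO: "p \<in> \<Omega>" using pK Kc by blast
    have sm: "\<bar>u\<bar> * \<bar>s\<bar> \<le> 1" "\<bar>u\<bar> * \<bar>s\<bar> \<le> h" if "0 \<le> u" "u \<le> 1" for u
      using mult_mono[of "\<bar>u\<bar>" 1 "\<bar>s\<bar>" h] that s h by auto
    have nD: "norm (s *\<^sub>R D 1 p) \<le> h * (1 + \<Theta>)" using mult_mono[OF s D1[OF pX]] h by simp
    have inK: "p + u *\<^sub>R (s *\<^sub>R D 1 p) \<in> Kc" if "0 \<le> u" "u \<le> 1" for u
      using Kin[OF p, of "u * s"] sm[OF that] by (simp add: abs_mult)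
    have "\<bar>L (p + s *\<^sub>R D 1 p) - L p - DL p (s *\<^sub>R D 1 p)\<bar> \<le> \<eta>1 * (h * (1 + \<Theta>))"
    proof (rule C1_difference_bound[OF L_C1])
      fix u :: real assume u: "0 \<le> u" "u \<le> 1"
      show "p + u *\<^sub>R (s *\<^sub>R D 1 p) \<in> \<Omega>" using inK[OF u] Kc by blast
      have "dist (p + u *\<^sub>R (s *\<^sub>R D 1 p)) p = (\<bar>u\<bar> * \<bar>s\<bar>) * norm (D 1 p)" by (simp add: dist_norm abs_mult)
      also have "\<dots> \<le> h * (1 + \<Theta>)" by (intro mult_mono sm u D1 pX) (use h in auto)
      finally have "dist (p + u *\<^sub>R (s *\<^sub>R D 1 p)) p < d" using h by linarith
      from d(2)[OF inK[OF u] pK this, of "s *\<^sub>R D 1 p", unfolded real_norm_def]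
      show "\<bar>DL (p + u *\<^sub>R (s *\<^sub>R D 1 p)) (s *\<^sub>R D 1 p) - DL p (s *\<^sub>R D 1 p)\<bar> \<le> \<eta>1 * (h * (1 + \<Theta>))"
        using mult_left_mono[OF nD, of \<eta>1] \<eta>1 by linarith
    qed
    moreover have "DL p (s *\<^sub>R D 1 p) = s * DL p (D 1 p)"
      using linear_scale[OF bounded_linear.linear[OF C1_on_linear[OF L_C1 pO]], of s "D 1 p"] by simp
    ultimately show ?thesis by simp
  qed
  \<comment> \<open>The slack in the mollified inequality must be small compared with
    \<open>h\<close>; hence the mollification radius is chosen after \<open>h\<close>.\<close>
  define \<eta>2 where "\<eta>2 = \<eta>1 * h"
  have \<eta>2: "\<eta>2 > 0" using \<eta>1 h by (simp add: \<eta>2_def)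
  obtain r0 where r0: "r0 > 0" "\<And>r x v t. \<lbrakk>0 < r; r < r0; norm x \<le> R; norm v \<le> R; \<delta> \<le> t; t \<le> t0 - \<delta>\<rbrakk> \<Longrightarrow>
     F' r (x, t) (v, 1) \<le> L (x, v, t) + c + \<eta>2"
    using F'_le[OF \<delta> \<eta>2, of R] by blast
  \<comment> \<open>The deficit without shift. On the support at interior times it tends to 0 as
    \<open>r\<close> does, because the inequality is an equality there; bounded convergence makes
    its integral over \<open>XT \<delta>\<close> smaller than \<open>\<eta>2\<close>.\<close>
  define \<beta> where "\<beta> r p = L p + c - F' r (proj_base p) (lift p)" for r p
  have lc: "continuous_on X lift" by (intro continuous_intros)
  have F'c: "continuous_on X (\<lambda>p. F' r (a p) (e p))" if "r > 0" "continuous_on X a" "continuous_on X e" for r a e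
    by (rule C1_on_continuous_deriv[OF F_C1[OF that(1)] that(2) _ that(3)]) auto
  have Lc: "continuous_on X L" by (rule continuous_on_subset[OF L_cont X_S])
  have \<beta>c: "continuous_on X (\<beta> r)" if "r > 0" for r
    unfolding \<beta>_def by (intro continuous_intros Lc F'c that lc)
  have \<beta>small: "\<forall>\<^sub>F n in sequentially. (LINT p|M. indicator (XT \<delta>) p * \<bar>\<beta> (1 / real (Suc n)) p\<bar>) < \<eta>2"
  proof -
    have "continuous_on X (\<lambda>p. L p + c)" by (intro continuous_intros Lc)
    then obtain BL where BL: "\<And>p. p \<in> X \<Longrightarrow> norm (L p + c) \<le> BL" by (rule continuous_bounded_X) blast
    obtain Bl where Bl: "\<And>p. p \<in> X \<Longrightarrow> norm (lift p) \<le> Bl" using lc by (rule continuous_bounded_X) blast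
    have "(\<lambda>n. LINT p|M. indicator (XT \<delta>) p * \<bar>\<beta> (1 / real (Suc n)) p\<bar>) \<longlonglongrightarrow> (LINT p|M. 0)"
    proof (rule dominated_M[where B="BL + Cf * Bl"])
      fix n
      have r: "0 < 1 / real (Suc n)" by simp
      show "(\<lambda>p. indicator (XT \<delta>) p * \<bar>\<beta> (1 / real (Suc n)) p\<bar>) \<in> borel_measurable M"
        using measurable_M[OF \<beta>c[OF r]] by measurable
      fix p assume p: "p \<in> X"
      have "\<bar>\<beta> (1 / real (Suc n)) p\<bar> \<le> BL + Cf * Bl"
        using BL[OF p] F'_bound[OF r, of "proj_base p" "lift p"] mult_left_mono[OF Bl[OF p] Cf]
        by (simp add: \<beta>_def del: of_nat_Suc)
      then show "\<bar>indicator (XT \<delta>) p * \<bar>\<beta> (1 / real (Suc n)) p\<bar>\<bar> \<le> BL + Cf * Bl"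
        by (auto simp: indicator_def simp del: of_nat_Suc)
    next
      fix p assume p: "p \<in> X"
      show "(\<lambda>n. indicator (XT \<delta>) p * \<bar>\<beta> (1 / real (Suc n)) p\<bar>) \<longlonglongrightarrow> 0"
      proof (cases "p \<in> XT \<delta>")
        case True
        then have t: "0 < time p" "time p < t0" using \<delta> by (auto simp: XT_def)
        have "filterlim (\<lambda>n. 1 / real (Suc n)) (at_right 0) sequentially" by real_asymp
        from filterlim_compose[OF F'_tendsto[OF p t, of "lift p"] this]
        have "(\<lambda>n. \<bar>\<beta> (1 / real (Suc n)) p\<bar>) \<longlonglongrightarrow> \<bar>L p + c - fD (proj_base p) (lift p)\<bar>"
          unfolding \<beta>_def by (intro tendsto_intros)
        then show ?thesis using True fD(2)[OF p t] by simp
      qed simp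
    qed
    then show ?thesis using \<eta>2 by (intro order_tendstoD(2)[of _ 0]) simp_all
  qed
  have "\<forall>\<^sub>F n in sequentially. 1 / real (Suc n) < r0" using r0(1) by real_asymp
  moreover have "\<forall>\<^sub>F n in sequentially. 2 * Cf * (1 / real (Suc n)) < \<eta> * h"
  proof (rule order_tendstoD(2))
    have "(\<lambda>n. 1 / real (Suc n)) \<longlonglongrightarrow> 0" by real_asymp
    then show "(\<lambda>n. 2 * Cf * (1 / real (Suc n))) \<longlonglongrightarrow> 0" by (rule tendsto_mult_right_zero)
  qed (use \<eta> h in simp)
  ultimately have "\<forall>\<^sub>F n in sequentially. 1 / real (Suc n) < r0 \<and> 2 * Cf * (1 / real (Suc n)) < \<eta> * h \<and>
     (LINT p|M. indicator (XT \<delta>) p * \<bar>\<beta> (1 / real (Suc n)) p\<bar>) < \<eta>2"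
    using \<beta>small by eventually_elim blast
  then obtain n where n: "1 / real (Suc n) < r0 \<and> 2 * Cf * (1 / real (Suc n)) < \<eta> * h \<and>
     (LINT p|M. indicator (XT \<delta>) p * \<bar>\<beta> (1 / real (Suc n)) p\<bar>) < \<eta>2"
    using eventually_happens'[OF sequentially_bot] by blast
  define r where "r = 1 / real (Suc n)"
  have r: "0 < r" "r < r0" "2 * Cf * r < \<eta> * h" "(LINT p|M. indicator (XT \<delta>) p * \<bar>\<beta> r p\<bar>) < \<eta>2"
    using n by (auto simp: r_def)
  define a where "a s p = L (p + s *\<^sub>R D 1 p) + c + \<eta>2 - F' r (proj_base (p + s *\<^sub>R D 1 p)) (lift (p + s *\<^sub>R D 1 p))" for s p
  have a0: "0 \<le> a s p" if p: "p \<in> XT \<delta>" and s: "\<bar>s\<bar> \<le> 1" for s p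
  proof -
    obtain x v t where e: "p + s *\<^sub>R D 1 p = (x, v, t)" by (metis prod.collapse)
    have "(x, v, t) \<in> Kc" using Kin[OF p s] by (simp add: e)
    then show ?thesis using r0(2)[OF r(1,2), of x v t] by (simp add: a_def e Kc_def proj_base_def)
  qed
  have Dc: "continuous_on X (\<lambda>p. p + s *\<^sub>R D 1 p)" for s
    unfolding D_def by (intro continuous_intros continuous_on_compose2[OF \<theta>C(1)[of UNIV] tc] continuous_on_compose2[OF \<theta>C(2)[of UNIV] tc]) auto
  have LDc: "continuous_on X (\<lambda>p. L (p + s *\<^sub>R D 1 p))" for s
    by (rule continuous_on_compose2[OF L_cont Dc]) (use X_S in \<open>force simp: phase_def D_def\<close>)
  have F'Dc: "continuous_on X (\<lambda>p. F' r (proj_base (p + s *\<^sub>R D 1 p)) (lift (p + s *\<^sub>R D 1 p)))" for s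
    unfolding proj_base_eq by (intro F'c r(1) continuous_intros Dc)
  have ac: "continuous_on X (a s)" for s unfolding a_def by (intro continuous_intros LDc F'Dc)
  \<comment> \<open>Closedness for the difference of \<open>F r\<close> after and before the shift.
    This difference vanishes near the ends, and its derivative along the lift is rewritten through
    the shifted and the unshifted deficit.\<close>
  have clos: "(LINT p|M. indicator (XT \<delta>) p * (L (p + s *\<^sub>R D 1 p) - L p + \<eta>2 + \<beta> r p - a s p)) = 0" for s
  proof -
    have th: "C1_on UNIV (\<lambda>z :: (real^'n) \<times> real. \<theta> (snd z)) (\<lambda>z e. \<theta>' (snd z) * snd e)"
      unfolding \<theta>_def \<theta>'_def
      by (rule C1_on_compose[OF plateau_C1[of UNIV] C1_on_bounded_linear[OF bounded_linear_snd]]) auto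
    have "bounded_linear (\<lambda>t. ((s * t) *\<^sub>R b, 0::real))"
      by (intro bounded_linear_Pair bounded_linear_scaleR_const bounded_linear_const_mult bounded_linear_ident bounded_linear_zero)
    from C1_on_compose[OF C1_on_bounded_linear[OF this] th]
    have "C1_on UNIV (\<lambda>z :: (real^'n) \<times> real. ((s * \<theta> (snd z)) *\<^sub>R b, 0::real)) (\<lambda>z e. ((s * (\<theta>' (snd z) * snd e)) *\<^sub>R b, 0))"
      by auto
    from C1_on_add[OF C1_on_bounded_linear[OF bounded_linear_ident] this]
    have T: "C1_on UNIV (\<lambda>z :: (real^'n) \<times> real. z + ((s * \<theta> (snd z)) *\<^sub>R b, 0::real)) (\<lambda>z e. e + ((s * (\<theta>' (snd z) * snd e)) *\<^sub>R b, 0))" .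
    define g' where "g' z e = F' r (z + ((s * \<theta> (snd z)) *\<^sub>R b, 0)) (e + ((s * (\<theta>' (snd z) * snd e)) *\<^sub>R b, 0)) - F' r z e" for z e
    have g: "C1_on UNIV (\<lambda>z. F r (z + ((s * \<theta> (snd z)) *\<^sub>R b, 0)) - F r z) g'"
      unfolding g'_def[abs_def] by (intro C1_on_diff C1_on_compose[OF F_C1[OF r(1)] T] F_C1[OF r(1)]) auto
    have 0: "(LINT p|M. g' (proj_base p) (lift p)) = 0"
      by (rule closed_C1[OF g \<delta>]) (use plateau_outside[OF \<delta>] in \<open>auto simp: \<theta>_def zero_prod_def[symmetric]\<close>)
    have "(LINT p|M. g' (proj_base p) (lift p)) = (LINT p|M. indicator (XT \<delta>) p * (L (p + s *\<^sub>R D 1 p) - L p + \<eta>2 + \<beta> r p - a s p))"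
    proof (rule Bochner_Integration.integral_cong[OF refl])
      fix p assume "p \<in> space M"
      then have p: "p \<in> X" by simp
      show "g' (proj_base p) (lift p) = indicator (XT \<delta>) p * (L (p + s *\<^sub>R D 1 p) - L p + \<eta>2 + \<beta> r p - a s p)"
      proof (cases "p \<in> XT \<delta>")
        case True
        have "proj_base (p + s *\<^sub>R D 1 p) = proj_base p + ((s * \<theta> (time p)) *\<^sub>R b, 0)"
          "lift (p + s *\<^sub>R D 1 p) = lift p + ((s * \<theta>' (time p)) *\<^sub>R b, 0)"
          by (auto simp: proj_base_eq D_def)
        moreover have "time (D 1 p) = 0" by (simp add: D_def)
        ultimately show ?thesis using True by (simp add: g'_def a_def \<beta>_def proj_base_eq)
      next
        case False
        then have "time p \<le> \<delta> \<or> time p \<ge> t0 - \<delta>" using p by (auto simp: XT_def)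
        from plateau_outside[OF \<delta> this] False show ?thesis
          by (simp add: g'_def \<theta>_def \<theta>'_def proj_base_eq zero_prod_def[symmetric])
      qed
    qed
    then show ?thesis using 0 by simp
  qed
  have int: "integrable M (\<lambda>p. indicator (XT \<delta>) p * k p)" if "continuous_on X k" for k :: "'n phase \<Rightarrow> real"
    by (intro integrable_XT integrable_M that)
  have br: "continuous_on X (\<beta> r)" by (rule \<beta>c[OF r(1)])
  have mXT: "(LINT p|M. indicator (XT \<delta>) p * k) \<le> m * k" if "k \<ge> 0" for k
  proof -
    have "(LINT p|M. indicator (XT \<delta>) p * k) \<le> (LINT p|M. k)"
      using that finite_M
      by (intro integral_mono integrable_XT) (auto simp: finite_measure.integrable_const indicator_def)
    then show ?thesis by (simp add: m_def)
  qed
  have suma: "(LINT p|M. indicator (XT \<delta>) p * (a h p + a (-h) p)) \<le> \<eta>1 * h * C1"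
  proof -
    let ?E = "\<lambda>s p. L (p + s *\<^sub>R D 1 p) - L p + \<eta>2 + \<beta> r p - a s p"
    have Ec: "continuous_on X (?E s)" for s by (intro continuous_intros LDc Lc br ac)
    \<comment> \<open>Both terms \<open>?E\<close> integrate to 0 and may be added. In the sum the
      deficits disappear from the integrand, and the opposite first-order terms of the two
      expansions of \<open>L\<close> cancel.\<close>
    have "(LINT p|M. indicator (XT \<delta>) p * (a h p + a (-h) p)) =
        (LINT p|M. indicator (XT \<delta>) p * (a h p + a (-h) p)) + (LINT p|M. indicator (XT \<delta>) p * ?E h p) + (LINT p|M. indicator (XT \<delta>) p * ?E (-h) p)"
      by (simp only: clos)
    also have "\<dots> = (LINT p|M. indicator (XT \<delta>) p * (a h p + a (-h) p) + indicator (XT \<delta>) p * ?E h p + indicator (XT \<delta>) p * ?E (-h) p)"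
      by (intro integral_add3[symmetric] int continuous_intros ac Ec)
    also have "\<dots> \<le> (LINT p|M. indicator (XT \<delta>) p * (2 * \<eta>1 * h * (1 + \<Theta>) + 2 * \<eta>2) + 2 * (indicator (XT \<delta>) p * \<bar>\<beta> r p\<bar>))"
    proof (rule integral_mono)
      fix p
      show "indicator (XT \<delta>) p * (a h p + a (-h) p) + indicator (XT \<delta>) p * ?E h p + indicator (XT \<delta>) p * ?E (-h) p
        \<le> indicator (XT \<delta>) p * (2 * \<eta>1 * h * (1 + \<Theta>) + 2 * \<eta>2) + 2 * (indicator (XT \<delta>) p * \<bar>\<beta> r p\<bar>)"
      proof (cases "p \<in> XT \<delta>")
        case True
        show ?thesis using taylor[OF True, of h] taylor[OF True, of "-h"] h True by simp
      qed simp
    qed (intro Bochner_Integration.integrable_add integrable_mult_right int Ec continuous_intros ac br)+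
    also have "\<dots> = (LINT p|M. indicator (XT \<delta>) p * (2 * \<eta>1 * h * (1 + \<Theta>) + 2 * \<eta>2)) + 2 * (LINT p|M. indicator (XT \<delta>) p * \<bar>\<beta> r p\<bar>)"
      by (subst Bochner_Integration.integral_add)
         ((intro int continuous_intros br integrable_mult_right)+, simp only: integral_mult_right_zero)
    also have "\<dots> \<le> m * (2 * \<eta>1 * h * (1 + \<Theta>) + 2 * \<eta>2) + 2 * \<eta>2"
      using r(4) \<eta>1 \<eta>2 h \<Theta> by (intro add_mono mXT) auto
    also have "\<dots> = \<eta>1 * h * C1" by (simp add: C1_def \<eta>2_def algebra_simps)
    finally show ?thesis .
  qed
  have hh: "\<bar>h\<bar> \<le> h" "\<bar>h\<bar> \<le> 1" "\<bar>- h\<bar> \<le> 1" using h by auto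
  let ?Q = "\<lambda>p. (F' r (proj_base p + h *\<^sub>R (b, 0)) (lift p) - F' r (proj_base p) (lift p)) / h - DL p (b, 0, 0)"
  have Qc: "continuous_on X ?Q"
    by (intro continuous_intros F'c r(1) lc continuous_on_proj_base dir_deriv_continuous[OF L_diff L1c]) (use X_S h in auto)
  have "h * (LINT p|M. indicator (XT (2 * \<delta>)) p * \<bar>?Q p\<bar>) = (LINT p|M. h * (indicator (XT (2 * \<delta>)) p * \<bar>?Q p\<bar>))"
    by simp
  also have "\<dots> \<le> (LINT p|M. indicator (XT \<delta>) p * (\<eta>1 * h * (1 + \<Theta>) + \<eta>2) + indicator (XT \<delta>) p * (a h p + a (-h) p) + indicator (XT \<delta>) p * \<bar>\<beta> r p\<bar>)"
  proof (rule integral_mono)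
    show "integrable M (\<lambda>p. h * (indicator (XT (2 * \<delta>)) p * \<bar>?Q p\<bar>))"
      by (intro integrable_mult_right integrable_XT integrable_M continuous_on_rabs Qc)
    show "integrable M (\<lambda>p. indicator (XT \<delta>) p * (\<eta>1 * h * (1 + \<Theta>) + \<eta>2) + indicator (XT \<delta>) p * (a h p + a (-h) p) + indicator (XT \<delta>) p * \<bar>\<beta> r p\<bar>)"
      by (intro Bochner_Integration.integrable_add int continuous_intros ac br)
    fix p
    show "h * (indicator (XT (2 * \<delta>)) p * \<bar>?Q p\<bar>) \<le> indicator (XT \<delta>) p * (\<eta>1 * h * (1 + \<Theta>) + \<eta>2) + indicator (XT \<delta>) p * (a h p + a (-h) p) + indicator (XT \<delta>) p * \<bar>\<beta> r p\<bar>"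
    proof (cases "p \<in> XT (2 * \<delta>)")
      case True
      then have p1: "p \<in> XT \<delta>" using \<delta> by (auto simp: XT_def)
      have th1: "\<theta> (time p) = 1" "\<theta>' (time p) = 0"
        using plateau_inside[OF \<delta>, of "time p" t0] True by (auto simp: XT_def \<theta>_def \<theta>'_def)
      have D1p: "D 1 p = (b, 0, 0)" by (simp add: D_def th1)
      have pl: "proj_base (p + h *\<^sub>R D 1 p) = proj_base p + h *\<^sub>R (b, 0)" "lift (p + h *\<^sub>R D 1 p) = lift p"
        by (auto simp: D1p proj_base_eq)
      \<comment> \<open>Where the plateau equals 1 the shift is a pure translation. There the error
        of the difference quotient consists of a Taylor remainder, the slack and the two deficits,
        and the nonnegative \<open>a h p\<close> is controlled by its integral.\<close>
      have "h * ?Q p = (L (p + h *\<^sub>R D 1 p) - L p - h * DL p (D 1 p)) + \<eta>2 - a h p + \<beta> r p"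
      proof -
        have ahp: "a h p = L (p + h *\<^sub>R D 1 p) + c + \<eta>2 - F' r (proj_base p + h *\<^sub>R (b, 0)) (lift p)"
          unfolding a_def by (simp only: pl)
        have "h * ((x - y) / h - k) = x - y - h * k" for x y k using h by (simp add: field_simps)
        then show ?thesis by (simp only: ahp \<beta>_def D1p)
      qed
      moreover have "\<bar>x + \<eta>2 - y + z\<bar> \<le> k + \<eta>2 + y + \<bar>z\<bar>" if "\<bar>x\<bar> \<le> k" "0 \<le> y" for x y z k
        using that \<eta>2 by linarith
      from this[OF taylor[OF p1 hh(1)] a0[OF p1 hh(2)], of "\<beta> r p"]
      have "\<bar>(L (p + h *\<^sub>R D 1 p) - L p - h * DL p (D 1 p)) + \<eta>2 - a h p + \<beta> r p\<bar>
         \<le> \<eta>1 * (h * (1 + \<Theta>)) + \<eta>2 + a h p + \<bar>\<beta> r p\<bar>" .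
      ultimately have "\<bar>h * ?Q p\<bar> \<le> \<eta>1 * (h * (1 + \<Theta>)) + \<eta>2 + a h p + \<bar>\<beta> r p\<bar>"
        by (simp only:)
      then have "h * \<bar>?Q p\<bar> \<le> \<eta>1 * (h * (1 + \<Theta>)) + \<eta>2 + a h p + \<bar>\<beta> r p\<bar>"
        unfolding abs_mult using h(1) by (simp only: abs_of_pos)
      then show ?thesis using True p1 a0[OF p1 hh(3)] by (simp add: mult.assoc)
    next
      case False
      have "0 \<le> \<eta>1 * h * (1 + \<Theta>)" using \<eta>1 h \<Theta>(1) by simp
      then show ?thesis using False a0[OF _ hh(2), of p] a0[OF _ hh(3), of p] \<eta>2
        by (cases "p \<in> XT \<delta>") auto
    qed
  qed
  also have "\<dots> = (LINT p|M. indicator (XT \<delta>) p * (\<eta>1 * h * (1 + \<Theta>) + \<eta>2)) + (LINT p|M. indicator (XT \<delta>) p * (a h p + a (-h) p)) + (LINT p|M. indicator (XT \<delta>) p * \<bar>\<beta> r p\<bar>)"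
    by (intro integral_add3 int continuous_intros br ac)
  also have "\<dots> \<le> m * (\<eta>1 * h * (1 + \<Theta>) + \<eta>2) + \<eta>1 * h * C1 + \<eta>2"
    using r(4) \<eta>1 \<eta>2 h \<Theta> by (intro add_mono mXT suma) auto
  also have "\<dots> = h * (\<eta>1 * C2)" by (simp add: C2_def \<eta>2_def algebra_simps)
  also have "\<eta>1 * C2 = \<eta>" using C by (simp add: \<eta>1_def)
  finally have "(LINT p|M. indicator (XT (2 * \<delta>)) p * \<bar>?Q p\<bar>) \<le> \<eta>"
    using h by (simp only: mult_le_cancel_left_pos)
  then show ?thesis using h r by (intro exI[of _ h] exI[of _ r]) (auto intro: less_imp_le)
qed

end

lemma C1_on_vec_lambda:
  fixes f :: "'i::finite \<Rightarrow> 'a::euclidean_space \<Rightarrow> real"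
  assumes "\<And>i. C1_on S (f i) (f' i)"
  shows "C1_on S (\<lambda>z. \<chi> i. f i z) (\<lambda>z e. \<chi> i. f' i z e)"
proof (rule C1_onI)
  fix z assume z: "z \<in> S"
  show "((\<lambda>z. \<chi> i. f i z) has_derivative (\<lambda>e. \<chi> i. f' i z e)) (at z)"
    by (subst has_derivative_componentwise_within)
       (use C1_onD(1)[OF assms z] in \<open>auto simp: Basis_vec_def inner_axis\<close>)
next
  show "continuous_on S (\<lambda>z. \<chi> i. f' i z e)" for e
    by (intro continuous_on_vec_lambda C1_onD(2)[OF assms])
qed

context minimizer
begin

definition momentum :: "'n phase \<Rightarrow> real ^ 'n" where "momentum p = (\<chi> i. DL p (unit_v i))"
definition force :: "'n phase \<Rightarrow> real ^ 'n" where "force p = (\<chi> i. DL p (unit_x i))"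

lemma unit_Basis: "unit_x i \<in> Basis" "unit_v i \<in> Basis" "unit_t \<in> Basis"
  by (auto simp: unit_x_def unit_v_def unit_t_def Basis_prod_def zero_prod_def axis_in_Basis_iff Basis_real_def image_iff)

lemma momentum_cont: "continuous_on S momentum" and force_cont: "continuous_on S force"
  unfolding momentum_def force_def using L1c unit_Basis by (auto intro!: continuous_on_vec_lambda)

lemma fiber_derivative:
  assumes p: "(x, v, t) \<in> \<Omega>"
  shows "((\<lambda>s. L (x, v + s *\<^sub>R b, t)) has_real_derivative DL (x, v + s *\<^sub>R b, t) (0, b, 0)) (at s)"
proof -
  have i: "((\<lambda>s. (x, v + s *\<^sub>R b, t)) has_derivative (\<lambda>s. (0, s *\<^sub>R b, 0))) (at s)"
    by (auto intro!: derivative_eq_intros)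
  have o: "(x, v + s *\<^sub>R b, t) \<in> \<Omega>" using p by (simp add: \<Omega>_def)
  have "DL (x, v + s *\<^sub>R b, t) (0, h *\<^sub>R b, 0) = DL (x, v + s *\<^sub>R b, t) (0, b, 0) * h" for h
    using linear_scale[OF bounded_linear.linear[OF C1_on_linear[OF L_C1 o]], of h "(0, b, 0)"] by simp
  with has_derivative_compose[OF i C1_onD(1)[OF L_C1 o]] show ?thesis
    by (simp add: has_field_derivative_def)
qed

text \<open>At a point of differentiability the inequality holds for every velocity, with equality
  at \<open>v\<close>; the two are subtracted.\<close>

lemma fiber_gap:
  assumes p: "(x, v, t) \<in> X" "0 < t" "t < t0"
  shows "L (x, v + w, t) \<ge> L (x, v, t) + fD (x, t) (w, 0)"
proof -
  have fd: "(fe has_derivative fD (x, t)) (at (x, t))" "fD (x, t) (v, 1) = L (x, v, t) + c"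
    using fD[OF p(1)] p by (auto simp: proj_base_def)
  have "fD (x, t) (v + w, 1) \<le> L (x, v + w, t) + c"
    by (rule fe_derivative_le[OF p(2,3) fd(1)])
  moreover have "fD (x, t) (v + w, 1) = fD (x, t) (v, 1) + fD (x, t) (w, 0)"
    using linear_add[OF bounded_linear.linear[OF has_derivative_bounded_linear[OF fd(1)]], of "(v, 1)" "(w, 0)"] by simp
  ultimately show ?thesis using fd(2) by simp
qed

text \<open>The first-order condition at the contact velocity. It identifies the spatial gradient of
  f, known only to exist on the projected support, with a function that is continuous on phase
  space.\<close>

lemma momentum_eq:
  assumes p: "(x, v, t) \<in> X" "0 < t" "t < t0"
  shows "fD (x, t) (b, 0) = DL (x, v, t) (0, b, 0)"
proof -
  have o: "(x, v, t) \<in> \<Omega>" using p by (simp add: \<Omega>_def)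
  have "bounded_linear (fD (x, t))" using fD(1)[OF p(1)] p has_derivative_bounded_linear by (auto simp: proj_base_def)
  then have sc: "fD (x, t) (s *\<^sub>R b, 0) = s * fD (x, t) (b, 0)" for s
    using linear_scale[OF bounded_linear.linear, of "fD (x, t)" s "(b, 0)"] by simp
  have "((\<lambda>s. L (x, v + s *\<^sub>R b, t) - s * fD (x, t) (b, 0)) has_real_derivative DL (x, v + 0 *\<^sub>R b, t) (0, b, 0) - fD (x, t) (b, 0)) (at 0)"
    by (auto intro!: derivative_eq_intros fiber_derivative[OF o])
  then have "DL (x, v + 0 *\<^sub>R b, t) (0, b, 0) - fD (x, t) (b, 0) = 0"
  proof (rule DERIV_local_min[where d=1])
    have "L (x, v, t) + s * fD (x, t) (b, 0) \<le> L (x, v + s *\<^sub>R b, t)" for s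
      using fiber_gap[OF p, of "s *\<^sub>R b"] sc[of s] by simp
    then show "\<forall>s. \<bar>0 - s\<bar> < 1 \<longrightarrow> L (x, v + 0 *\<^sub>R b, t) - 0 * fD (x, t) (b, 0) \<le> L (x, v + s *\<^sub>R b, t) - s * fD (x, t) (b, 0)"
      by (simp add: le_diff_eq)
  qed simp
  then show ?thesis by simp
qed

text \<open>The components of \<open>P k\<close> are difference quotients of the mollified f along
  the coordinate axes, with step and radius supplied by \<open>deficit_estimate\<close> for the
  tolerance 1 / (k + 1). That estimate is exactly the asserted convergence in L^1 of the derivatives
  along the lift.\<close>

lemma momentum_approx:
  assumes \<delta>: "\<delta> > 0"
  obtains P P' B where "\<And>k. C1_on UNIV (P k) (P' k)" "\<And>k z. norm (P k z :: real ^ 'n) \<le> B"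
    "\<And>p. p \<in> X \<Longrightarrow> 0 < time p \<Longrightarrow> time p < t0 \<Longrightarrow> (\<lambda>k. P k (proj_base p)) \<longlonglongrightarrow> momentum p"
    "(\<lambda>k. LINT p|M. indicator (XT (2 * \<delta>)) p * norm (P' k (proj_base p) (lift p) - force p)) \<longlonglongrightarrow> 0"
proof -
  define b where "b i = (axis i 1 :: real ^ 'n)" for i
  define \<eta> where "\<eta> k = 1 / real (Suc k)" for k
  define G where "G k i h r \<longleftrightarrow> 0 < h \<and> h < \<eta> k \<and> 0 < r \<and> 2 * Cf * r \<le> \<eta> k * h \<and>
    (LINT p|M. indicator (XT (2 * \<delta>)) p *
       \<bar>(F' r (proj_base p + h *\<^sub>R (b i, 0)) (lift p) - F' r (proj_base p) (lift p)) / h - DL p (b i, 0, 0)\<bar>) \<le> \<eta> k"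
    for k i h r
  have "\<exists>h r. G k i h r" for k i
    unfolding G_def by (rule deficit_estimate[OF \<delta>]) (auto simp: b_def \<eta>_def norm_axis_1)
  then obtain h r where "\<And>k i. G k i (h k i) (r k i)" by metis
  then have hr: "\<And>k i. 0 < h k i" "\<And>k i. h k i < \<eta> k" "\<And>k i. 0 < r k i" "\<And>k i. 2 * Cf * r k i \<le> \<eta> k * h k i"
    "\<And>k i. (LINT p|M. indicator (XT (2 * \<delta>)) p *
       \<bar>(F' (r k i) (proj_base p + h k i *\<^sub>R (b i, 0)) (lift p) - F' (r k i) (proj_base p) (lift p)) / h k i - DL p (b i, 0, 0)\<bar>) \<le> \<eta> k"
    unfolding G_def by blast+
  define Q where "Q k i z = (F (r k i) (z + h k i *\<^sub>R (b i, 0)) - F (r k i) z) / h k i" for k i z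
  define Q' where "Q' k i z e = (F' (r k i) (z + h k i *\<^sub>R (b i, 0)) e - F' (r k i) z e) / h k i" for k i z e
  have QC: "C1_on UNIV (Q k i) (Q' k i)" for k i
  proof -
    have sh: "C1_on UNIV (\<lambda>z :: (real^'n) \<times> real. z + h k i *\<^sub>R (b i, 0)) (\<lambda>z e. e + 0)"
      by (intro C1_on_add C1_on_bounded_linear bounded_linear_ident C1_on_const)
    have "C1_on UNIV (\<lambda>z. (1 / h k i) * (F (r k i) (z + h k i *\<^sub>R (b i, 0)) - F (r k i) z))
      (\<lambda>z e. (1 / h k i) * (F' (r k i) (z + h k i *\<^sub>R (b i, 0)) (e + 0) - F' (r k i) z e) + 0 * (F (r k i) (z + h k i *\<^sub>R (b i, 0)) - F (r k i) z))"
      by (intro C1_on_mult C1_on_const C1_on_diff C1_on_compose[OF F_C1 sh] F_C1 hr) auto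
    then show ?thesis by (simp add: Q_def[abs_def] Q'_def[abs_def])
  qed
  have Qb: "\<bar>Q k i z\<bar> \<le> Cf" for k i z
  proof -
    have "\<bar>F (r k i) (z + h k i *\<^sub>R (b i, 0)) - F (r k i) z\<bar> \<le> Cf * h k i"
      using Lip_abs[OF F_lip[OF hr(3)[of k i]], of "z + h k i *\<^sub>R (b i, 0)" z] hr(1)[of k i]
      by (simp add: b_def norm_axis_1 norm_Pair)
    then show ?thesis using hr(1)[of k i] by (simp add: Q_def abs_divide divide_le_eq)
  qed
  have \<eta>0: "\<eta> \<longlonglongrightarrow> 0" unfolding \<eta>_def by real_asymp
  have h0: "filterlim (\<lambda>k. h k i) (at_right 0) sequentially" for i
  proof (rule filterlim_at_withinI)
    show "(\<lambda>k. h k i) \<longlonglongrightarrow> 0"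
      by (rule tendsto_sandwich[OF _ _ tendsto_const \<eta>0]) (use hr in \<open>auto intro!: always_eventually less_imp_le\<close>)
  qed (use hr in \<open>auto intro!: always_eventually\<close>)
  have Qlim: "(\<lambda>k. Q k i (proj_base p)) \<longlonglongrightarrow> momentum p $ i" if p: "p \<in> X" "0 < time p" "time p < t0" for p i
  proof -
    define q where "q k = (fe (proj_base p + h k i *\<^sub>R (b i, 0)) - fe (proj_base p)) / h k i" for k
    have 1: "((\<lambda>t::real. proj_base p + t *\<^sub>R (b i, 0::real)) has_derivative (\<lambda>t. t *\<^sub>R (b i, 0::real))) (at 0)"
      by (auto intro!: derivative_eq_intros simp del: scaleR_Pair)
    have fd: "(fe has_derivative fD (proj_base p)) (at (proj_base p + (0::real) *\<^sub>R (b i, 0::real)))" using fD(1)[OF p] by (simp del: scaleR_Pair)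
    have "fD (proj_base p) (t *\<^sub>R (b i, 0)) = fD (proj_base p) (b i, 0) * t" for t
      using linear_scale[OF bounded_linear.linear[OF has_derivative_bounded_linear[OF fd]], of t "(b i, 0)"] by (simp del: scaleR_Pair)
    with has_derivative_compose[OF 1 fd]
    have "((\<lambda>t. fe (proj_base p + t *\<^sub>R (b i, 0))) has_real_derivative fD (proj_base p) (b i, 0)) (at 0)"
      by (simp add: has_field_derivative_def del: scaleR_Pair)
    then have "((\<lambda>t. (fe (proj_base p + t *\<^sub>R (b i, 0)) - fe (proj_base p)) / t) \<longlongrightarrow> fD (proj_base p) (b i, 0)) (at 0)"
      by (simp add: has_field_derivative_iff del: scaleR_Pair)
    then have "((\<lambda>t. (fe (proj_base p + t *\<^sub>R (b i, 0)) - fe (proj_base p)) / t) \<longlongrightarrow> fD (proj_base p) (b i, 0)) (at_right 0)"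
      by (rule filterlim_at_split[THEN iffD1, THEN conjunct2])
    from filterlim_compose[OF this h0[of i]] have q: "q \<longlonglongrightarrow> fD (proj_base p) (b i, 0)" by (simp add: q_def[abs_def] del: scaleR_Pair)
    have "fD (proj_base p) (b i, 0) = momentum p $ i"
      using momentum_eq[of "fst p" "fst (snd p)" "time p" "b i"] p by (simp add: proj_base_eq momentum_def unit_v_def b_def)
    \<comment> \<open>Mollification changes f by at most \<open>Cf * r\<close> at each of the two
      points; the condition \<open>2 * Cf * r \<le> \<eta> * h\<close> keeps this negligible after
      division by the step.\<close>
    moreover have "(\<lambda>k. Q k i (proj_base p) - q k) \<longlonglongrightarrow> 0"
    proof (rule Lim_null_comparison[OF always_eventually \<eta>0], rule allI)
      fix k
      have "Q k i (proj_base p) - q k = ((F (r k i) (proj_base p + h k i *\<^sub>R (b i, 0)) - fe (proj_base p + h k i *\<^sub>R (b i, 0)))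
         - (F (r k i) (proj_base p) - fe (proj_base p))) / h k i"
        by (simp add: Q_def q_def diff_divide_distrib)
      also have "\<bar>\<dots>\<bar> \<le> (2 * Cf * r k i) / h k i"
        using F_close[OF hr(3)[of k i], of "proj_base p + h k i *\<^sub>R (b i, 0)"] F_close[OF hr(3)[of k i], of "proj_base p"] hr(1)[of k i]
        by (simp add: abs_divide divide_right_mono)
      also have "\<dots> \<le> \<eta> k" using hr(1,4)[of k i] by (simp add: divide_le_eq)
      finally show "norm (Q k i (proj_base p) - q k) \<le> \<eta> k" by simp
    qed
    ultimately show ?thesis using tendsto_add[OF _ q, of "\<lambda>k. Q k i (proj_base p) - q k" 0] by simp
  qed
  show thesis
  proof (rule that)
    show "C1_on UNIV (\<lambda>z. \<chi> i. Q k i z) (\<lambda>z e. \<chi> i. Q' k i z e)" for k by (rule C1_on_vec_lambda[OF QC])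
    show "norm (\<chi> i. Q k i z) \<le> (\<Sum>i\<in>(UNIV::'n set). Cf)" for k z
      by (rule order_trans[OF norm_le_l1_cart sum_mono]) (simp add: Qb)
    show "(\<lambda>k. \<chi> i. Q k i (proj_base p)) \<longlonglongrightarrow> momentum p" if "p \<in> X" "0 < time p" "time p < t0" for p
      by (rule vec_tendstoI) (simp add: Qlim[OF that])
    define I where "I k i = (LINT p|M. indicator (XT (2 * \<delta>)) p * \<bar>Q' k i (proj_base p) (lift p) - DL p (b i, 0, 0)\<bar>)" for k i
    have lc: "continuous_on X lift" by (intro continuous_intros)
    have Q'c: "continuous_on X (\<lambda>p. Q' k i (proj_base p) (lift p) - DL p (b i, 0, 0))" for k i
      by (intro continuous_intros C1_on_continuous_deriv[OF QC continuous_on_proj_base] lc dir_deriv_continuous[OF L_diff L1c])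
         (use X_S in auto)
    show "(\<lambda>k. LINT p|M. indicator (XT (2 * \<delta>)) p * norm ((\<chi> i. Q' k i (proj_base p) (lift p)) - force p)) \<longlonglongrightarrow> 0"
    proof (rule Lim_null_comparison[OF always_eventually], rule allI)
      fix k
      have int: "integrable M (\<lambda>p. indicator (XT (2 * \<delta>)) p * \<bar>Q' k i (proj_base p) (lift p) - DL p (b i, 0, 0)\<bar>)" for i
        by (intro integrable_XT integrable_M continuous_on_rabs Q'c)
      have "continuous_on X (\<lambda>p. (\<chi> i. Q' k i (proj_base p) (lift p)) - force p)"
        by (intro continuous_intros continuous_on_vec_lambda C1_on_continuous_deriv[OF QC continuous_on_proj_base] lc
            continuous_on_subset[OF force_cont X_S]) auto
      then have int': "integrable M (\<lambda>p. indicator (XT (2 * \<delta>)) p * norm ((\<chi> i. Q' k i (proj_base p) (lift p)) - force p))"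
        by (intro integrable_XT integrable_M continuous_on_norm)
      have "(LINT p|M. indicator (XT (2 * \<delta>)) p * norm ((\<chi> i. Q' k i (proj_base p) (lift p)) - force p))
        \<le> (LINT p|M. (\<Sum>i\<in>UNIV. indicator (XT (2 * \<delta>)) p * \<bar>Q' k i (proj_base p) (lift p) - DL p (b i, 0, 0)\<bar>))"
      proof (rule integral_mono[OF int'])
        show "integrable M (\<lambda>p. \<Sum>i\<in>UNIV. indicator (XT (2 * \<delta>)) p * \<bar>Q' k i (proj_base p) (lift p) - DL p (b i, 0, 0)\<bar>)"
          by (intro Bochner_Integration.integrable_sum int)
        fix p
        have "norm ((\<chi> i. Q' k i (proj_base p) (lift p)) - force p) \<le> (\<Sum>i\<in>UNIV. \<bar>Q' k i (proj_base p) (lift p) - DL p (b i, 0, 0)\<bar>)"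
          using norm_le_l1_cart[of "(\<chi> i. Q' k i (proj_base p) (lift p)) - force p"] by (simp add: force_def unit_x_def b_def)
        then show "indicator (XT (2 * \<delta>)) p * norm ((\<chi> i. Q' k i (proj_base p) (lift p)) - force p)
          \<le> (\<Sum>i\<in>UNIV. indicator (XT (2 * \<delta>)) p * \<bar>Q' k i (proj_base p) (lift p) - DL p (b i, 0, 0)\<bar>)"
          by (simp add: sum_distrib_left[symmetric] mult_left_mono)
      qed
      also have "\<dots> = (\<Sum>i\<in>UNIV. I k i)" unfolding I_def by (rule Bochner_Integration.integral_sum) (rule int)
      also have "\<dots> \<le> (\<Sum>i\<in>(UNIV :: 'n set). \<eta> k)" using hr(5) by (intro sum_mono) (simp add: I_def Q'_def)
      finally show "norm (LINT p|M. indicator (XT (2 * \<delta>)) p * norm ((\<chi> i. Q' k i (proj_base p) (lift p)) - force p)) \<le> real CARD('n) * \<eta> k"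
        by (simp add: integral_nonneg_AE)
    next
      show "(\<lambda>k. real CARD('n) * \<eta> k) \<longlonglongrightarrow> 0" by (rule tendsto_mult_right_zero[OF \<eta>0])
    qed
  qed
qed

lemma measurable_indicator_XT:
  fixes h :: "'n phase \<Rightarrow> real"
  assumes "continuous_on (XT \<delta>) h"
  shows "(\<lambda>p. indicator (XT \<delta>) p * h p) \<in> borel_measurable M"
proof -
  have cl: "closed (XT \<delta>)" using compact_XT compact_imp_closed by blast
  have "(\<lambda>p. indicator (XT \<delta>) p *\<^sub>R h p) \<in> borel_measurable borel"
    by (rule borel_measurable_continuous_on_indicator) (use cl assms in auto)
  then have "(\<lambda>p. indicator (XT \<delta>) p * h p) \<in> borel_measurable \<mu>" by (simp add: measurable_cong_sets[OF sets_\<mu> refl])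
  then show ?thesis unfolding M_def by (rule measurable_restrict_space1)
qed

lemma integrable_indicator_XT:
  fixes h :: "'n phase \<Rightarrow> real"
  assumes "continuous_on (XT \<delta>) h"
  shows "integrable M (\<lambda>p. indicator (XT \<delta>) p * h p)"
proof -
  have "bounded (h ` XT \<delta>)" by (intro compact_imp_bounded compact_continuous_image assms compact_XT)
  then obtain B where B: "\<And>p. p \<in> XT \<delta> \<Longrightarrow> norm (h p) \<le> B" by (meson bounded_iff imageI)
  show ?thesis
    by (rule integrable_bounded_M[OF measurable_indicator_XT[OF assms], of "\<bar>B\<bar>"])
       (use B in \<open>force simp: indicator_def\<close>)
qed

definition strip :: "((real ^ 'n) \<times> real) set" where "strip = UNIV \<times> {0<..<t0}"

text \<open>Inserting \<open>P k\<close> for the momentum variable makes \<open>\<Psi>\<close> a C^1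
  function of (x, t), and the cutoff makes it admissible. In the limit the momentum behaves as if it
  had derivative \<open>force\<close> along (v, 1), although it is not assumed to be differentiable
  along the support.\<close>

lemma momentum_identity:
  fixes \<Psi> :: "((real ^ 'n) \<times> real) \<times> (real ^ 'n) \<Rightarrow> real"
  assumes \<Psi>: "C1_on (strip \<times> UNIV) \<Psi> \<Psi>'" and \<delta>: "\<delta> > 0"
  shows "(LINT p|M. indicator (XT (2 * \<delta>)) p *
      (plateau t0 (2 * \<delta>) (time p) * \<Psi>' (proj_base p, momentum p) (lift p, force p)
       + plateau_deriv t0 (2 * \<delta>) (time p) * \<Psi> (proj_base p, momentum p))) = 0"
proof -
  obtain P P' B where P: "\<And>k. C1_on UNIV (P k) (P' k)" and PB: "\<And>k z. norm (P k z :: real ^ 'n) \<le> B"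
    and Plim: "\<And>p. p \<in> X \<Longrightarrow> 0 < time p \<Longrightarrow> time p < t0 \<Longrightarrow> (\<lambda>k. P k (proj_base p)) \<longlonglongrightarrow> momentum p"
    and P'lim: "(\<lambda>k. LINT p|M. indicator (XT (2 * \<delta>)) p * norm (P' k (proj_base p) (lift p) - force p)) \<longlonglongrightarrow> 0"
    by (rule momentum_approx[OF \<delta>]) (rule that, assumption+)
  define \<kappa> where "\<kappa> = plateau t0 (2 * \<delta>)"
  define \<kappa>' where "\<kappa>' = plateau_deriv t0 (2 * \<delta>)"
  let ?Y = "XT (2 * \<delta>)"
  define Kz where "Kz = (UNIV :: (real^'n) set) \<times> {2 * \<delta>..t0 - 2 * \<delta>}"
  have d2: "2 * \<delta> > 0" using \<delta> by simp
  have strip: "open strip" by (auto simp: strip_def intro!: open_Times)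
  have Kz: "closed Kz" "Kz \<subseteq> strip" using \<delta> by (auto simp: Kz_def strip_def intro!: closed_Times)
  have Y: "p \<in> ?Y \<longleftrightarrow> p \<in> X \<and> proj_base p \<in> Kz" for p by (auto simp: XT_def Kz_def proj_base_eq)
  have chi: "C1_on A (\<lambda>z :: (real^'n) \<times> real. \<kappa> (snd z)) (\<lambda>z e. \<kappa>' (snd z) * snd e)" for A
    unfolding \<kappa>_def \<kappa>'_def
    by (rule C1_on_compose[OF plateau_C1[of UNIV] C1_on_bounded_linear[OF bounded_linear_snd]]) auto
  define g' where "g' k z e = \<kappa> (snd z) * \<Psi>' (z, P k z) (e, P' k z e) + \<kappa>' (snd z) * snd e * \<Psi> (z, P k z)" for k z e
  have clos: "(LINT p|M. indicator ?Y p * g' k (proj_base p) (lift p)) = 0" for k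
  proof -
    have inner: "C1_on strip (\<lambda>z. (z, P k z)) (\<lambda>z e. (e, P' k z e))"
      by (intro C1_on_Pair C1_on_bounded_linear bounded_linear_ident C1_on_subset[OF P]) auto
    have g: "C1_on strip (\<lambda>z. \<kappa> (snd z) * \<Psi> (z, P k z)) (g' k)"
      unfolding g'_def[abs_def] by (intro C1_on_mult chi C1_on_compose[OF \<Psi> inner]) auto
    have out: "\<kappa> t = 0" if "t \<le> 2 * \<delta> \<or> t \<ge> t0 - 2 * \<delta>" for t
      unfolding \<kappa>_def using plateau_outside[OF d2 that] by simp
    have ext: "C1_on UNIV (\<lambda>z. if z \<in> strip then \<kappa> (snd z) * \<Psi> (z, P k z) else 0) (\<lambda>z e. if z \<in> Kz then g' k z e else 0)"
      by (rule C1_on_extend_zero[OF g strip Kz]) (use out in \<open>force simp: Kz_def\<close>)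
    have "(LINT p|M. (if proj_base p \<in> Kz then g' k (proj_base p) (lift p) else 0)) = 0"
      by (rule closed_C1[OF ext d2]) (use out in auto)
    moreover have "(LINT p|M. (if proj_base p \<in> Kz then g' k (proj_base p) (lift p) else 0))
       = (LINT p|M. indicator ?Y p * g' k (proj_base p) (lift p))"
      by (rule Bochner_Integration.integral_cong[OF refl]) (auto simp: Y indicator_def)
    ultimately show ?thesis by simp
  qed
  define A where "A q p = indicator ?Y p * (\<kappa> (time p) * \<Psi>' (proj_base p, q) (lift p, force p) + \<kappa>' (time p) * \<Psi> (proj_base p, q))" for p q
  define KK where "KK = proj_base ` ?Y \<times> (cball 0 B :: (real^'n) set)"
  have KK: "compact KK" "KK \<subseteq> strip \<times> UNIV"
    using Kz Y by (auto simp: KK_def intro!: compact_Times compact_continuous_image continuous_on_proj_base compact_XT)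
  obtain B1 where B1: "B1 \<ge> 0" "\<And>z e. z \<in> KK \<Longrightarrow> norm (\<Psi>' z e) \<le> B1 * norm e"
    using C1_on_deriv_bound[OF \<Psi> KK] by blast
  have "compact (\<Psi> ` KK)" by (intro compact_continuous_image KK(1) continuous_on_subset[OF C1_on_continuous_on[OF \<Psi>] KK(2)])
  then obtain B2 where B2: "\<And>z. z \<in> KK \<Longrightarrow> norm (\<Psi> z) \<le> B2"
    by (meson bounded_iff compact_imp_bounded imageI)
  have fc: "continuous_on X force" by (rule continuous_on_subset[OF force_cont X_S])
  have lfc: "continuous_on X (\<lambda>p. (lift p, force p))" by (intro continuous_intros fc)
  obtain B3 where B3: "\<And>p. p \<in> X \<Longrightarrow> norm (lift p, force p) \<le> B3" using lfc by (rule continuous_bounded_X) blast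
  have tc: "continuous_on X time" by (intro continuous_intros)
  have \<kappa>C: "continuous_on UNIV \<kappa>" "continuous_on UNIV \<kappa>'"
    using C1_on_continuous_on[OF plateau_C1] C1_onD(2)[OF plateau_C1, of UNIV t0 "2 * \<delta>" 1] by (auto simp: \<kappa>_def \<kappa>'_def)
  have \<kappa>c: "continuous_on X (\<lambda>p. \<kappa> (time p))" "continuous_on X (\<lambda>p. \<kappa>' (time p))"
    by (rule continuous_on_compose2[OF \<kappa>C(1) tc], simp, rule continuous_on_compose2[OF \<kappa>C(2) tc], simp)
  obtain B4 where B4: "\<And>p. p \<in> X \<Longrightarrow> norm (\<kappa>' (time p)) \<le> B4" using \<kappa>c(2) by (rule continuous_bounded_X) blast
  have \<kappa>r: "\<bar>\<kappa> t\<bar> \<le> 1" for t using plateau_range by (simp add: \<kappa>_def)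
  have inKK: "(proj_base p, P k (proj_base p)) \<in> KK" if "p \<in> ?Y" for p k
    using that PB by (simp add: KK_def)
  have Yt: "p \<in> X" "0 < time p" "time p < t0" if "p \<in> ?Y" for p using that \<delta> by (auto simp: XT_def)
  have YX: "?Y \<subseteq> X" by (auto simp: XT_def)
  have Pc: "continuous_on ?Y (\<lambda>p. (proj_base p, P k (proj_base p)))" for k
    by (intro continuous_intros continuous_on_proj_base continuous_on_compose2[OF C1_on_continuous_on[OF P] continuous_on_proj_base]) auto
  have PS: "(proj_base p, P k (proj_base p)) \<in> strip \<times> UNIV" if "p \<in> ?Y" for p k using inKK[OF that] KK by auto
  have cA: "continuous_on ?Y (\<lambda>p. \<kappa> (time p) * \<Psi>' (proj_base p, P k (proj_base p)) (lift p, force p) + \<kappa>' (time p) * \<Psi> (proj_base p, P k (proj_base p)))" for k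
    by (intro continuous_intros C1_on_continuous_deriv[OF \<Psi> Pc PS] continuous_on_subset[OF lfc YX] continuous_on_subset[OF \<kappa>c(1) YX]
        continuous_on_subset[OF \<kappa>c(2) YX] continuous_on_compose2[OF C1_on_continuous_on[OF \<Psi>] Pc]) (use PS in auto)
  \<comment> \<open>With the derivative of \<open>P k\<close> already replaced by
    \<open>force\<close>, bounded pointwise convergence of \<open>P k\<close> suffices.\<close>
  have Alim: "(\<lambda>k. LINT p|M. A (P k (proj_base p)) p) \<longlonglongrightarrow> (LINT p|M. A (momentum p) p)"
  proof (rule dominated_M[where B="\<bar>B1 * B3 + B4 * B2\<bar>"])
    show "(\<lambda>p. A (P k (proj_base p)) p) \<in> borel_measurable M" for k unfolding A_def by (rule measurable_indicator_XT[OF cA])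
    fix p assume p: "p \<in> X"
    show "\<bar>A (P k (proj_base p)) p\<bar> \<le> \<bar>B1 * B3 + B4 * B2\<bar>" for k
    proof (cases "p \<in> ?Y")
      case True
      have "\<bar>\<kappa> (time p) * \<Psi>' (proj_base p, P k (proj_base p)) (lift p, force p)\<bar> \<le> 1 * (B1 * B3)"
        unfolding abs_mult using \<kappa>r B1(2)[OF inKK[OF True, of k], of "(lift p, force p)"] mult_left_mono[OF B3[OF p] B1(1)]
        by (intro mult_mono) auto
      moreover have "\<bar>\<kappa>' (time p) * \<Psi> (proj_base p, P k (proj_base p))\<bar> \<le> B4 * B2"
        unfolding abs_mult using B4[OF p] B2[OF inKK[OF True, of k]] by (intro mult_mono) auto
      ultimately show ?thesis using True by (simp add: A_def)
    qed (simp add: A_def)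
    show "(\<lambda>k. A (P k (proj_base p)) p) \<longlonglongrightarrow> A (momentum p) p"
    proof (cases "p \<in> ?Y")
      case True
      then have st: "proj_base p \<in> strip" using Y Kz by blast
      have l: "(\<lambda>k. (proj_base p, P k (proj_base p))) \<longlonglongrightarrow> (proj_base p, momentum p)"
        by (intro tendsto_intros Plim Yt True)
      have "(\<lambda>k. \<Psi>' (proj_base p, P k (proj_base p)) (lift p, force p)) \<longlonglongrightarrow> \<Psi>' (proj_base p, momentum p) (lift p, force p)"
        by (rule continuous_on_tendsto_compose[OF C1_onD(2)[OF \<Psi>] l]) (use st in auto)
      moreover have "(\<lambda>k. \<Psi> (proj_base p, P k (proj_base p))) \<longlonglongrightarrow> \<Psi> (proj_base p, momentum p)"
        by (rule continuous_on_tendsto_compose[OF C1_on_continuous_on[OF \<Psi>] l]) (use st in auto)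
      ultimately show ?thesis unfolding A_def by (intro tendsto_intros)
    qed (simp add: A_def)
  qed
  \<comment> \<open>The replacement of the derivative of \<open>P k\<close> by \<open>force\<close>
    enters linearly, through a bounded factor, so its cost is the L^1 distance of the two.\<close>
  have rest: "(\<lambda>k. LINT p|M. A (P k (proj_base p)) p) \<longlonglongrightarrow> 0"
  proof (rule Lim_null_comparison[OF always_eventually], rule allI)
    fix k
    have P'c: "continuous_on X (\<lambda>p. P' k (proj_base p) (lift p))"
      by (intro C1_on_continuous_deriv[OF P continuous_on_proj_base] continuous_intros) auto
    have Ai: "integrable M (\<lambda>p. A (P k (proj_base p)) p)" unfolding A_def by (rule integrable_indicator_XT[OF cA])
    have Pi: "integrable M (\<lambda>p. indicator ?Y p * norm (P' k (proj_base p) (lift p) - force p))"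
      by (intro integrable_XT integrable_M continuous_intros P'c fc)
    have key: "\<bar>indicator ?Y p * g' k (proj_base p) (lift p) - A (P k (proj_base p)) p\<bar> \<le> B1 * (indicator ?Y p * norm (P' k (proj_base p) (lift p) - force p))" for p
    proof (cases "p \<in> ?Y")
      case True
      let ?q = "(proj_base p, P k (proj_base p))" and ?w = "P' k (proj_base p) (lift p) - force p"
      have lin: "linear (\<Psi>' ?q)" using C1_on_linear[OF \<Psi> PS[OF True]] bounded_linear.linear by blast
      have "\<Psi>' ?q (lift p, P' k (proj_base p) (lift p)) = \<Psi>' ?q (lift p, force p) + \<Psi>' ?q (0, ?w)"
        using linear_add[OF lin, of "(lift p, force p)" "(0, ?w)"] by simp
      then have "indicator ?Y p * g' k (proj_base p) (lift p) - A (P k (proj_base p)) p = \<kappa> (time p) * \<Psi>' ?q (0, ?w)"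
        using True by (simp add: g'_def A_def proj_base_eq algebra_simps)
      also have "\<bar>\<dots>\<bar> \<le> 1 * (B1 * norm ?w)"
        unfolding abs_mult using \<kappa>r B1(2)[OF inKK[OF True, of k], of "(0, ?w)"] by (intro mult_mono) (auto simp: norm_Pair)
      finally show ?thesis using True by simp
    qed (simp add: A_def)
    have gi: "integrable M (\<lambda>p. indicator ?Y p * g' k (proj_base p) (lift p))"
    proof (rule integrable_indicator_XT)
      have "continuous_on ?Y (\<lambda>p. (lift p, P' k (proj_base p) (lift p)))"
        by (intro continuous_intros continuous_on_subset[OF P'c YX])
      then have "continuous_on ?Y (\<lambda>p. \<kappa> (time p) * \<Psi>' (proj_base p, P k (proj_base p)) (lift p, P' k (proj_base p) (lift p)) + \<kappa>' (time p) * \<Psi> (proj_base p, P k (proj_base p)))"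
        by (intro continuous_intros C1_on_continuous_deriv[OF \<Psi> Pc PS] continuous_on_subset[OF \<kappa>c(1) YX]
            continuous_on_subset[OF \<kappa>c(2) YX] continuous_on_compose2[OF C1_on_continuous_on[OF \<Psi>] Pc]) (use PS continuous_on_subset[OF P'c YX] in auto)
      then show "continuous_on ?Y (\<lambda>p. g' k (proj_base p) (lift p))" by (simp add: g'_def proj_base_eq)
    qed
    have "\<bar>LINT p|M. A (P k (proj_base p)) p\<bar> = \<bar>LINT p|M. indicator ?Y p * g' k (proj_base p) (lift p) - A (P k (proj_base p)) p\<bar>"
      using gi Ai clos[of k] by simp
    also have "\<dots> \<le> (LINT p|M. B1 * (indicator ?Y p * norm (P' k (proj_base p) (lift p) - force p)))"
      by (rule order_trans[OF integral_abs_bound integral_mono]) (use gi Ai Pi key in auto)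
    finally show "norm (LINT p|M. A (P k (proj_base p)) p) \<le> B1 * (LINT p|M. indicator ?Y p * norm (P' k (proj_base p) (lift p) - force p))"
      by simp
  next
    show "(\<lambda>k. B1 * (LINT p|M. indicator ?Y p * norm (P' k (proj_base p) (lift p) - force p))) \<longlonglongrightarrow> 0"
      by (rule tendsto_mult_right_zero[OF P'lim])
  qed
  have "(LINT p|M. A (momentum p) p) = 0" using LIMSEQ_unique[OF Alim rest] .
  then show ?thesis by (simp add: A_def \<kappa>_def \<kappa>'_def)
qed

end

section \<open>The fiber Hessian\<close>

lemma mixed_difference:
  fixes f :: "'a::euclidean_space \<Rightarrow> real"
  assumes f: "C1_on S f f'" and fa: "C1_on S (\<lambda>z. f' z a) fa'" and h: "h > 0"
    and rect: "\<And>s t. 0 \<le> s \<Longrightarrow> s \<le> h \<Longrightarrow> 0 \<le> t \<Longrightarrow> t \<le> h \<Longrightarrow> z + s *\<^sub>R a + t *\<^sub>R b \<in> S"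
  obtains s t where "0 < s" "s < h" "0 < t" "t < h"
    "f (z + h *\<^sub>R a + h *\<^sub>R b) - f (z + h *\<^sub>R a) - f (z + h *\<^sub>R b) + f z = h * (h * fa' (z + s *\<^sub>R a + t *\<^sub>R b) b)"
proof -
  define S2 where "S2 = {w \<in> S. w + h *\<^sub>R b \<in> S}"
  have "C1_on S2 (\<lambda>w. w + h *\<^sub>R b) (\<lambda>w e. e + 0)"
    by (intro C1_on_add C1_on_bounded_linear bounded_linear_ident C1_on_const)
  then have g: "C1_on S2 (\<lambda>w. f (w + h *\<^sub>R b) - f w) (\<lambda>w e. f' (w + h *\<^sub>R b) (e + 0) - f' w e)"
    by (intro C1_on_diff C1_on_compose[OF f] C1_on_subset[OF f]) (auto simp: S2_def)
  obtain s where s: "0 < s" "s < h"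
    "(f (z + h *\<^sub>R a + h *\<^sub>R b) - f (z + h *\<^sub>R a)) - (f (z + h *\<^sub>R b) - f z) = h * (f' (z + s *\<^sub>R a + h *\<^sub>R b) (a + 0) - f' (z + s *\<^sub>R a) a)"
  proof (rule C1_on_MVT[OF g h, of z a])
    fix s assume "0 \<le> s" "s \<le> h"
    then show "z + s *\<^sub>R a \<in> S2" using rect[of s 0] rect[of s h] h by (simp add: S2_def)
  qed blast
  obtain t where t: "0 < t" "t < h"
    "f' (z + s *\<^sub>R a + h *\<^sub>R b) a - f' (z + s *\<^sub>R a) a = h * fa' (z + s *\<^sub>R a + t *\<^sub>R b) b"
    by (rule C1_on_MVT[OF fa h, of "z + s *\<^sub>R a" b]) (use rect s in auto)
  show thesis by (rule that[OF s(1,2) t(1,2)]) (use s(3) t(3) in simp)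
qed

text \<open>One second difference over a parallelogram with sides h a and h b is h^2 times either
  mixed derivative, taken at two points of the parallelogram; continuity brings both values to
  \<open>z\<close>.\<close>

lemma second_derivative_symmetric:
  fixes f :: "'a::euclidean_space \<Rightarrow> real"
  assumes S: "open S" "z \<in> S" and f: "C1_on S f f'"
    and fa: "C1_on S (\<lambda>z. f' z a) fa'" and fb: "C1_on S (\<lambda>z. f' z b) fb'"
  shows "fa' z b = fb' z a"
proof (rule ccontr)
  assume ne: "fa' z b \<noteq> fb' z a"
  define \<epsilon> where "\<epsilon> = \<bar>fa' z b - fb' z a\<bar> / 2"
  have \<epsilon>: "\<epsilon> > 0" using ne by (simp add: \<epsilon>_def)
  have "\<forall>\<^sub>F w in at z. dist (fa' w b) (fa' z b) < \<epsilon> \<and> dist (fb' w a) (fb' z a) < \<epsilon> \<and> w \<in> S"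
  proof (intro eventually_conj)
    have "isCont (\<lambda>w. fa' w b) z" "isCont (\<lambda>w. fb' w a) z"
      using C1_onD(2)[OF fa] C1_onD(2)[OF fb] S by (auto simp: continuous_on_eq_continuous_at)
    then show "\<forall>\<^sub>F w in at z. dist (fa' w b) (fa' z b) < \<epsilon>" "\<forall>\<^sub>F w in at z. dist (fb' w a) (fb' z a) < \<epsilon>"
      using \<epsilon> by (auto simp: isCont_def tendsto_iff)
    show "\<forall>\<^sub>F w in at z. w \<in> S" using S by (simp add: eventually_at_in_open')
  qed
  then obtain d where d: "d > 0" "\<And>w. w \<noteq> z \<Longrightarrow> dist w z < d \<Longrightarrow> dist (fa' w b) (fa' z b) < \<epsilon> \<and> dist (fb' w a) (fb' z a) < \<epsilon> \<and> w \<in> S"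
    unfolding eventually_at by blast
  have near: "dist (fa' w b) (fa' z b) < \<epsilon>" "dist (fb' w a) (fb' z a) < \<epsilon>" "w \<in> S" if "dist w z < d" for w
    using d(2)[of w] that S \<epsilon> by (cases "w = z"; simp)+
  define h where "h = d / (2 * (norm a + norm b + 1))"
  have h: "h > 0" using d by (simp add: h_def add_nonneg_pos)
  have in_d: "dist (z + s *\<^sub>R a + t *\<^sub>R b) z < d" if "0 \<le> s" "s \<le> h" "0 \<le> t" "t \<le> h" for s t
  proof -
    have "dist (z + s *\<^sub>R a + t *\<^sub>R b) z \<le> s * norm a + t * norm b"
      using that norm_triangle_ineq[of "s *\<^sub>R a" "t *\<^sub>R b"] by (simp add: dist_norm add.assoc)
    also have "\<dots> \<le> h * norm a + h * norm b" using that by (intro add_mono mult_right_mono) auto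
    also have "\<dots> \<le> h * (norm a + norm b + 1)" using h by (simp add: algebra_simps)
    also have "\<dots> = d / 2"
    proof -
      have g: "d / (2 * x) * x = d / 2" if "x > 0" for x :: real using that by simp
      have "norm a + norm b + 1 > 0" by (simp add: add_nonneg_pos)
      then show ?thesis unfolding h_def by (rule g)
    qed
    also have "\<dots> < d" using d by simp
    finally show ?thesis .
  qed
  have in_d': "dist (z + s *\<^sub>R b + t *\<^sub>R a) z < d" if "0 \<le> s" "s \<le> h" "0 \<le> t" "t \<le> h" for s t
    using in_d[OF that(3,4,1,2)] by (simp add: add_ac)
  obtain s t where st: "0 < s" "s < h" "0 < t" "t < h"
    "f (z + h *\<^sub>R a + h *\<^sub>R b) - f (z + h *\<^sub>R a) - f (z + h *\<^sub>R b) + f z = h * (h * fa' (z + s *\<^sub>R a + t *\<^sub>R b) b)"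
    by (rule mixed_difference[OF f fa h]) (use in_d near in auto)
  obtain s' t' where st': "0 < s'" "s' < h" "0 < t'" "t' < h"
    "f (z + h *\<^sub>R b + h *\<^sub>R a) - f (z + h *\<^sub>R b) - f (z + h *\<^sub>R a) + f z = h * (h * fb' (z + s' *\<^sub>R b + t' *\<^sub>R a) a)"
    by (rule mixed_difference[OF f fb h]) (use in_d' near in auto)
  have "h * (h * fa' (z + s *\<^sub>R a + t *\<^sub>R b) b) = h * (h * fb' (z + s' *\<^sub>R b + t' *\<^sub>R a) a)"
    unfolding st(5)[symmetric] st'(5)[symmetric] by (simp add: algebra_simps)
  then have eq: "fa' (z + s *\<^sub>R a + t *\<^sub>R b) b = fb' (z + s' *\<^sub>R b + t' *\<^sub>R a) a" using h by simp
  have "dist (fa' (z + s *\<^sub>R a + t *\<^sub>R b) b) (fa' z b) < \<epsilon>" using near(1)[OF in_d[of s t]] st by simp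
  moreover have "dist (fb' (z + s' *\<^sub>R b + t' *\<^sub>R a) a) (fb' z a) < \<epsilon>" using near(2)[OF in_d'[of s' t']] st' by simp
  ultimately have "\<bar>fa' z b - fb' z a\<bar> < 2 * \<epsilon>" unfolding eq dist_real_def by linarith
  then show False by (simp add: \<epsilon>_def)
qed

section \<open>Perturbed contractions and positive definiteness\<close>

lemma contraction_bounded:
  fixes a b :: "nat \<Rightarrow> real"
  assumes q: "0 \<le> q" "q < 1" and step: "\<And>m. a (Suc m) \<le> q * a m + b m" and b: "\<And>m. b m \<le> B" and B: "0 \<le> B"
    and a0: "a 0 \<le> a00" "0 \<le> a00"
  shows "a m \<le> a00 + B / (1 - q)"
proof (induction m)
  case 0
  have "0 \<le> B / (1 - q)" using q B by simp
  then show ?case using a0 by linarith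
next
  case (Suc m)
  have "a (Suc m) \<le> q * (a00 + B / (1 - q)) + B" using step[of m] b[of m] mult_left_mono[OF Suc q(1)] by linarith
  also have "\<dots> = q * a00 + B / (1 - q)" using q by (simp add: field_simps)
  also have "\<dots> \<le> a00 + B / (1 - q)" using q a0(2) by (simp add: mult_left_le_one_le)
  finally show ?case .
qed

text \<open>Intended for the derivative error \<open>a\<close> of the iteration, with
  \<open>b\<close> the residual of the limit equation at the current iterate. Once \<open>b\<close>
  is below \<open>(1 - q) * \<epsilon> / 2\<close>, the bound
  \<open>q ^ k * a N + \<epsilon> / 2\<close> reproduces itself.\<close>

lemma contraction_tendsto:
  fixes a b :: "nat \<Rightarrow> real"
  assumes q: "0 \<le> q" "q < 1" and step: "\<And>m. a (Suc m) \<le> q * a m + b m" and b: "b \<longlonglongrightarrow> 0"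
    and a: "\<And>m. 0 \<le> a m"
  shows "a \<longlonglongrightarrow> 0"
proof (rule LIMSEQ_I)
  fix \<epsilon> :: real assume \<epsilon>: "\<epsilon> > 0"
  have "(1 - q) * \<epsilon> / 2 > 0" using q \<epsilon> by simp
  from LIMSEQ_D[OF b this] obtain N where N: "\<And>m. m \<ge> N \<Longrightarrow> b m < (1 - q) * \<epsilon> / 2"
    by (metis abs_less_iff diff_zero real_norm_def)
  have ak: "a (N + k) \<le> q ^ k * a N + \<epsilon> / 2" for k
  proof (induction k)
    case (Suc k)
    have "a (N + Suc k) \<le> q * a (N + k) + (1 - q) * \<epsilon> / 2" using step[of "N + k"] N[of "N + k"] by simp
    also have "\<dots> \<le> q * (q ^ k * a N + \<epsilon> / 2) + (1 - q) * \<epsilon> / 2" using Suc q by (intro add_right_mono mult_left_mono)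
    also have "\<dots> = q ^ Suc k * a N + \<epsilon> / 2" by (simp add: field_simps)
    finally show ?case .
  qed (use \<epsilon> in simp)
  have "(\<lambda>k. q ^ k * a N) \<longlonglongrightarrow> 0 * a N" using q by (intro tendsto_intros LIMSEQ_realpow_zero) auto
  then have "\<forall>\<^sub>F k in sequentially. q ^ k * a N < \<epsilon> / 2" using \<epsilon> by (intro order_tendstoD(2)[of _ 0]) auto
  then obtain k0 where k0: "\<And>k. k \<ge> k0 \<Longrightarrow> q ^ k * a N < \<epsilon> / 2" by (auto simp: eventually_sequentially)
  show "\<exists>no. \<forall>m\<ge>no. norm (a m - 0) < \<epsilon>"
  proof (intro exI[of _ "N + k0"] allI impI)
    fix m assume "m \<ge> N + k0"
    then obtain k where k: "m = N + k" "k \<ge> k0" by (metis add.assoc add_leD1 le_Suc_ex le_add1)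
    then show "norm (a m - 0) < \<epsilon>" using ak[of k] k0[of k] a[of m] by simp
  qed
qed

text \<open>A null vector of a semidefinite form lies in the kernel of its matrix: otherwise the
  form becomes negative slightly off \<open>z\<close> along some \<open>w\<close>.\<close>

lemma symmetric_psd_invertible_pos:
  fixes A :: "real ^ 'n ^ 'n"
  assumes sym: "\<And>x y. x \<bullet> (A *v y) = y \<bullet> (A *v x)" and psd: "\<And>x. x \<bullet> (A *v x) \<ge> 0"
    and inv: "invertible A" and z: "z \<noteq> 0"
  shows "z \<bullet> (A *v z) > 0"
proof (rule ccontr)
  assume "\<not> z \<bullet> (A *v z) > 0"
  then have z0: "z \<bullet> (A *v z) = 0" using psd[of z] by simp
  have "w \<bullet> (A *v z) = 0" for w
  proof (rule ccontr)
    assume ne: "w \<bullet> (A *v z) \<noteq> 0"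
    define k where "k = w \<bullet> (A *v z)"
    define m where "m = w \<bullet> (A *v w)"
    have "0 \<le> (z + s *\<^sub>R w) \<bullet> (A *v (z + s *\<^sub>R w))" for s by (rule psd)
    moreover have "(z + s *\<^sub>R w) \<bullet> (A *v (z + s *\<^sub>R w)) = 2 * s * k + s\<^sup>2 * m" for s
      using z0 sym[of z w] by (simp add: matrix_vector_right_distrib vec.scale inner_add_left inner_add_right k_def m_def
          power2_eq_square algebra_simps matrix_vector_mult_scaleR)
    ultimately have *: "0 \<le> 2 * s * k + s\<^sup>2 * m" for s by simp
    have m0: "m \<ge> 0" using psd by (simp add: m_def)
    \<comment> \<open>The minimizer over \<open>s\<close> would be \<open>- k / m\<close>; replacing
      \<open>m\<close> by \<open>m + 1\<close> covers the case \<open>m = 0\<close> and still gives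
      a negative value.\<close>
    have "0 \<le> 2 * (- k / (m + 1)) * k + (- k / (m + 1))\<^sup>2 * m" by (rule *)
    also have "\<dots> = (k\<^sup>2 / (m + 1)\<^sup>2) * (m - 2 * (m + 1))"
    proof -
      have g: "2 * (- k / n) * k + (- k / n)\<^sup>2 * m = (k\<^sup>2 / n\<^sup>2) * (m - 2 * n)" if "n > 0" for n
        using that by (simp add: field_simps power2_eq_square)
      show ?thesis by (rule g) (use m0 in simp)
    qed
    also have "\<dots> < 0" using m0 ne by (intro mult_pos_neg) (auto simp: k_def)
    finally show False by simp
  qed
  from this[of "A *v z"] have "A *v z = 0" by simp
  moreover obtain B where "B ** A = mat 1" using inv by (auto simp: invertible_def)
  ultimately have "z = 0" by (metis matrix_vector_mul_assoc matrix_vector_mul_lid matrix_vector_mult_0_right)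
  then show False using z by simp
qed

locale el_minimizer = minimizer U t0 \<mu> L c f
  for U :: "(real ^ 'n::finite) set" and t0 \<mu> L c f +
  assumes inv: "\<And>p. p \<in> X \<Longrightarrow> invertible (Lvv t0 L p)"
    and uniq: "\<And>x t. (x, t) \<in> proj_base ` X \<Longrightarrow> \<exists>!v. L (x, v, t) + c = total_deriv UNIV t0 f (x, v, t)"
begin

definition momentum' :: "'n phase \<Rightarrow> 'n phase \<Rightarrow> real ^ 'n" where
  "momentum' p e = (\<chi> i. dir_deriv S e (dir_deriv S (unit_v i) L) p)"

lemma momentum_C1: "C1_on \<Omega> momentum momentum'"
  unfolding momentum_def[abs_def] momentum'_def[abs_def] by (rule C1_on_vec_lambda[OF DL_C1[OF unit_Basis(2)]])

lemma momentum'_linear: "p \<in> S \<Longrightarrow> linear (momentum' p)"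
proof -
  assume "p \<in> S"
  then have "linear (\<lambda>e. dir_deriv S e (dir_deriv S (unit_v i) L) p)" for i
    using L1 unit_Basis by (auto simp: dir_deriv_def[of S _ "dir_deriv S (unit_v i) L"] differentiable_on_def intro!: linear_frechet_derivative)
  then show ?thesis
    unfolding momentum'_def by (auto simp: linear_iff vec_eq_iff)
qed

lemma momentum'_cont: "continuous_on S (\<lambda>p. momentum' p (k p))" if "continuous_on S k"
proof -
  have "dir_deriv S (unit_v i) L differentiable_on S" for i using L1 unit_Basis by blast
  then show ?thesis unfolding momentum'_def
    by (intro continuous_on_vec_lambda dir_deriv_continuous[OF _ L2c[OF unit_Basis(2)]] continuous_intros that) auto
qed

lemma vec_expand: "(w :: real ^ 'n) = (\<Sum>k\<in>UNIV. w $ k *\<^sub>R axis k 1)"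
  using basis_expansion[of w] by (simp add: scalar_mult_eq_scaleR)

lemma phase_expand_v: "(0, w, 0) = (\<Sum>k\<in>UNIV. w $ k *\<^sub>R (unit_v k :: 'n phase))"
  using vec_expand[of w] by (simp add: unit_v_def prod_eq_iff fst_sum snd_sum)

lemma phase_expand_x: "(w, 0, 1) = (\<Sum>k\<in>UNIV. w $ k *\<^sub>R (unit_x k :: 'n phase)) + unit_t"
  using vec_expand[of w] by (simp add: unit_x_def unit_t_def prod_eq_iff fst_sum snd_sum)

lemma momentum'_Lvv: "p \<in> S \<Longrightarrow> momentum' p (0, w, 0) = Lvv t0 L p *v w"
  unfolding phase_expand_v
  by (simp add: linear_sum[OF momentum'_linear] linear_scale[OF momentum'_linear])
     (simp add: vec_eq_iff momentum'_def Lvv_def matrix_vector_mult_def mult.commute)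

definition accel :: "'n phase \<Rightarrow> real ^ 'n" where "accel p = fst (snd (EL_field t0 L p))"

lemma EL_field_eq: "EL_field t0 L p = (fst (snd p), accel p, 1)"
  by (simp add: accel_def EL_field_def split_beta Let_def)

text \<open>\<open>EL_field\<close> contracts the first index of the inverse Hessian, so the
  equation takes row-vector form. \<open>matrix_inv\<close> is a genuine inverse because the Hessian
  is invertible on the support.\<close>

lemma accel_eq:
  assumes "p \<in> X"
  shows "accel p v* Lvv t0 L p = force p - momentum' p (fst (snd p), 0, 1)"
proof -
  let ?A = "Lvv t0 L p" and ?v = "fst (snd p)"
  define \<rho> where "\<rho> = force p - momentum' p (?v, 0, 1)"
  have pS: "p \<in> S" using assms X_S by blast
  have "momentum' p (?v, 0, 1) $ i = pd t0 unit_t (pd t0 (unit_v i) L) p + (\<Sum>j\<in>UNIV. ?v $ j * pd t0 (unit_x j) (pd t0 (unit_v i) L) p)" for i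
    unfolding phase_expand_x
    by (simp add: linear_add[OF momentum'_linear[OF pS]] linear_sum[OF momentum'_linear[OF pS]] linear_scale[OF momentum'_linear[OF pS]])
       (simp add: momentum'_def)
  then have "accel p = \<rho> v* matrix_inv ?A"
    by (simp add: accel_def EL_field_def split_beta Let_def \<rho>_def force_def vector_matrix_mult_def vec_eq_iff mult.commute diff_diff_eq)
  moreover have "matrix_inv ?A ** ?A = mat 1"
    using inv[OF assms] unfolding invertible_def matrix_inv_def by (rule someI2_ex) blast
  ultimately show ?thesis by (simp add: vector_matrix_mul_assoc \<rho>_def)
qed

lemma Lvv_symmetric: "p \<in> \<Omega> \<Longrightarrow> transpose (Lvv t0 L p) = Lvv t0 L p"
  using second_derivative_symmetric[OF open_\<Omega> _ L_C1 DL_C1[OF unit_Basis(2)] DL_C1[OF unit_Basis(2)]]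
  by (auto simp: transpose_def Lvv_def vec_eq_iff)

lemma \<Omega>_S: "\<Omega> \<subseteq> S" by (auto simp: \<Omega>_def phase_def)

text \<open>Symmetry of the Hessian turns the row-vector equation into the usual one: L_v has
  derivative L_x along the vector field.\<close>

lemma Euler_Lagrange:
  assumes p: "p \<in> X" "p \<in> \<Omega>"
  shows "momentum' p (fst (snd p), accel p, 1) = force p"
proof -
  have "(fst (snd p), accel p, 1::real) = (fst (snd p), 0, 1) + (0, accel p, 0)" by simp
  then have "momentum' p (fst (snd p), accel p, 1) = momentum' p (fst (snd p), 0, 1) + momentum' p (0, accel p, 0)"
    using linear_add[OF momentum'_linear[of p], of "(fst (snd p), 0, 1)" "(0, accel p, 0)"] p \<Omega>_S by auto
  also have "momentum' p (0, accel p, 0) = accel p v* transpose (Lvv t0 L p)"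
    using momentum'_Lvv[of p] p \<Omega>_S by auto
  also have "\<dots> = force p - momentum' p (fst (snd p), 0, 1)" by (simp add: Lvv_symmetric[OF p(2)] accel_eq[OF p(1)])
  finally show ?thesis by simp
qed

lemma DL_momentum:
  assumes "p \<in> \<Omega>"
  shows "DL p (0, w, 0) = w \<bullet> momentum p"
proof -
  define l where "l e = DL p e" for e
  have "linear l" unfolding l_def using C1_on_linear[OF L_C1 assms] by (rule bounded_linear.linear)
  then have "l (0, w, 0) = (\<Sum>i\<in>UNIV. w $ i * l (unit_v i))"
    unfolding phase_expand_v by (simp add: linear_sum linear_scale)
  then show ?thesis by (simp add: l_def momentum_def inner_vec_def)
qed

lemma fiber_momentum_derivative:
  assumes p: "(x, v, t) \<in> \<Omega>"
  shows "((\<lambda>s. momentum (x, v + s *\<^sub>R d, t)) has_derivative (\<lambda>h. h *\<^sub>R momentum' (x, v + s *\<^sub>R d, t) (0, d, 0))) (at s)"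
proof -
  have i: "((\<lambda>s. (x, v + s *\<^sub>R d, t)) has_derivative (\<lambda>s. (0, s *\<^sub>R d, 0))) (at s)"
    by (auto intro!: derivative_eq_intros)
  have o: "(x, v + s *\<^sub>R d, t) \<in> \<Omega>" using p by (simp add: \<Omega>_def)
  have "momentum' (x, v + s *\<^sub>R d, t) (0, h *\<^sub>R d, 0) = h *\<^sub>R momentum' (x, v + s *\<^sub>R d, t) (0, d, 0)" for h
    using linear_scale[OF bounded_linear.linear[OF C1_on_linear[OF momentum_C1 o]], of h "(0, d, 0)"] by simp
  with has_derivative_compose[OF i C1_onD(1)[OF momentum_C1 o]] show ?thesis by simp
qed

text \<open>On the support, \<open>L - df\<close> attains its minimum along the fiber.\<close>

lemma Lvv_psd:
  assumes p: "p \<in> X" "p \<in> \<Omega>"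
  shows "z \<bullet> (Lvv t0 L p *v z) \<ge> 0"
proof (rule ccontr)
  obtain x v t where pe: "p = (x, v, t)" by (cases p)
  have pX: "(x, v, t) \<in> X" "0 < t" "t < t0" and o: "(x, v, t) \<in> \<Omega>" using p by (auto simp: pe \<Omega>_def)
  assume "\<not> z \<bullet> (Lvv t0 L p *v z) \<ge> 0"
  then have neg: "z \<bullet> momentum' (x, v, t) (0, z, 0) < 0" using momentum'_Lvv[of p z] p \<Omega>_S by (auto simp: pe)
  define k where "k = fD (x, t) (z, 0)"
  define q where "q s = L (x, v + s *\<^sub>R z, t) - s * k" for s
  define q' where "q' s = z \<bullet> momentum (x, v + s *\<^sub>R z, t) - k" for s
  have dq: "(q has_real_derivative q' s) (at s)" for s
    unfolding q_def[abs_def] q'_def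
    using fiber_derivative[OF o, of z s] DL_momentum[of "(x, v + s *\<^sub>R z, t)" z] o
    by (auto intro!: derivative_eq_intros simp: \<Omega>_def)
  have "((\<lambda>s. z \<bullet> momentum (x, v + s *\<^sub>R z, t) - k) has_derivative (\<lambda>h. z \<bullet> (h *\<^sub>R momentum' (x, v + 0 *\<^sub>R z, t) (0, z, 0)) - 0)) (at 0)"
    by (intro has_derivative_diff has_derivative_const has_derivative_inner_right fiber_momentum_derivative o)
  then have dq': "(q' has_real_derivative z \<bullet> momentum' (x, v, t) (0, z, 0)) (at 0)"
    by (simp add: has_field_derivative_def q'_def[abs_def] mult.commute[of _ "z \<bullet> momentum' (x, v, t) (0, z, 0)"])
  have q'0: "q' 0 = 0"
    using momentum_eq[OF pX, of z] DL_momentum[OF o, of z] by (simp add: q'_def k_def)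
  obtain d where d: "d > 0" "\<And>h. 0 < h \<Longrightarrow> h < d \<Longrightarrow> q' h < 0"
    using DERIV_neg_dec_right[OF dq' neg] q'0 by auto
  have "\<exists>s. 0 < s \<and> s < d / 2 \<and> q (d / 2) - q 0 = (d / 2 - 0) * q' s"
    by (rule MVT2) (use d dq in auto)
  then obtain s where s: "0 < s" "s < d / 2" "q (d / 2) - q 0 = d / 2 * q' s" by auto
  have "q' s < 0" using d(2)[of s] s d(1) by simp
  then have "q (d / 2) < q 0" using s(3) d(1) by (smt (verit) half_gt_zero mult_pos_neg)
  moreover have "q 0 \<le> q (d / 2)"
  proof -
    have "bounded_linear (fD (x, t))" using fD(1)[OF pX(1)] pX has_derivative_bounded_linear by (auto simp: proj_base_def)
    then have "fD (x, t) ((d / 2) *\<^sub>R z, 0) = d / 2 * k"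
      using linear_scale[OF bounded_linear.linear, of "fD (x, t)" "d / 2" "(z, 0)"] by (simp add: k_def)
    then show ?thesis using fiber_gap[OF pX, of "(d / 2) *\<^sub>R z"] by (simp add: q_def)
  qed
  ultimately show False by simp
qed

lemma Lvv_pos:
  assumes p: "p \<in> X" "p \<in> \<Omega>" and z: "z \<noteq> 0"
  shows "z \<bullet> (Lvv t0 L p *v z) > 0"
proof (rule symmetric_psd_invertible_pos[OF _ Lvv_psd[OF p] inv[OF p(1)] z])
  fix x y :: "real ^ 'n"
  have "x \<bullet> (Lvv t0 L p *v y) = (x v* Lvv t0 L p) \<bullet> y" by (simp only: dot_lmul_matrix)
  also have "x v* Lvv t0 L p = Lvv t0 L p *v x"
    using vector_transpose_matrix[of x "Lvv t0 L p"] by (simp add: Lvv_symmetric[OF p(2)])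
  finally show "x \<bullet> (Lvv t0 L p *v y) = y \<bullet> (Lvv t0 L p *v x)" by (simp add: inner_commute)
qed

end

section \<open>Inverting the momentum\<close>

context el_minimizer
begin

text \<open>One gradient step has derivative I - \<tau> N in the velocity, where N is the Hessian. A
  positive lower bound for the quadratic form of N on the compact set \<open>XT \<delta>\<close> and
  an upper bound for its norm, both persisting nearby, make the step a contraction with uniform
  constants.\<close>

lemma contraction_constants:
  assumes \<delta>: "\<delta> > 0"
  obtains r \<tau> q Kc where "0 < r" "0 < \<tau>" "0 \<le> q" "q < 1" "compact Kc" "Kc \<subseteq> \<Omega>"
    "\<And>x v t w. (x, v, t) \<in> XT \<delta> \<Longrightarrow> norm (w - v) \<le> r \<Longrightarrow> (x, w, t) \<in> Kc"
    "\<And>x v t w z. (x, v, t) \<in> XT \<delta> \<Longrightarrow> norm (w - v) \<le> r \<Longrightarrow> norm (z - \<tau> *\<^sub>R momentum' (x, w, t) (0, z, 0)) \<le> q * norm z"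
proof (cases "XT \<delta> = {}")
  case True
  show thesis by (rule that[of 1 1 0 "{}"]) (simp_all add: True)
next
  case False
  define N where "N p z = momentum' p (0, z, 0)" for p z
  have Y\<Omega>: "XT \<delta> \<subseteq> \<Omega>" by (rule XT_\<Omega>[OF \<delta>])
  have linN: "linear (N p)" if "p \<in> \<Omega>" for p
  proof -
    have "linear (momentum' p)" using momentum'_linear \<Omega>_S that by blast
    moreover have "linear (\<lambda>z :: real ^ 'n. (0 :: real ^ 'n, z, 0 :: real))" by (auto simp: linear_iff)
    ultimately show ?thesis unfolding N_def using linear_compose[of "\<lambda>z. (0, z, 0)" "momentum' p"] by (simp add: o_def)
  qed
  let ?D = "XT \<delta> \<times> sphere (0 :: real ^ 'n) 1"
  have comp: "compact ?D" by (intro compact_Times compact_XT compact_sphere)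
  have cont: "continuous_on ?D (\<lambda>y. snd y \<bullet> N (fst y) (snd y))"
    unfolding N_def by (intro continuous_intros C1_on_continuous_deriv[OF momentum_C1]) (use Y\<Omega> in auto)
  have ne: "?D \<noteq> {}"
  proof -
    have "axis undefined 1 \<in> sphere (0 :: real ^ 'n) 1" by (simp add: norm_axis_1)
    then show ?thesis using False by blast
  qed
  obtain y0 where y0: "y0 \<in> ?D" "\<And>y. y \<in> ?D \<Longrightarrow> snd y0 \<bullet> N (fst y0) (snd y0) \<le> snd y \<bullet> N (fst y) (snd y)"
    using continuous_attains_inf[OF comp ne cont] by blast
  \<comment> \<open>Half of the minimum of the quadratic form on unit vectors: the other half may be
    lost when the velocity is moved by up to \<open>r\<close>.\<close>
  define \<nu> where "\<nu> = (snd y0 \<bullet> N (fst y0) (snd y0)) / 2"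
  have \<nu>: "\<nu> > 0"
  proof -
    have "fst y0 \<in> X" "fst y0 \<in> \<Omega>" "snd y0 \<noteq> 0" using y0(1) Y\<Omega> by (auto simp: XT_def)
    then show ?thesis using Lvv_pos[of "fst y0" "snd y0"] momentum'_Lvv[of "fst y0" "snd y0"] \<Omega>_S by (auto simp: \<nu>_def N_def)
  qed
  have low: "z \<bullet> N p z \<ge> 2 * \<nu> * (norm z)\<^sup>2" if p: "p \<in> XT \<delta>" for p z
  proof (cases "z = 0")
    case True
    then show ?thesis by simp
  next
    case False
    let ?u = "z /\<^sub>R norm z"
    have "(p, ?u) \<in> ?D" using p False by simp
    from y0(2)[OF this] have "2 * \<nu> \<le> ?u \<bullet> N p ?u" by (simp add: \<nu>_def)
    also have "\<dots> = (z \<bullet> N p z) / (norm z)\<^sup>2"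
      using linear_scale[OF linN, of p "inverse (norm z)" z] p Y\<Omega> by (auto simp: power2_eq_square divide_inverse)
    finally show ?thesis using False by (simp add: le_divide_eq)
  qed
  define Kc where "Kc = (\<lambda>y. fst y + (0, snd y, 0)) ` (XT \<delta> \<times> cball (0 :: real ^ 'n) 1)"
  have Kc: "compact Kc" "Kc \<subseteq> \<Omega>"
  proof -
    show "compact Kc" unfolding Kc_def
      by (intro compact_continuous_image compact_Times compact_XT compact_cball continuous_intros)
    show "Kc \<subseteq> \<Omega>" using Y\<Omega> by (force simp: Kc_def \<Omega>_def)
  qed
  have inK: "(x, w, t) \<in> Kc" if "(x, v, t) \<in> XT \<delta>" "norm (w - v) \<le> 1" for x v t w
    unfolding Kc_def by (rule image_eqI[of _ _ "((x, v, t), w - v)"]) (use that in auto)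
  obtain d where d: "d > 0" "\<And>p q e. p \<in> Kc \<Longrightarrow> q \<in> Kc \<Longrightarrow> dist p q < d \<Longrightarrow> norm (momentum' p e - momentum' q e) \<le> \<nu> * norm e"
    by (rule C1_on_uniform[OF momentum_C1 Kc \<nu>]) blast
  obtain \<Lambda>0 where \<Lambda>0: "\<Lambda>0 \<ge> 0" "\<And>p e. p \<in> Kc \<Longrightarrow> norm (momentum' p e) \<le> \<Lambda>0 * norm e"
    by (rule C1_on_deriv_bound[OF momentum_C1 Kc]) blast
  \<comment> \<open>The maximum with \<open>\<nu>\<close> ensures
    \<open>\<nu> / \<Lambda> \<le> 1\<close>, so that the square root defining \<open>q\<close> is
    real.\<close>
  define \<Lambda> where "\<Lambda> = max \<Lambda>0 \<nu>"
  have \<Lambda>: "\<Lambda> > 0" "\<nu> \<le> \<Lambda>" "\<Lambda>0 \<le> \<Lambda>" using \<nu> by (auto simp: \<Lambda>_def)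
  \<comment> \<open>This \<open>\<tau>\<close> minimizes \<open>1 - 2 * (\<tau> * \<nu>) +
    \<tau>\<^sup>2 * \<Lambda>\<^sup>2\<close>, the bound for the squared contraction factor, and
    \<open>q\<^sup>2\<close> is the minimum.\<close>
  define \<tau> where "\<tau> = \<nu> / \<Lambda>\<^sup>2"
  define q where "q = sqrt (1 - (\<nu> / \<Lambda>)\<^sup>2)"
  define r where "r = min 1 (d / 2)"
  have lL: "0 < (\<nu> / \<Lambda>)\<^sup>2" "(\<nu> / \<Lambda>)\<^sup>2 \<le> 1" using \<nu> \<Lambda> by (auto simp: power_le_one)
  show thesis
  proof (rule that[of r \<tau> q Kc])
    show "0 < r" "0 < \<tau>" "0 \<le> q" "q < 1" using d \<nu> \<Lambda> lL by (auto simp: r_def \<tau>_def q_def)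
    fix x v t w assume p: "(x, v, t) \<in> XT \<delta>" and w: "norm (w - v) \<le> r"
    then have w1: "norm (w - v) \<le> 1" "norm (w - v) < d" using d by (auto simp: r_def)
    show wK: "(x, w, t) \<in> Kc" by (rule inK[OF p w1(1)])
    have pK: "(x, v, t) \<in> Kc" by (rule inK[OF p]) simp
    fix z :: "real ^ 'n"
    have nz: "norm (0 :: real ^ 'n, z, 0 :: real) = norm z" by (simp add: norm_Pair)
    have "norm (N (x, w, t) z - N (x, v, t) z) \<le> \<nu> * norm z"
      using d(2)[OF wK pK, of "(0, z, 0)"] w1 unfolding N_def nz by (simp add: dist_Pair_Pair dist_norm)
    then have "\<bar>z \<bullet> (N (x, w, t) z - N (x, v, t) z)\<bar> \<le> norm z * (\<nu> * norm z)"
      using Cauchy_Schwarz_ineq2[of z "N (x, w, t) z - N (x, v, t) z"]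
      by (meson mult_left_mono norm_ge_zero order_trans)
    then have 1: "z \<bullet> N (x, w, t) z \<ge> \<nu> * (norm z)\<^sup>2"
      using low[OF p, of z] by (simp add: inner_diff_right power2_eq_square abs_le_iff algebra_simps)
    have "norm (N (x, w, t) z) \<le> \<Lambda> * norm z"
      using \<Lambda>0(2)[OF wK, of "(0, z, 0)"] mult_right_mono[OF \<Lambda>(3), of "norm z"] unfolding N_def nz by simp
    then have 2: "(norm (N (x, w, t) z))\<^sup>2 \<le> \<Lambda>\<^sup>2 * (norm z)\<^sup>2"
      using power_mono[of "norm (N (x, w, t) z)" "\<Lambda> * norm z" 2] by (simp add: power_mult_distrib)
    have \<tau>0: "\<tau> > 0" using \<nu> \<Lambda> by (simp add: \<tau>_def)
    have "(norm (z - \<tau> *\<^sub>R N (x, w, t) z))\<^sup>2 = (norm z)\<^sup>2 - 2 * \<tau> * (z \<bullet> N (x, w, t) z) + \<tau>\<^sup>2 * (norm (N (x, w, t) z))\<^sup>2"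
      unfolding power2_norm_eq_inner
      by (simp add: inner_diff_left inner_diff_right inner_commute power2_eq_square algebra_simps)
    also have "\<dots> \<le> (norm z)\<^sup>2 - 2 * \<tau> * (\<nu> * (norm z)\<^sup>2) + \<tau>\<^sup>2 * (\<Lambda>\<^sup>2 * (norm z)\<^sup>2)"
      using 1 2 \<tau>0 by (intro add_mono diff_mono mult_left_mono) auto
    also have "\<dots> = (1 - 2 * (\<tau> * \<nu>) + \<tau>\<^sup>2 * \<Lambda>\<^sup>2) * (norm z)\<^sup>2" by (simp add: algebra_simps)
    also have "1 - 2 * (\<tau> * \<nu>) + \<tau>\<^sup>2 * \<Lambda>\<^sup>2 = 1 - (\<nu> / \<Lambda>)\<^sup>2"
      using \<Lambda>(1) by (simp add: \<tau>_def field_simps power2_eq_square)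
    also have "\<dots> = q\<^sup>2" using lL by (simp add: q_def)
    finally have "(norm (z - \<tau> *\<^sub>R N (x, w, t) z))\<^sup>2 \<le> (q * norm z)\<^sup>2" by (simp add: power_mult_distrib)
    then show "norm (z - \<tau> *\<^sub>R momentum' (x, w, t) (0, z, 0)) \<le> q * norm z"
      unfolding N_def by (rule power2_le_imp_le) (use lL in \<open>simp add: q_def\<close>)
  qed (use Kc in auto)
qed

text \<open>Every support point is a contact point of the inequality on its fiber, and the contact
  point is unique by assumption; so the support is a graph.\<close>

lemma velocity_determined:
  assumes p: "(x, v, t) \<in> X" "(x, w, t) \<in> X"
  shows "v = w"
proof -
  have "(x, t) \<in> proj_base ` X" using p by (force simp: proj_base_def)
  moreover have "L (x, v, t) + c = total_deriv UNIV t0 f (x, v, t)" "L (x, w, t) + c = total_deriv UNIV t0 f (x, w, t)"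
    using min p by (auto simp: minimizable_by_def)
  ultimately show ?thesis using uniq by blast
qed

text \<open>The projection is injective on the compact support, hence has a continuous inverse, and
  the velocity is a continuous function on the projected support. Only values are approximated;
  nothing is claimed about the size of \<open>g'\<close>.\<close>

lemma velocity_approx:
  assumes "\<epsilon> > 0"
  obtains g g' where "C1_on UNIV (g :: (real ^ 'n) \<times> real \<Rightarrow> real ^ 'n) g'"
    "\<And>p. p \<in> X \<Longrightarrow> norm (g (proj_base p) - fst (snd p)) < \<epsilon>"
proof -
  have inj: "inj_on proj_base X"
    using velocity_determined by (auto simp: inj_on_def proj_base_def)
  define V where "V = (\<lambda>z. fst (snd (the_inv_into X proj_base z)))"
  have Vc: "continuous_on (proj_base ` X) V"
    unfolding V_def by (intro continuous_intros continuous_on_inv_into continuous_on_proj_base compact_X inj)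
  have PX: "compact (proj_base ` X)" by (intro compact_continuous_image continuous_on_proj_base compact_X)
  obtain g where g: "polynomial_function g" "\<And>z. z \<in> proj_base ` X \<Longrightarrow> norm (V z - g z) < \<epsilon>"
    using Stone_Weierstrass_polynomial_function[OF PX Vc assms] by blast
  have comp: "real_polynomial_function (\<lambda>z. g z $ i)" for i
    using g(1) bounded_linear_vec_nth[of i] unfolding polynomial_function_def o_def by blast
  have "\<exists>g'. C1_on UNIV (\<lambda>z. g z $ i) g'" for i
  proof -
    obtain d where d: "\<And>z. ((\<lambda>z. g z $ i) has_derivative d z) (at z)" "\<And>e. real_polynomial_function (\<lambda>z. d z e)"
      using real_polynomial_function_deriv[OF comp[of i]] by blast
    have "C1_on UNIV (\<lambda>z. g z $ i) d"
      by (intro C1_onI d(1) continuous_at_imp_continuous_on ballI continuous_real_polymonial_function d(2))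
    then show ?thesis by blast
  qed
  then obtain g' where "\<And>i. C1_on UNIV (\<lambda>z. g z $ i) (g' i)" by metis
  from C1_on_vec_lambda[of UNIV "\<lambda>i z. g z $ i" g', OF this] have "C1_on UNIV g (\<lambda>z e. \<chi> i. g' i z e)" by simp
  moreover have "norm (g (proj_base p) - fst (snd p)) < \<epsilon>" if "p \<in> X" for p
    using g(2)[of "proj_base p"] that by (simp add: V_def the_inv_into_f_f[OF inj that] norm_minus_commute)
  ultimately show thesis by (rule that)
qed

text \<open>\<open>descent g \<tau> m\<close> approximately inverts \<open>v \<mapsto> momentum (x, v, t)\<close> by gradient descent. It is
  globally defined and \<open>C\<^sup>1\<close>, and converges, together with its derivative, at the points of the
  support.\<close>

primrec descent :: "((real ^ 'n) \<times> real \<Rightarrow> real ^ 'n) \<Rightarrow> real \<Rightarrow> nat \<Rightarrow> ((real ^ 'n) \<times> real) \<times> (real ^ 'n) \<Rightarrow> real ^ 'n" where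
  "descent g \<tau> 0 y = g (fst y)"
| "descent g \<tau> (Suc m) y = descent g \<tau> m y + \<tau> *\<^sub>R (snd y - momentum (fst (fst y), descent g \<tau> m y, snd (fst y)))"

primrec descent' :: "((real ^ 'n) \<times> real \<Rightarrow> real ^ 'n) \<Rightarrow> ((real ^ 'n) \<times> real \<Rightarrow> (real ^ 'n) \<times> real \<Rightarrow> real ^ 'n) \<Rightarrow> real \<Rightarrow> nat
    \<Rightarrow> ((real ^ 'n) \<times> real) \<times> (real ^ 'n) \<Rightarrow> ((real ^ 'n) \<times> real) \<times> (real ^ 'n) \<Rightarrow> real ^ 'n" where
  "descent' g g' \<tau> 0 y e = g' (fst y) (fst e)"
| "descent' g g' \<tau> (Suc m) y e = descent' g g' \<tau> m y e + \<tau> *\<^sub>R (snd e -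
     momentum' (fst (fst y), descent g \<tau> m y, snd (fst y)) (fst (fst e), descent' g g' \<tau> m y e, snd (fst e)))"

lemma C1_on_phase_point:
  assumes "C1_on (strip \<times> UNIV) (w :: ((real ^ 'n) \<times> real) \<times> (real ^ 'n) \<Rightarrow> real ^ 'n) w'"
  shows "C1_on (strip \<times> UNIV) (\<lambda>y. (fst (fst y), w y, snd (fst y))) (\<lambda>y e. (fst (fst e), w' y e, snd (fst e)))"
  by (intro C1_on_Pair assms C1_on_bounded_linear bounded_linear_compose[OF bounded_linear_fst bounded_linear_fst, unfolded o_def]
      bounded_linear_compose[OF bounded_linear_snd bounded_linear_fst, unfolded o_def])

lemma descent_C1:
  assumes g: "C1_on UNIV g g'"
  shows "C1_on (strip \<times> UNIV) (descent g \<tau> m) (descent' g g' \<tau> m)"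
proof (induction m)
  case 0
  have "C1_on (strip \<times> UNIV) (\<lambda>y :: ((real^'n) \<times> real) \<times> (real^'n). g (fst y)) (\<lambda>y e. g' (fst y) (fst e))"
    by (rule C1_on_compose[OF g C1_on_bounded_linear[OF bounded_linear_fst]]) auto
  then show ?case by simp
next
  case (Suc m)
  have "C1_on (strip \<times> UNIV) (\<lambda>y. descent g \<tau> m y + \<tau> *\<^sub>R (snd y - momentum (fst (fst y), descent g \<tau> m y, snd (fst y))))
    (\<lambda>y e. descent' g g' \<tau> m y e + (\<tau> *\<^sub>R (snd e - momentum' (fst (fst y), descent g \<tau> m y, snd (fst y)) (fst (fst e), descent' g g' \<tau> m y e, snd (fst e)))
       + 0 *\<^sub>R (snd y - momentum (fst (fst y), descent g \<tau> m y, snd (fst y)))))"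
    by (intro C1_on_add Suc C1_on_scaleR C1_on_const C1_on_diff C1_on_bounded_linear bounded_linear_snd
        C1_on_compose[OF momentum_C1 C1_on_phase_point[OF Suc]]) (auto simp: strip_def \<Omega>_def)
  then show ?case by simp
qed

text \<open>The vector \<open>v\<close> is a fixed point of the gradient step for the momentum at
  \<open>v\<close>. The mean value inequality along the segment from \<open>v\<close> to
  \<open>w\<close>, which stays in the ball of radius \<open>r\<close>, gives the factor
  \<open>q\<close>.\<close>

lemma momentum_contraction:
  assumes p: "(x, v, t) \<in> \<Omega>" and q: "0 \<le> q"
    and con: "\<And>w z. norm (w - v) \<le> r \<Longrightarrow> norm (z - \<tau> *\<^sub>R momentum' (x, w, t) (0, z, 0)) \<le> q * norm z"
    and w: "norm (w - v) \<le> r"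
  shows "norm (w + \<tau> *\<^sub>R (momentum (x, v, t) - momentum (x, w, t)) - v) \<le> q * norm (w - v)"
proof -
  define d where "d = w - v"
  define h where "h s = s *\<^sub>R d - \<tau> *\<^sub>R momentum (x, v + s *\<^sub>R d, t)" for s
  define h' where "h' s k = k *\<^sub>R d - \<tau> *\<^sub>R (k *\<^sub>R momentum' (x, v + s *\<^sub>R d, t) (0, d, 0))" for s k :: real
  have "norm (h 1 - h 0) \<le> (q * norm d) * norm (1 - 0 :: real)"
  proof (rule differentiable_bound[of "{0..1}"])
    fix s :: real assume s: "s \<in> {0..1}"
    have "(h has_derivative h' s) (at s)"
      unfolding h_def[abs_def] h'_def[abs_def]
      by (intro has_derivative_diff has_derivative_scaleR_left has_derivative_ident has_derivative_scaleR_right fiber_momentum_derivative p)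
    then show "(h has_derivative h' s) (at s within {0..1})" by (rule has_derivative_at_withinI)
    have "norm ((v + s *\<^sub>R d) - v) \<le> r" using s w mult_left_le_one_le[of "norm d" s] by (simp add: d_def)
    from con[OF this, of d] have *: "norm (d - \<tau> *\<^sub>R momentum' (x, v + s *\<^sub>R d, t) (0, d, 0)) \<le> q * norm d" .
    have "h' s k = k *\<^sub>R (d - \<tau> *\<^sub>R momentum' (x, v + s *\<^sub>R d, t) (0, d, 0))" for k
      by (simp add: h'_def algebra_simps)
    then show "onorm (h' s) \<le> q * norm d"
      using mult_right_mono[OF *] q by (intro onorm_bound) (auto simp: mult.commute)
  qed auto
  moreover have "h 1 - h 0 = w + \<tau> *\<^sub>R (momentum (x, v, t) - momentum (x, w, t)) - v"
    by (simp add: h_def d_def algebra_simps)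
  ultimately show ?thesis by (simp add: d_def)
qed

text \<open>The matrix inverse is avoided. By compactness the transposed Hessian is bounded below by
  \<open>l\<close> uniformly on the support, so the distance of two accelerations is controlled by
  the residual of one of them in the linear equation of the other; that residual is
  continuous.\<close>

lemma accel_cont: "continuous_on X accel"
proof (cases "X = {}")
  case True
  then show ?thesis by simp
next
  case False
  define T where "T p z = (\<chi> k. z \<bullet> momentum' p (unit_v k))" for p and z :: "real ^ 'n"
  define \<rho> where "\<rho> p = force p - momentum' p (fst (snd p), 0, 1)" for p
  have T_eq: "T p z = z v* Lvv t0 L p" for p z
    by (simp add: T_def vector_matrix_mult_def vec_eq_iff inner_vec_def momentum'_def Lvv_def mult.commute)
  have mc: "continuous_on X (\<lambda>p. momentum' p (k p))" if "continuous_on S k" for k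
    by (rule continuous_on_subset[OF momentum'_cont[OF that] X_S])
  have \<rho>c: "continuous_on X \<rho>"
    unfolding \<rho>_def by (intro continuous_on_diff continuous_on_subset[OF force_cont X_S] mc continuous_intros)
  let ?D = "X \<times> sphere (0 :: real ^ 'n) 1"
  have "continuous_on ?D (\<lambda>y. momentum' (fst y) (unit_v k))" for k
    by (rule continuous_on_compose2[OF mc[OF continuous_on_const]]) (auto intro: continuous_intros)
  then have cont: "continuous_on ?D (\<lambda>y. norm (T (fst y) (snd y)))"
    unfolding T_def by (intro continuous_intros continuous_on_vec_lambda)
  have comp: "compact ?D" by (intro compact_Times compact_X compact_sphere)
  have ne: "?D \<noteq> {}"
  proof -
    have "axis undefined 1 \<in> sphere (0 :: real ^ 'n) 1" by (simp add: norm_axis_1)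
    then show ?thesis using False by blast
  qed
  obtain y0 where y0: "y0 \<in> ?D" "\<And>y. y \<in> ?D \<Longrightarrow> norm (T (fst y0) (snd y0)) \<le> norm (T (fst y) (snd y))"
    using continuous_attains_inf[OF comp ne cont] by blast
  define l where "l = norm (T (fst y0) (snd y0))"
  have l: "l > 0"
  proof -
    have y: "fst y0 \<in> X" "snd y0 \<noteq> 0" using y0(1) by auto
    obtain A' where A': "Lvv t0 L (fst y0) ** A' = mat 1" using inv[OF y(1)] by (auto simp: invertible_def)
    have "T (fst y0) (snd y0) \<noteq> 0"
    proof
      assume "T (fst y0) (snd y0) = 0"
      then have "(snd y0 v* Lvv t0 L (fst y0)) v* A' = 0" by (simp add: T_eq)
      then show False using y(2) A' by (simp add: vector_matrix_mul_assoc)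
    qed
    then show ?thesis by (simp add: l_def)
  qed
  have low: "l * norm z \<le> norm (T p z)" if p: "p \<in> X" for p z
  proof (cases "z = 0")
    case True
    then show ?thesis by simp
  next
    case False
    have "T p (z /\<^sub>R norm z) = T p z /\<^sub>R norm z" by (simp add: T_def vec_eq_iff)
    moreover have "l \<le> norm (T p (z /\<^sub>R norm z))" using y0(2)[of "(p, z /\<^sub>R norm z)"] p False by (simp add: l_def)
    ultimately have "l \<le> norm (T p z) / norm z" by (simp add: divide_inverse mult.commute)
    then show ?thesis using False by (simp add: le_divide_eq)
  qed
  show ?thesis
    unfolding continuous_on_def
  proof
    fix q assume q: "q \<in> X"
    define E where "E p = norm (\<rho> p - T p (accel q)) / l" for p
    have "continuous_on X E"
      unfolding E_def T_def using l by (intro continuous_intros \<rho>c continuous_on_vec_lambda mc) auto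
    then have "(E \<longlongrightarrow> E q) (at q within X)" using q by (simp add: continuous_on_def)
    moreover have "E q = 0" using accel_eq[OF q] by (simp add: E_def T_eq \<rho>_def)
    ultimately have E0: "(E \<longlongrightarrow> 0) (at q within X)" by simp
    have "norm (accel p - accel q) \<le> E p" if p: "p \<in> X" for p
    proof -
      have "T p (accel p - accel q) = T p (accel p) - T p (accel q)"
        by (simp add: T_def vec_eq_iff inner_diff_left)
      also have "T p (accel p) = \<rho> p" using accel_eq[OF p] by (simp add: T_eq \<rho>_def)
      finally show ?thesis using low[OF p, of "accel p - accel q"] l by (simp add: E_def le_divide_eq mult.commute)
    qed
    then have "\<forall>\<^sub>F p in at q within X. norm (accel p - accel q) \<le> E p" by (simp add: eventually_at_filter)
    from Lim_null_comparison[OF this E0] show "(accel \<longlongrightarrow> accel q) (at q within X)" by (simp add: LIM_zero_iff)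
  qed
qed

text \<open>The values converge like \<open>q ^ m\<close>. The derivatives along (v, 1) with
  momentum rate \<open>force\<close> follow the linearized recursion, whose fixed point at the limit
  velocity is the acceleration by \<open>Euler_Lagrange\<close>; the varying coefficients act as a
  vanishing perturbation.\<close>

lemma descent_converges:
  assumes \<delta>: "\<delta> > 0"
  obtains g g' \<tau> Kc B where "C1_on UNIV g g'" "compact Kc" "Kc \<subseteq> \<Omega>"
    "\<And>p m. p \<in> XT \<delta> \<Longrightarrow> (fst p, descent g \<tau> m (proj_base p, momentum p), time p) \<in> Kc"
    "\<And>p. p \<in> XT \<delta> \<Longrightarrow> (\<lambda>m. descent g \<tau> m (proj_base p, momentum p)) \<longlonglongrightarrow> fst (snd p)"
    "\<And>p. p \<in> XT \<delta> \<Longrightarrow> (\<lambda>m. descent' g g' \<tau> m (proj_base p, momentum p) (lift p, force p)) \<longlonglongrightarrow> accel p"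
    "\<And>p m. p \<in> XT \<delta> \<Longrightarrow> norm (descent' g g' \<tau> m (proj_base p, momentum p) (lift p, force p)) \<le> B"
proof -
  obtain r \<tau> q Kc where r: "0 < r" and \<tau>: "0 < \<tau>" and q: "0 \<le> q" "q < 1" and Kc: "compact Kc" "Kc \<subseteq> \<Omega>"
    and inK: "\<And>x v t w. (x, v, t) \<in> XT \<delta> \<Longrightarrow> norm (w - v) \<le> r \<Longrightarrow> (x, w, t) \<in> Kc"
    and con: "\<And>x v t w z. (x, v, t) \<in> XT \<delta> \<Longrightarrow> norm (w - v) \<le> r \<Longrightarrow> norm (z - \<tau> *\<^sub>R momentum' (x, w, t) (0, z, 0)) \<le> q * norm z"
    by (rule contraction_constants[OF \<delta>]) (rule that, assumption+)
  obtain g g' where g: "C1_on UNIV (g :: (real ^ 'n) \<times> real \<Rightarrow> real ^ 'n) g'"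
    and g0: "\<And>p. p \<in> X \<Longrightarrow> norm (g (proj_base p) - fst (snd p)) < r"
    by (rule velocity_approx[OF r]) blast
  obtain \<Lambda>0 where \<Lambda>0: "\<Lambda>0 \<ge> 0" "\<And>p e. p \<in> Kc \<Longrightarrow> norm (momentum' p e) \<le> \<Lambda>0 * norm e"
    by (rule C1_on_deriv_bound[OF momentum_C1 Kc]) blast
  have fc: "continuous_on X force" by (rule continuous_on_subset[OF force_cont X_S])
  have ec: "continuous_on X (\<lambda>p. (fst (snd p), accel p, 1::real))" by (intro continuous_intros accel_cont)
  have gc: "continuous_on X (\<lambda>p. g' (proj_base p) (lift p) - accel p)"
    by (intro continuous_intros accel_cont C1_on_continuous_deriv[OF g continuous_on_proj_base]) auto
  obtain BF where BF: "\<And>p. p \<in> X \<Longrightarrow> norm (force p) \<le> BF" using fc by (rule continuous_bounded_X) blast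
  obtain BE where BE: "\<And>p. p \<in> X \<Longrightarrow> norm (fst (snd p), accel p, 1::real) \<le> BE" using ec by (rule continuous_bounded_X) blast
  obtain BA where BA: "\<And>p. p \<in> X \<Longrightarrow> norm (accel p) \<le> BA" using accel_cont by (rule continuous_bounded_X) blast
  obtain B0 where B0: "B0 > 0" "\<And>p. p \<in> X \<Longrightarrow> norm (g' (proj_base p) (lift p) - accel p) \<le> B0" using gc by (rule continuous_bounded_X) blast
  define Bb where "Bb = \<bar>\<tau> * (BF + \<Lambda>0 * BE)\<bar>"
  define y where "y p = (proj_base p, momentum p)" for p
  define w where "w p m = descent g \<tau> m (y p)" for p m
  define e where "e p m = descent' g g' \<tau> m (y p) (lift p, force p)" for p m
  have w_Suc: "w p (Suc m) = w p m + \<tau> *\<^sub>R (momentum p - momentum (fst p, w p m, time p))" for p m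
    by (simp add: w_def y_def proj_base_eq)
  have e_Suc: "e p (Suc m) = e p m + \<tau> *\<^sub>R (force p - momentum' (fst p, w p m, time p) (fst (snd p), e p m, 1))" for p m
    by (simp add: e_def w_def y_def proj_base_eq)
  have XTp: "p \<in> X" "p \<in> \<Omega>" if "p \<in> XT \<delta>" for p using that XT_\<Omega>[OF \<delta>] by (auto simp: XT_def)
  have wq: "norm (w p m - fst (snd p)) \<le> q ^ m * r" if p: "p \<in> XT \<delta>" for p m
  proof (induction m)
    case 0
    then show ?case using g0[OF XTp(1)[OF p]] by (simp add: w_def y_def)
  next
    case (Suc m)
    have pe: "(fst p, fst (snd p), time p) = p" by simp
    have "q ^ m * r \<le> r" using q r by (simp add: power_le_one mult_left_le_one_le)
    then have "norm (w p m - fst (snd p)) \<le> r" using Suc by linarith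
    then have "norm (w p (Suc m) - fst (snd p)) \<le> q * norm (w p m - fst (snd p))"
      using momentum_contraction[of "fst p" "fst (snd p)" "time p" q r \<tau> "w p m"] con[of "fst p" "fst (snd p)" "time p"]
        XTp(2)[OF p] q p unfolding pe w_Suc by blast
    also have "\<dots> \<le> q * (q ^ m * r)" by (intro mult_left_mono Suc q)
    finally show ?case by simp
  qed
  have wr: "norm (w p m - fst (snd p)) \<le> r" if p: "p \<in> XT \<delta>" for p m
  proof -
    have "q ^ m * r \<le> r" using q r by (simp add: power_le_one mult_left_le_one_le)
    then show ?thesis using wq[OF p, of m] by linarith
  qed
  have wK: "(fst p, w p m, time p) \<in> Kc" if p: "p \<in> XT \<delta>" for p m
    by (rule inK[of _ "fst (snd p)"]) (use p wr[OF p] in auto)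
  have wlim: "w p \<longlonglongrightarrow> fst (snd p)" if p: "p \<in> XT \<delta>" for p
  proof (rule LIM_zero_cancel, rule Lim_null_comparison[OF always_eventually], rule allI)
    show "norm (w p m - fst (snd p)) \<le> q ^ m * r" for m by (rule wq[OF p])
    show "(\<lambda>m. q ^ m * r) \<longlonglongrightarrow> 0" using q by (intro tendsto_mult_left_zero LIMSEQ_realpow_zero) auto
  qed
  define a where "a p m = norm (e p m - accel p)" for p m
  \<comment> \<open>The residual of the Euler-Lagrange equation when the Hessian and mixed
    derivatives are evaluated at the iterate instead of the true velocity. It vanishes in the limit
    and is uniformly bounded, which are the two inputs of the contraction lemmas.\<close>
  define b where "b p m = \<tau> * norm (force p - momentum' (fst p, w p m, time p) (fst (snd p), accel p, 1))" for p m
  have step: "a p (Suc m) \<le> q * a p m + b p m" if p: "p \<in> XT \<delta>" for p m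
  proof -
    let ?P = "(fst p, w p m, time p)" and ?z = "e p m - accel p"
    have lin: "linear (momentum' ?P)" using momentum'_linear \<Omega>_S Kc wK[OF p] by blast
    have "(fst (snd p), e p m, 1::real) = (fst (snd p), accel p, 1) + (0, ?z, 0)" by simp
    then have m': "momentum' ?P (fst (snd p), e p m, 1) = momentum' ?P (fst (snd p), accel p, 1) + momentum' ?P (0, ?z, 0)"
      using linear_add[OF lin] by metis
    let ?u = "?z - \<tau> *\<^sub>R momentum' ?P (0, ?z, 0)" and ?v = "\<tau> *\<^sub>R (force p - momentum' ?P (fst (snd p), accel p, 1))"
    have "e p (Suc m) - accel p = ?u + ?v"
      by (simp add: e_Suc m' algebra_simps)
    then have "a p (Suc m) = norm (?u + ?v)" by (simp only: a_def)
    also have "\<dots> \<le> norm ?u + norm ?v" by (rule norm_triangle_ineq)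
    also have "norm ?v = b p m" using \<tau> by (simp add: b_def)
    also have "norm (?z - \<tau> *\<^sub>R momentum' ?P (0, ?z, 0)) \<le> q * a p m"
      unfolding a_def by (rule con[of _ "fst (snd p)"]) (use p wr[OF p] in auto)
    finally show ?thesis by simp
  qed
  have blim: "b p \<longlonglongrightarrow> 0" if p: "p \<in> XT \<delta>" for p
  proof -
    have "(\<lambda>m. (fst p, w p m, time p)) \<longlonglongrightarrow> (fst p, fst (snd p), time p)" by (intro tendsto_intros wlim p)
    then have l: "(\<lambda>m. (fst p, w p m, time p)) \<longlonglongrightarrow> p" by simp
    have "(\<lambda>m. momentum' (fst p, w p m, time p) (fst (snd p), accel p, 1)) \<longlonglongrightarrow> momentum' p (fst (snd p), accel p, 1)"
      by (rule continuous_on_tendsto_compose[OF C1_onD(2)[OF momentum_C1] l XTp(2)[OF p]])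
         (intro always_eventually allI subsetD[OF Kc(2)] wK p)
    then have "b p \<longlonglongrightarrow> \<tau> * norm (force p - momentum' p (fst (snd p), accel p, 1))"
      unfolding b_def by (intro tendsto_intros)
    then show ?thesis using Euler_Lagrange[OF XTp[OF p]] by simp
  qed
  have bB: "b p m \<le> Bb" if p: "p \<in> XT \<delta>" for p m
  proof -
    have "norm (force p - momentum' (fst p, w p m, time p) (fst (snd p), accel p, 1)) \<le> BF + \<Lambda>0 * BE"
      using norm_triangle_ineq4[of "force p" "momentum' (fst p, w p m, time p) (fst (snd p), accel p, 1)"]
        BF[OF XTp(1)[OF p]] \<Lambda>0(2)[OF wK[OF p, of m], of "(fst (snd p), accel p, 1)"]
        mult_left_mono[OF BE[OF XTp(1)[OF p]] \<Lambda>0(1)] by linarith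
    then have "b p m \<le> \<tau> * (BF + \<Lambda>0 * BE)" unfolding b_def using \<tau> by (intro mult_left_mono) auto
    then show ?thesis by (simp add: Bb_def)
  qed
  have a0: "a p 0 \<le> B0" if p: "p \<in> XT \<delta>" for p
    using B0(2)[OF XTp(1)[OF p]] by (simp add: a_def e_def y_def)
  show thesis
  proof (rule that[OF g Kc])
    fix p assume p: "p \<in> XT \<delta>"
    show "(fst p, descent g \<tau> m (proj_base p, momentum p), time p) \<in> Kc" for m using wK[OF p] by (simp add: w_def y_def)
    show "(\<lambda>m. descent g \<tau> m (proj_base p, momentum p)) \<longlonglongrightarrow> fst (snd p)"
      using wlim[OF p] by (simp add: w_def[abs_def] y_def)
    have "a p \<longlonglongrightarrow> 0" by (rule contraction_tendsto[OF q step[OF p] blim[OF p]]) (simp add: a_def)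
    then have "(\<lambda>m. norm (e p m - accel p)) \<longlonglongrightarrow> 0" unfolding a_def[abs_def] .
    then have "e p \<longlonglongrightarrow> accel p" by (rule LIM_zero_cancel[OF tendsto_norm_zero_cancel])
    then show "(\<lambda>m. descent' g g' \<tau> m (proj_base p, momentum p) (lift p, force p)) \<longlonglongrightarrow> accel p"
      by (simp add: e_def[abs_def] y_def)
    fix m
    have "a p m \<le> B0 + Bb / (1 - q)"
      by (rule contraction_bounded[OF q step[OF p] bB[OF p] _ a0[OF p]]) (use B0 in \<open>auto simp: Bb_def\<close>)
    then have "norm (e p m) \<le> BA + (B0 + Bb / (1 - q))"
      using BA[OF XTp(1)[OF p]] norm_triangle_ineq[of "e p m - accel p" "accel p"] by (simp add: a_def)
    then show "norm (descent' g g' \<tau> m (proj_base p, momentum p) (lift p, force p)) \<le> BA + (B0 + Bb / (1 - q))"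
      by (simp add: e_def y_def)
  qed
qed

text \<open>The momentum identity is applied with the m-th iterate substituted for the velocity in
  \<open>\<psi>\<close>. As m grows, the iterate tends to the velocity and its derivative to the
  acceleration, boundedly on the support, so the integrals converge.\<close>

lemma invariance_with_cutoff:
  fixes \<psi> :: "'n phase \<Rightarrow> real"
  assumes \<psi>: "C1_on \<Omega> \<psi> \<psi>'" and \<delta>: "\<delta> > 0"
  shows "(LINT p|M. indicator (XT (2 * \<delta>)) p *
      (plateau t0 (2 * \<delta>) (time p) * \<psi>' p (EL_field t0 L p) + plateau_deriv t0 (2 * \<delta>) (time p) * \<psi> p)) = 0"
proof -
  let ?Y = "XT (2 * \<delta>)"
  define \<kappa> where "\<kappa> = plateau t0 (2 * \<delta>)"
  define \<kappa>' where "\<kappa>' = plateau_deriv t0 (2 * \<delta>)"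
  have d2: "2 * \<delta> > 0" using \<delta> by simp
  obtain g g' \<tau> Kc B where g: "C1_on UNIV g g'" and Kc: "compact Kc" "Kc \<subseteq> \<Omega>"
    and K: "\<And>p m. p \<in> ?Y \<Longrightarrow> (fst p, descent g \<tau> m (proj_base p, momentum p), time p) \<in> Kc"
    and wlim: "\<And>p. p \<in> ?Y \<Longrightarrow> (\<lambda>m. descent g \<tau> m (proj_base p, momentum p)) \<longlonglongrightarrow> fst (snd p)"
    and elim: "\<And>p. p \<in> ?Y \<Longrightarrow> (\<lambda>m. descent' g g' \<tau> m (proj_base p, momentum p) (lift p, force p)) \<longlonglongrightarrow> accel p"
    and eB: "\<And>p m. p \<in> ?Y \<Longrightarrow> norm (descent' g g' \<tau> m (proj_base p, momentum p) (lift p, force p)) \<le> B"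
    by (rule descent_converges[OF d2]) (rule that, assumption+)
  define w where "w p m = descent g \<tau> m (proj_base p, momentum p)" for p m
  define e where "e p m = descent' g g' \<tau> m (proj_base p, momentum p) (lift p, force p)" for p m
  have pc: "C1_on (strip \<times> UNIV) (\<lambda>y. (fst (fst y), descent g \<tau> m y, snd (fst y)))
      (\<lambda>y e. (fst (fst e), descent' g g' \<tau> m y e, snd (fst e)))" for m
    by (rule C1_on_phase_point[OF descent_C1[OF g]])
  have \<Psi>: "C1_on (strip \<times> UNIV) (\<lambda>y. \<psi> (fst (fst y), descent g \<tau> m y, snd (fst y)))
     (\<lambda>y e. \<psi>' (fst (fst y), descent g \<tau> m y, snd (fst y)) (fst (fst e), descent' g g' \<tau> m y e, snd (fst e)))" for m
    by (rule C1_on_compose[OF \<psi> pc]) (auto simp: strip_def \<Omega>_def)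
  define A where "A m p = indicator ?Y p * (\<kappa> (time p) * \<psi>' (fst p, w p m, time p) (fst (snd p), e p m, 1) + \<kappa>' (time p) * \<psi> (fst p, w p m, time p))" for m p
  have 0: "(LINT p|M. A m p) = 0" for m
    using momentum_identity[OF \<Psi> \<delta>, of m] unfolding A_def \<kappa>_def \<kappa>'_def w_def e_def by (simp add: proj_base_eq)
  have YX: "?Y \<subseteq> X" by (auto simp: XT_def)
  have \<kappa>C: "continuous_on UNIV \<kappa>" "continuous_on UNIV \<kappa>'"
    using C1_on_continuous_on[OF plateau_C1] C1_onD(2)[OF plateau_C1, of UNIV t0 "2 * \<delta>" 1] by (auto simp: \<kappa>_def \<kappa>'_def)
  have tc: "continuous_on X time" by (intro continuous_intros)
  have \<kappa>c: "continuous_on X (\<lambda>p. \<kappa> (time p))" "continuous_on X (\<lambda>p. \<kappa>' (time p))"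
    by (rule continuous_on_compose2[OF \<kappa>C(1) tc], simp, rule continuous_on_compose2[OF \<kappa>C(2) tc], simp)
  obtain B4 where B4: "\<And>p. p \<in> X \<Longrightarrow> norm (\<kappa>' (time p)) \<le> B4" using \<kappa>c(2) by (rule continuous_bounded_X) blast
  have \<kappa>r: "\<bar>\<kappa> t\<bar> \<le> 1" for t using plateau_range by (simp add: \<kappa>_def)
  obtain B1 where B1: "B1 \<ge> 0" "\<And>z e. z \<in> Kc \<Longrightarrow> norm (\<psi>' z e) \<le> B1 * norm e"
    by (rule C1_on_deriv_bound[OF \<psi> Kc]) blast
  have "compact (\<psi> ` Kc)" by (intro compact_continuous_image Kc(1) continuous_on_subset[OF C1_on_continuous_on[OF \<psi>] Kc(2)])
  then obtain B2 where B2: "\<And>z. z \<in> Kc \<Longrightarrow> norm (\<psi> z) \<le> B2" by (meson bounded_iff compact_imp_bounded imageI)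
  have vc: "continuous_on X (\<lambda>p :: 'n phase. fst (snd p))" by (intro continuous_intros)
  obtain B3 where B3: "\<And>p. p \<in> X \<Longrightarrow> norm (fst (snd p)) \<le> B3" using vc by (rule continuous_bounded_X) blast
  have Y\<Omega>: "?Y \<subseteq> \<Omega>" by (rule XT_\<Omega>[OF d2])
  have "(\<lambda>m. LINT p|M. A m p) \<longlonglongrightarrow> (LINT p|M. indicator ?Y p * (\<kappa> (time p) * \<psi>' p (EL_field t0 L p) + \<kappa>' (time p) * \<psi> p))"
  proof (rule dominated_M[where B="\<bar>B1 * (B3 + B + 1) + B4 * B2\<bar>"])
    fix m
    have yc: "continuous_on ?Y (\<lambda>p. (proj_base p, momentum p))"
      by (intro continuous_intros continuous_on_subset[OF momentum_cont]) (use YX X_S in auto)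
    have yS: "(proj_base p, momentum p) \<in> strip \<times> UNIV" if "p \<in> ?Y" for p
      using that Y\<Omega> by (auto simp: strip_def \<Omega>_def proj_base_eq)
    have wc: "continuous_on ?Y (\<lambda>p. w p m)"
      unfolding w_def by (rule continuous_on_compose2[OF C1_on_continuous_on[OF descent_C1[OF g]] yc]) (use yS in auto)
    have lc: "continuous_on ?Y (\<lambda>p. (lift p, force p))"
      by (intro continuous_intros continuous_on_subset[OF force_cont]) (use YX X_S in auto)
    have ec: "continuous_on ?Y (\<lambda>p. e p m)"
      unfolding e_def by (rule C1_on_continuous_deriv[OF descent_C1[OF g] yc yS lc])
    have Pc: "continuous_on ?Y (\<lambda>p. (fst p, w p m, time p))" by (intro continuous_intros wc)
    have PO: "(fst p, w p m, time p) \<in> \<Omega>" if "p \<in> ?Y" for p using K[OF that] Kc by (auto simp: w_def)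
    show "A m \<in> borel_measurable M"
      unfolding A_def
    proof (rule measurable_indicator_XT, intro continuous_intros)
      show "continuous_on ?Y (\<lambda>p. \<kappa> (time p))" "continuous_on ?Y (\<lambda>p. \<kappa>' (time p))"
        using \<kappa>c YX continuous_on_subset by blast+
      show "continuous_on ?Y (\<lambda>p. \<psi>' (fst p, w p m, time p) (fst (snd p), e p m, 1))"
        by (intro C1_on_continuous_deriv[OF \<psi> Pc PO] continuous_intros ec)
      show "continuous_on ?Y (\<lambda>p. \<psi> (fst p, w p m, time p))"
        by (rule continuous_on_compose2[OF C1_on_continuous_on[OF \<psi>] Pc]) (use PO in auto)
    qed
    fix p assume p: "p \<in> X"
    show "\<bar>A m p\<bar> \<le> \<bar>B1 * (B3 + B + 1) + B4 * B2\<bar>"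
    proof (cases "p \<in> ?Y")
      case True
      have kk: "(fst p, w p m, time p) \<in> Kc" using K[OF True] by (simp add: w_def)
      have "norm (fst (snd p), e p m, 1::real) \<le> B3 + B + 1"
        using norm_Pair_le[of "fst (snd p)" "(e p m, 1::real)"] norm_Pair_le[of "e p m" "1::real"] B3[OF p] eB[OF True, of m]
        by (simp add: e_def)
      then have "\<bar>\<psi>' (fst p, w p m, time p) (fst (snd p), e p m, 1)\<bar> \<le> B1 * (B3 + B + 1)"
        using B1(2)[OF kk, of "(fst (snd p), e p m, 1)"] mult_left_mono[OF _ B1(1), of "norm (fst (snd p), e p m, 1::real)" "B3 + B + 1"]
        by simp
      then have "\<bar>\<kappa> (time p) * \<psi>' (fst p, w p m, time p) (fst (snd p), e p m, 1)\<bar> \<le> 1 * (B1 * (B3 + B + 1))"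
        unfolding abs_mult using \<kappa>r by (intro mult_mono) auto
      moreover have "\<bar>\<kappa>' (time p) * \<psi> (fst p, w p m, time p)\<bar> \<le> B4 * B2"
        unfolding abs_mult using B4[OF p] B2[OF kk] by (intro mult_mono) auto
      ultimately show ?thesis using True by (simp add: A_def)
    qed (simp add: A_def)
  next
    fix p assume p: "p \<in> X"
    show "(\<lambda>m. A m p) \<longlonglongrightarrow> indicator ?Y p * (\<kappa> (time p) * \<psi>' p (EL_field t0 L p) + \<kappa>' (time p) * \<psi> p)"
    proof (cases "p \<in> ?Y")
      case True
      have "(\<lambda>m. (fst p, w p m, time p)) \<longlonglongrightarrow> (fst p, fst (snd p), time p)" using wlim[OF True] by (intro tendsto_intros) (simp add: w_def)
      then have l: "(\<lambda>m. (fst p, w p m, time p)) \<longlonglongrightarrow> p" by simp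
      have "(fst p, w p m, time p) \<in> \<Omega>" for m using K[OF True, of m] Kc by (auto simp: w_def)
      then have ev: "\<forall>\<^sub>F m in sequentially. (fst p, w p m, time p) \<in> \<Omega>" by simp
      have pO: "p \<in> \<Omega>" using True Y\<Omega> by blast
      have "(\<lambda>m. \<psi> (fst p, w p m, time p)) \<longlonglongrightarrow> \<psi> p"
        by (rule continuous_on_tendsto_compose[OF C1_on_continuous_on[OF \<psi>] l pO ev])
      moreover have "(\<lambda>m. \<psi>' (fst p, w p m, time p) (fst (snd p), e p m, 1)) \<longlonglongrightarrow> \<psi>' p (fst (snd p), accel p, 1)"
      proof -
        \<comment> \<open>Base point and increment both vary with m, so continuity for a fixed
          increment does not suffice here.\<close>
        have jc: "continuous_on (\<Omega> \<times> UNIV) (\<lambda>y. \<psi>' (fst y) (snd y))"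
          by (intro C1_on_continuous_deriv[OF \<psi>] continuous_intros) auto
        have "(\<lambda>m. ((fst p, w p m, time p), (fst (snd p), e p m, 1::real))) \<longlonglongrightarrow> (p, (fst (snd p), accel p, 1))"
          using elim[OF True] by (intro tendsto_intros l) (simp add: e_def)
        from continuous_on_tendsto_compose[OF jc this] show ?thesis using pO ev by simp
      qed
      ultimately show ?thesis unfolding A_def EL_field_eq by (intro tendsto_intros)
    qed (simp add: A_def)
  qed
  then show ?thesis unfolding 0 by (simp add: LIMSEQ_const_iff \<kappa>_def \<kappa>'_def)
qed

end

section \<open>Removal of the cutoff in time\<close>

lemma smooth_step_deriv_bounded: obtains B where "B > 0" "\<And>s. \<bar>smooth_step_deriv s\<bar> \<le> B"
proof -
  have "continuous_on {0..1} smooth_step_deriv"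
    using C1_onD(2)[OF smooth_step_C1, of 1] by (auto intro: continuous_on_subset)
  then have "bounded (smooth_step_deriv ` {0..1})" by (intro compact_imp_bounded compact_continuous_image) auto
  then obtain B where B: "B > 0" "\<And>y. y \<in> smooth_step_deriv ` {0..1} \<Longrightarrow> norm y \<le> B" by (auto simp: bounded_pos)
  show thesis
  proof (rule that[OF B(1)])
    show "\<bar>smooth_step_deriv s\<bar> \<le> B" for s
      using B(2)[of "smooth_step_deriv s"] B(1) smooth_step_deriv_0[of s] by (cases "s \<in> {0..1}") auto
  qed
qed

lemma plateau_deriv_bounded:
  obtains B where "B > 0" "\<And>T \<delta> t. \<delta> > 0 \<Longrightarrow> \<bar>plateau_deriv T \<delta> t\<bar> \<le> B / \<delta>"
proof -
  obtain B where B: "B > 0" "\<And>s. \<bar>smooth_step_deriv s\<bar> \<le> B" by (rule smooth_step_deriv_bounded) blast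
  have sr: "\<bar>smooth_step s\<bar> \<le> 1" for s using smooth_step_range[of s] by simp
  show thesis
  proof (rule that[of "2 * B"])
    fix T \<delta> t :: real assume \<delta>: "\<delta> > 0"
    have "\<bar>plateau_deriv T \<delta> t\<bar> \<le> \<bar>smooth_step ((t - \<delta>) / \<delta>)\<bar> * (\<bar>smooth_step_deriv ((T - \<delta> - t) / \<delta>)\<bar> * (1 / \<delta>))
       + \<bar>smooth_step_deriv ((t - \<delta>) / \<delta>)\<bar> * (1 / \<delta>) * \<bar>smooth_step ((T - \<delta> - t) / \<delta>)\<bar>"
      unfolding plateau_deriv_def using \<delta>
      by (intro order_trans[OF abs_triangle_ineq]) (simp add: abs_mult)
    also have "\<dots> \<le> 1 * (B * (1 / \<delta>)) + B * (1 / \<delta>) * 1"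
      using \<delta> B by (intro add_mono mult_mono sr) auto
    finally show "\<bar>plateau_deriv T \<delta> t\<bar> \<le> 2 * B / \<delta>" by simp
  qed (use B in simp)
qed

context el_minimizer
begin

text \<open>The derivative of the cutoff has order 1 / \<delta>, but it lives where the time is
  within order \<delta> of an end, and there \<open>\<phi>\<close> has order \<delta>. The cutoff
  term is therefore bounded; it also vanishes pointwise in the limit.\<close>

theorem EL_invariant: "EL_invariant U t0 L \<mu>"
  unfolding EL_invariant_def set_integral_M
proof (intro allI impI, elim conjE)
  fix \<phi> assume test: "test_fun U t0 \<phi>" and van: "\<forall>x\<in>U. \<forall>v. \<phi> (x, v, 0) = 0 \<and> \<phi> (x, v, t0) = 0"
  let ?S = "phase U t0"
  obtain K where K: "compact K" "K \<subseteq> ?S" "\<And>p. p \<in> ?S - K \<Longrightarrow> \<phi> p = 0"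
    and "smooth_fun_on ?S \<phi>" using test by (auto simp: test_fun_def)
  then have "Ck_on (Suc 0) ?S \<phi>" unfolding smooth_fun_on_def by blast
  then have \<phi>d: "\<phi> differentiable_on ?S" and \<phi>c: "\<forall>e\<in>Basis. continuous_on ?S (dir_deriv ?S e \<phi>)" by auto
  define S1 where "S1 = \<Omega> \<inter> (U \<times> UNIV)"
  have S1: "open S1" unfolding S1_def by (intro open_Int open_\<Omega> open_Times U open_UNIV)
  have S1S: "S1 \<subseteq> interior ?S" by (rule interior_maximal[OF _ S1]) (auto simp: S1_def \<Omega>_def phase_def)
  have \<phi>C: "C1_on S1 \<phi> (\<lambda>z e. dir_deriv ?S e \<phi> z)"
    by (rule C1_on_subset[OF dir_deriv_C1[OF \<phi>d \<phi>c] S1S])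
  \<comment> \<open>\<open>K\<close> may reach the end times, so the zero extension is C^1 on
    \<open>S1 \<union> - K\<close>. This set contains \<open>\<Omega>\<close>, because
    \<open>K\<close> lies over \<open>U\<close>.\<close>
  define \<psi> where "\<psi> z = (if z \<in> S1 then \<phi> z else 0)" for z
  define \<psi>' where "\<psi>' z e = (if z \<in> K then dir_deriv ?S e \<phi> z else 0)" for z e
  have "C1_on (S1 \<union> - K) \<psi> \<psi>'"
    unfolding \<psi>_def[abs_def] \<psi>'_def[abs_def]
    by (rule C1_on_extend_zero_Un[OF \<phi>C S1 compact_imp_closed[OF K(1)]])
       (use K(3) S1S interior_subset in blast)
  then have \<psi>C: "C1_on \<Omega> \<psi> \<psi>'"
    by (rule C1_on_subset) (use K(2) in \<open>auto simp: S1_def phase_def\<close>)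
  define H where "H p = dir_deriv ?S (EL_field t0 L p) \<phi> p" for p
  have XS1: "p \<in> S1" if "p \<in> X" "p \<in> \<Omega>" for p using that X_sub by (auto simp: S1_def phase_def mem_Times_iff)
  have \<psi>_eq: "\<psi> p = \<phi> p" "\<psi>' p (EL_field t0 L p) = H p" if p: "p \<in> X" "p \<in> \<Omega>" for p
  proof -
    show "\<psi> p = \<phi> p" using XS1[OF p] by (simp add: \<psi>_def)
    have "(\<psi> has_derivative \<psi>' p) (at p)" using C1_onD(1)[OF \<psi>C p(2)] .
    then have "(\<phi> has_derivative \<psi>' p) (at p)"
      by (rule has_derivative_transform_within_open[OF _ S1 XS1[OF p]]) (simp add: \<psi>_def)
    from has_derivative_unique[OF this C1_onD(1)[OF \<phi>C XS1[OF p]]]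
    show "\<psi>' p (EL_field t0 L p) = H p" by (simp add: H_def)
  qed
  have Hc: "continuous_on X H"
    unfolding H_def EL_field_eq
    by (intro dir_deriv_continuous[OF \<phi>d \<phi>c] continuous_intros accel_cont) (use X_sub in auto)
  obtain BH where BH: "\<And>p. p \<in> X \<Longrightarrow> norm (H p) \<le> BH" using Hc by (rule continuous_bounded_X) blast
  \<comment> \<open>The support swept through all times of I. It contains the segments in time that
    join a support point to the ends, and on this compact set the time derivative of
    \<open>\<phi>\<close> is bounded.\<close>
  define X' where "X' = (\<lambda>y. (fst (fst y), fst (snd (fst y)), snd y)) ` (X \<times> {0..t0})"
  have X': "compact X'" "X' \<subseteq> ?S"
  proof -
    show "compact X'" unfolding X'_def
      by (intro compact_continuous_image compact_Times compact_X compact_Icc continuous_intros)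
    show "X' \<subseteq> ?S" using X_sub by (auto simp: X'_def phase_def)
  qed
  have "continuous_on X' (dir_deriv ?S unit_t \<phi>)"
    using \<phi>c unit_Basis(3) X'(2) by (auto intro: continuous_on_subset)
  then have "bounded (dir_deriv ?S unit_t \<phi> ` X')" by (intro compact_imp_bounded compact_continuous_image X')
  then obtain C where C: "C > 0" "\<And>p. p \<in> X' \<Longrightarrow> \<bar>dir_deriv ?S unit_t \<phi> p\<bar> \<le> C" by (auto simp: bounded_pos)
  have \<phi>_time: "\<bar>\<phi> (x, v, b) - \<phi> (x, v, a)\<bar> \<le> C * (b - a)"
    if p: "(x, v, t) \<in> X" and ab: "0 \<le> a" "a \<le> b" "b \<le> t0" for x v t a b
  proof (cases "a = b")
    case True
    then show ?thesis by simp
  next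
    case False
    then have ab': "a < b" using ab by simp
    have inS: "(x, v, s) \<in> ?S" "(x, v, s) \<in> X'" if "0 \<le> s" "s \<le> t0" for s
      using p X_sub that by (auto simp: phase_def X'_def intro!: image_eqI[of _ _ "((x, v, t), s)"])
    obtain s where s: "a < s" "s < b" "\<phi> (x, v, b) - \<phi> (x, v, a) = dir_deriv ?S unit_t \<phi> (x, v, s) * (b - a)"
    proof (rule mvt[OF ab', of "\<lambda>s. \<phi> (x, v, s)" "\<lambda>s h. dir_deriv ?S unit_t \<phi> (x, v, s) * h"])
      show "continuous_on {a..b} (\<lambda>s. \<phi> (x, v, s))"
          by (rule continuous_on_compose2[OF differentiable_imp_continuous_on[OF \<phi>d]])
             (use inS ab in \<open>auto intro!: continuous_intros\<close>)
        fix s assume s: "a < s" "s < b"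
        have "(x, v, s) \<in> S1" using p X_sub s ab by (auto simp: S1_def \<Omega>_def phase_def)
        note d = C1_onD(1)[OF \<phi>C this]
        have i: "((\<lambda>s. (x, v, s)) has_derivative (\<lambda>h. h *\<^sub>R (0, 0, 1))) (at s)"
          by (auto intro!: derivative_eq_intros)
        have "dir_deriv ?S (h *\<^sub>R (0, 0, 1)) \<phi> (x, v, s) = dir_deriv ?S unit_t \<phi> (x, v, s) * h" for h
          using linear_scale[OF bounded_linear.linear[OF has_derivative_bounded_linear[OF d]], of h "unit_t"]
          by (simp add: unit_t_def)
        with has_derivative_compose[OF i d]
        show "((\<lambda>s. \<phi> (x, v, s)) has_derivative (\<lambda>h. dir_deriv ?S unit_t \<phi> (x, v, s) * h)) (at s)" by simp
    qed blast
    show ?thesis unfolding s(3) abs_mult using C(2)[of "(x, v, s)"] inS[of s] s ab by (intro mult_mono) auto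
  qed
  \<comment> \<open>The mean value theorem from either end, where \<open>\<phi>\<close> vanishes;
    this linear bound compensates the size of the cutoff derivative.\<close>
  have \<phi>_ends: "\<bar>\<phi> p\<bar> \<le> C * time p" "\<bar>\<phi> p\<bar> \<le> C * (t0 - time p)" if p: "p \<in> X" for p
  proof -
    obtain x v t where pe: "p = (x, v, t)" by (cases p)
    have t: "0 \<le> t" "t \<le> t0" "x \<in> U" using p X_sub by (auto simp: pe phase_def)
    show "\<bar>\<phi> p\<bar> \<le> C * time p" "\<bar>\<phi> p\<bar> \<le> C * (t0 - time p)"
      using \<phi>_time[of x v t 0 t] \<phi>_time[of x v t t t0] p t van by (auto simp: pe)
  qed
  obtain B where B: "B > 0" "\<And>T \<delta> t. \<delta> > 0 \<Longrightarrow> \<bar>plateau_deriv T \<delta> t\<bar> \<le> B / \<delta>" by (rule plateau_deriv_bounded) blast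
  define \<delta> where "\<delta> k = 1 / real (Suc k)" for k
  have \<delta>: "\<delta> k > 0" for k by (simp add: \<delta>_def)
  define s where "s k p = indicator (XT (2 * \<delta> k)) p * (plateau t0 (2 * \<delta> k) (time p) * H p + plateau_deriv t0 (2 * \<delta> k) (time p) * \<phi> p)" for k p
  have s0: "(LINT p|M. s k p) = 0" for k
  proof -
    have "(LINT p|M. s k p) = (LINT p|M. indicator (XT (2 * \<delta> k)) p *
      (plateau t0 (2 * \<delta> k) (time p) * \<psi>' p (EL_field t0 L p) + plateau_deriv t0 (2 * \<delta> k) (time p) * \<psi> p))"
    proof (rule Bochner_Integration.integral_cong[OF refl])
      fix p assume "p \<in> space M"
      then show "s k p = indicator (XT (2 * \<delta> k)) p *
        (plateau t0 (2 * \<delta> k) (time p) * \<psi>' p (EL_field t0 L p) + plateau_deriv t0 (2 * \<delta> k) (time p) * \<psi> p)"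
        using \<psi>_eq[of p] XT_\<Omega>[of "2 * \<delta> k"] \<delta>[of k] by (cases "p \<in> XT (2 * \<delta> k)") (auto simp: s_def)
    qed
    then show ?thesis using invariance_with_cutoff[OF \<psi>C \<delta>] by simp
  qed
  \<comment> \<open>A fixed point at an interior time eventually lies where the plateau equals 1 and
    has derivative 0; points at the end times never enter. Hence the limit with the indicator of
    \<open>\<Omega>\<close>.\<close>
  have "(\<lambda>k. LINT p|M. s k p) \<longlonglongrightarrow> (LINT p|M. indicator \<Omega> p * H p)"
  proof (rule dominated_M[where B="BH + 2 * B * C"])
    fix k
    have YX: "XT (2 * \<delta> k) \<subseteq> X" by (auto simp: XT_def)
    have pc: "continuous_on A (\<lambda>p :: 'n phase. plateau t0 (2 * \<delta> k) (time p))" "continuous_on A (\<lambda>p :: 'n phase. plateau_deriv t0 (2 * \<delta> k) (time p))" for A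
    proof -
      have "continuous_on UNIV (plateau t0 (2 * \<delta> k))" "continuous_on UNIV (plateau_deriv t0 (2 * \<delta> k))"
        using C1_on_continuous_on[OF plateau_C1] C1_onD(2)[OF plateau_C1, of UNIV t0 "2 * \<delta> k" 1] by auto
      then show "continuous_on A (\<lambda>p :: 'n phase. plateau t0 (2 * \<delta> k) (time p))" "continuous_on A (\<lambda>p :: 'n phase. plateau_deriv t0 (2 * \<delta> k) (time p))"
        by (auto intro!: continuous_on_compose2[of UNIV _ A "\<lambda>p :: 'n phase. time p"] continuous_intros)
    qed
    show "s k \<in> borel_measurable M"
      unfolding s_def
      by (rule measurable_indicator_XT)
         (intro continuous_intros pc continuous_on_subset[OF Hc YX]
           continuous_on_subset[OF differentiable_imp_continuous_on[OF \<phi>d] order_trans[OF YX X_sub]])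
    fix p assume p: "p \<in> X"
    have 1: "\<bar>plateau t0 (2 * \<delta> k) (time p) * H p\<bar> \<le> 1 * BH"
      unfolding abs_mult using plateau_range[of t0 "2 * \<delta> k" "time p"] BH[OF p] by (intro mult_mono) auto
    have 2: "\<bar>plateau_deriv t0 (2 * \<delta> k) (time p) * \<phi> p\<bar> \<le> 2 * B * C"
    proof (cases "2 * (2 * \<delta> k) \<le> time p \<and> time p \<le> t0 - 2 * (2 * \<delta> k)")
      case True
      then show ?thesis using plateau_inside(2)[of "2 * \<delta> k" "time p" t0] \<delta>[of k] B(1) C(1) by simp
    next
      case False
      have "\<bar>\<phi> p\<bar> \<le> C * (2 * (2 * \<delta> k))"
      proof (cases "2 * (2 * \<delta> k) \<le> time p")
        case True
        then have "t0 - time p \<le> 2 * (2 * \<delta> k)" using False by linarith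
        from mult_left_mono[OF this, of C] show ?thesis using \<phi>_ends(2)[OF p] C(1) by linarith
      next
        case False
        then have "time p \<le> 2 * (2 * \<delta> k)" by simp
        from mult_left_mono[OF this, of C] show ?thesis using \<phi>_ends(1)[OF p] C(1) by linarith
      qed
      \<comment> \<open>The cutoff parameter is \<open>2 * \<delta> k\<close>, so its layers reach
        up to distance \<open>2 * (2 * \<delta> k)\<close> from the ends; the powers of
        \<open>\<delta> k\<close> cancel.\<close>
      then have "\<bar>plateau_deriv t0 (2 * \<delta> k) (time p)\<bar> * \<bar>\<phi> p\<bar> \<le> (B / (2 * \<delta> k)) * (C * (2 * (2 * \<delta> k)))"
        using B \<delta>[of k] by (intro mult_mono) auto
      also have "\<dots> = 2 * B * C" using \<delta>[of k] by (simp add: field_simps)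
      finally show ?thesis by (simp add: abs_mult)
    qed
    have "0 \<le> BH" using BH[OF p] norm_ge_zero order_trans by blast
    then show "\<bar>s k p\<bar> \<le> BH + 2 * B * C" using 1 2 B(1) C(1) by (auto simp: s_def indicator_def)
  next
    fix p assume p: "p \<in> X"
    show "(\<lambda>k. s k p) \<longlonglongrightarrow> indicator \<Omega> p * H p"
    proof (cases "p \<in> \<Omega>")
      case True
      then have t: "0 < time p" "time p < t0" by (auto simp: \<Omega>_def)
      have "(\<lambda>k. 2 * (2 * \<delta> k)) \<longlonglongrightarrow> 0" unfolding \<delta>_def by real_asymp
      then have "\<forall>\<^sub>F k in sequentially. 2 * (2 * \<delta> k) < min (time p) (t0 - time p)"
        by (rule order_tendstoD(2)) (use t in auto)
      then have "\<forall>\<^sub>F k in sequentially. s k p = indicator \<Omega> p * H p"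
      proof eventually_elim
        case (elim k)
        then have "p \<in> XT (2 * \<delta> k)" using p \<delta>[of k] by (auto simp: XT_def)
        then show ?case using plateau_inside[of "2 * \<delta> k" "time p" t0] elim \<delta>[of k] True by (simp add: s_def)
      qed
      then show ?thesis by (rule tendsto_eventually)
    next
      case False
      then have "p \<notin> XT (2 * \<delta> k)" for k using XT_\<Omega>[of "2 * \<delta> k"] \<delta>[of k] by auto
      then show ?thesis using False by (simp add: s_def)
    qed
  qed
  then have 0: "(LINT p|M. indicator \<Omega> p * H p) = 0" unfolding s0 by (simp add: LIMSEQ_const_iff)
  have Hm: "H \<in> borel_measurable M" by (rule measurable_M[OF Hc])
  \<comment> \<open>The set of support points at the end times is null, so dropping the indicator
    does not change the integral.\<close>
  have "(LINT p|M. H p) = (LINT p|M. indicator \<Omega> p * H p)"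
  proof (rule integral_cong_AE[OF Hm])
    have "\<Omega> \<in> sets borel" using open_\<Omega> by simp
    then have "(indicator \<Omega> :: 'n phase \<Rightarrow> real) \<in> borel_measurable \<mu>" by (simp add: measurable_cong_sets[OF sets_\<mu> refl])
    then have "(indicator \<Omega> :: 'n phase \<Rightarrow> real) \<in> borel_measurable M" unfolding M_def by (rule measurable_restrict_space1)
    then show "(\<lambda>p. indicator \<Omega> p * H p) \<in> borel_measurable M" using Hm by measurable
    show "AE p in M. H p = indicator \<Omega> p * H p"
      using measure_time_ends by eventually_elim (auto simp: \<Omega>_def mem_Times_iff indicator_def)
  qed
  then show "(LINT p|M. dir_deriv ?S (EL_field t0 L p) \<phi> p) = 0" using 0 by (simp add: H_def)
qed

end

theorem corollary36:
  fixes U :: "(real ^ 'n::finite) set"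
    and t0 c :: real
    and L :: "'n phase \<Rightarrow> real"
    and \<mu> :: "'n phase measure"
    and f :: "(real ^ 'n) \<times> real \<Rightarrow> real"
  assumes "open U" and "t0 > 0"
    and "C2_Lip_on (phase UNIV t0) L"
    and "closed_in U t0 \<mu>"
    and "\<exists>W. openin (top_of_set (phase UNIV t0)) W \<and> msupport \<mu> \<subseteq> W \<and>
           (\<forall>p\<in>W. invertible (Lvv t0 L p))"
    and "minimizable_by t0 \<mu> (\<lambda>p. L p + c) f"
    and "\<forall>(x, t) \<in> proj_base ` msupport \<mu>.
           \<exists>!v. L (x, v, t) + c = total_deriv UNIV t0 f (x, v, t)"
  shows "EL_invariant U t0 L \<mu>"
proof -
  interpret el_minimizer U t0 \<mu> L c f
  proof unfold_locales
    show "Ck_on 2 (phase UNIV t0) L" using assms(3) by (simp add: C2_Lip_on_def)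
    show "invertible (Lvv t0 L p)" if "p \<in> msupport \<mu>" for p using assms(5) that by blast
    show "\<exists>!v. L (x, v, t) + c = total_deriv UNIV t0 f (x, v, t)" if "(x, t) \<in> proj_base ` msupport \<mu>" for x t
      using assms(7) that by blast
  qed (use assms in auto)
  show ?thesis by (rule EL_invariant)
qed

end
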